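(* Let $\Bbbk$ be an algebraically closed field of characteristic $p>2$, and let $A$ and the $A$-modules $S_\gamma$, $T_{\alpha,\beta}$, $V_{\alpha,\beta,\gamma}$ be as defined in the context. Then the set of isomorphism classes of simple $A$-modules is $$\widehat{A}=\{[S_\gamma]\mid\gamma\in\Bbbk^{\times}\}\cup\{[T_{\alpha,\beta}]\mid\alpha,\beta\in\Bbbk^{\times}\}\cup\{[V_{\alpha,\beta,\gamma}]\mid\alpha,\beta\in\Bbbk^{\times},\gamma\in\Bbbk\}.$$
   Context: All modules are left modules; $[M]$ denotes the isomorphism class of $M$. $A$ (the bosonization of the super Jordan plane) is the $\Bbbk$-algebra generated by $x,y,g,g^{-1}$ with relations $x^2=0$, $ys-sy-xs=0$ where $s:=xy+yx$, $gg^{-1}=g^{-1}g=1$, $gxg^{-1}=-x$, $gyg^{-1}=-y+x$. $\langle\cdots\rangle$ denotes the two-sided ideal generated by the listed elements. For $\gamma\in\Bbbk^{\times}$, $S_\gamma:=A/\langle s,x,y,g-\gamma\rangle$. For $\alpha,\beta\in\Bbbk^{\times}$, $T_{\alpha,\beta}=\Bbbk e_0\oplus\Bbbk e_1$ with $se_i=xe_i=0$ $(i=0,1)$, $ye_0=\alpha e_0$, $ye_1=-\alpha e_1$, $ge_0=e_1$, $ge_1=\beta e_0$. For $\alpha,\beta\in\Bbbk^{\times}$ and $\gamma\in\Bbbk$, $V_{\alpha,\beta,\gamma}$ is the $2p$-dimensional $A$-module with basis $v_0,\dots,v_{p-1},w_0,\dots,w_{p-1}$ and action: $xv_i=0$ and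 $xw_i=v_i$ for $0\le i\le p-1$; $yv_i=w_{i+1}$ for $0\le i\le p-2$ and $yv_{p-1}=\beta w_0$; $yw_i=(i+1)v_i+\gamma v_{i+1}$ for $0\le i\le p-2$ and $yw_{p-1}=\beta\gamma v_0$; $gv_i=-\alpha^{-1}v_{i+1}$ for $0\le i\le p-2$ and $gv_{p-1}=-\alpha^{-1}\beta v_0$; $gw_i=\alpha^{-1}w_{i+1}$ for $0\le i\le p-2$ and $gw_{p-1}=\alpha^{-1}\beta w_0$. *)

theory Defs
  imports "HOL-Algebra.Algebra" "HOL-Algebra.Algebraic_Closure_Type" "HOL-Library.Poly_Mapping"
begin

text \<open>Left modules over a not necessarily commutative ring. HOL-Algebra has the locale
  \<^locale>\<open>module\<close> for commutative rings only; its record and its notion of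
  \<^locale>\<open>submodule\<close> are reused. The fields \<open>mult\<close> and \<open>one\<close> of the record are irrelevant.\<close>

locale left_module = R?: ring R + M?: abelian_group M
  for R :: "'r ring" (structure) and M :: "('r, 'm) module" (structure) +
  assumes smult_closed: "a \<in> carrier R \<Longrightarrow> u \<in> carrier M \<Longrightarrow> a \<odot>\<^bsub>M\<^esub> u \<in> carrier M"
    and smult_l_distr: "a \<in> carrier R \<Longrightarrow> b \<in> carrier R \<Longrightarrow> u \<in> carrier M \<Longrightarrow>
      (a \<oplus>\<^bsub>R\<^esub> b) \<odot>\<^bsub>M\<^esub> u = a \<odot>\<^bsub>M\<^esub> u \<oplus>\<^bsub>M\<^esub> b \<odot>\<^bsub>M\<^esub> u"
    and smult_r_distr: "a \<in> carrier R \<Longrightarrow> u \<in> carrier M \<Longrightarrow> v \<in> carrier M \<Longrightarrow>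
      a \<odot>\<^bsub>M\<^esub> (u \<oplus>\<^bsub>M\<^esub> v) = a \<odot>\<^bsub>M\<^esub> u \<oplus>\<^bsub>M\<^esub> a \<odot>\<^bsub>M\<^esub> v"
    and smult_assoc: "a \<in> carrier R \<Longrightarrow> b \<in> carrier R \<Longrightarrow> u \<in> carrier M \<Longrightarrow>
      (a \<otimes>\<^bsub>R\<^esub> b) \<odot>\<^bsub>M\<^esub> u = a \<odot>\<^bsub>M\<^esub> (b \<odot>\<^bsub>M\<^esub> u)"
    and smult_one: "u \<in> carrier M \<Longrightarrow> \<one>\<^bsub>R\<^esub> \<odot>\<^bsub>M\<^esub> u = u"

definition simple_module :: "'r ring \<Rightarrow> ('r, 'm) module \<Rightarrow> bool" where
  "simple_module R M \<longleftrightarrow> left_module R M \<and> carrier M \<noteq> {\<zero>\<^bsub>M\<^esub>} \<and>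
     (\<forall>N. submodule N R M \<longrightarrow> N = {\<zero>\<^bsub>M\<^esub>} \<or> N = carrier M)"

definition module_iso :: "'r ring \<Rightarrow> ('r, 'm) module \<Rightarrow> ('r, 'n) module \<Rightarrow> bool" where
  "module_iso R M N \<longleftrightarrow> (\<exists>h. bij_betw h (carrier M) (carrier N) \<and>
     (\<forall>u\<in>carrier M. \<forall>v\<in>carrier M. h (u \<oplus>\<^bsub>M\<^esub> v) = h u \<oplus>\<^bsub>N\<^esub> h v) \<and>
     (\<forall>a\<in>carrier R. \<forall>u\<in>carrier M. h (a \<odot>\<^bsub>M\<^esub> u) = a \<odot>\<^bsub>N\<^esub> h u))"

text \<open>The isomorphism class \<open>[M]\<close>, taken among the modules whose carrier is a set of elements
  of a type \<open>'u\<close> (the universe); \<open>M\<close> itself may live over another type. The class is nonempty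
  as soon as \<open>'u\<close> has at least as many elements as \<open>carrier M\<close>.

  For an algebra over a field \<open>k\<close> a type can carry a nonzero module only if it admits an
  injection from \<open>k\<close>; conversely, for infinite \<open>k\<close>, such a type contains a copy of every module of
  finite nonzero dimension. Assuming such an injection for an arbitrary universe \<open>'u\<close> therefore excludes no
  simple module and makes no class of a finite-dimensional module empty.\<close>

definition iso_class :: "'r ring \<Rightarrow> ('r, 'm) module \<Rightarrow> ('r, 'u) module set" where
  "iso_class R M = {N. left_module R N \<and> module_iso R M N}"

definition simple_classes :: "'r ring \<Rightarrow> ('r, 'u) module set set" where
  "simple_classes R = {iso_class R M | M :: ('r, 'u) module. simple_module R M}"

definition quotient_module :: "'r ring \<Rightarrow> 'r set \<Rightarrow> ('r, 'r set) module" where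
  "quotient_module R I = \<lparr>carrier = carrier (R Quot I),
     monoid.mult = monoid.mult (R Quot I), one = one (R Quot I),
     ring.zero = ring.zero (R Quot I), ring.add = ring.add (R Quot I),
     module.smult = (\<lambda>a C. (I +>\<^bsub>R\<^esub> a) \<otimes>\<^bsub>R Quot I\<^esub> C)\<rparr>"


text \<open>The free algebra on \<open>x, y, g, g\<^sup>-\<^sup>1\<close>: finitely supported functions on the free monoid of words,
  with the convolution product.\<close>

datatype letter = Letter_x | Letter_y | Letter_g | Letter_ginv

datatype word = Word (letters: "letter list")

instantiation word :: monoid_add
begin

definition zero_word :: word where "0 = Word []"

definition plus_word :: "word \<Rightarrow> word \<Rightarrow> word" where "u + v = Word (letters u @ letters v)"

instance
  by standard (simp_all add: zero_word_def plus_word_def)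

end

type_synonym 'k free_alg = "word \<Rightarrow>\<^sub>0 'k"

abbreviation fscalar :: "'k::field \<Rightarrow> 'k free_alg" where
  "fscalar c \<equiv> Poly_Mapping.single 0 c"

abbreviation fletter :: "letter \<Rightarrow> 'k::field free_alg" where
  "fletter l \<equiv> Poly_Mapping.single (Word [l]) 1"

abbreviation fx :: "'k::field free_alg" where "fx \<equiv> fletter Letter_x"
abbreviation fy :: "'k::field free_alg" where "fy \<equiv> fletter Letter_y"
abbreviation fg :: "'k::field free_alg" where "fg \<equiv> fletter Letter_g"
abbreviation fginv :: "'k::field free_alg" where "fginv \<equiv> fletter Letter_ginv"

definition fs :: "'k::field free_alg" where "fs = fx * fy + fy * fx"

definition relations :: "'k::field free_alg set" where
  "relations = {fx * fx, fy * fs - fs * fy - fx * fs, fg * fginv - 1, fginv * fg - 1,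
     fg * fx * fginv - (- fx), fg * fy * fginv - (- fy + fx)}"

definition relation_ideal :: "'k::field free_alg set" where
  "relation_ideal = Idl\<^bsub>ring_of_type_algebra\<^esub> relations"

text \<open>The bosonization \<open>A\<close> of the super Jordan plane, and the projection onto it. The field acts
  on an \<open>A\<close>-module through the elements \<open>to_A (fscalar c)\<close>.\<close>

definition alg_A :: "'k::field free_alg set ring" where
  "alg_A = ring_of_type_algebra Quot relation_ideal"

definition to_A :: "'k::field free_alg \<Rightarrow> 'k free_alg set" where
  "to_A a = relation_ideal +>\<^bsub>ring_of_type_algebra\<^esub> a"

definition mod_S :: "'k::field \<Rightarrow> ('k free_alg set, 'k free_alg set set) module" where
  "mod_S \<gamma> = quotient_module alg_A
     (Idl\<^bsub>alg_A\<^esub> {to_A fs, to_A fx, to_A fy, to_A (fg - fscalar \<gamma>)})"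


text \<open>Modules given by a basis \<open>I\<close> and the images of the basis vectors under \<open>x\<close>, \<open>y\<close> and \<open>g\<close>.
  The space with basis \<open>I\<close> consists of the finitely supported functions vanishing outside \<open>I\<close>;
  \<open>g\<^sup>-\<^sup>1\<close> acts by the inverse of the operator by which \<open>g\<close> acts on this space.\<close>

type_synonym ('i, 'k) vec = "'i \<Rightarrow>\<^sub>0 'k"

definition scale :: "'k::field \<Rightarrow> ('i, 'k) vec \<Rightarrow> ('i, 'k) vec" (infixr \<open>*\<^sub>v\<close> 75) where
  "c *\<^sub>v u = Poly_Mapping.map (\<lambda>d. c * d) u"

definition span_on :: "'i set \<Rightarrow> ('i, 'k::field) vec set" where
  "span_on I = {u. Poly_Mapping.keys u \<subseteq> I}"

definition linear_ext :: "('i \<Rightarrow> ('i, 'k) vec) \<Rightarrow> ('i, 'k::field) vec \<Rightarrow> ('i, 'k) vec" where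
  "linear_ext \<phi> u = (\<Sum>i\<in>Poly_Mapping.keys u. Poly_Mapping.lookup u i *\<^sub>v \<phi> i)"

fun letter_act ::
  "'i set \<Rightarrow> ('i \<Rightarrow> ('i, 'k) vec) \<Rightarrow> ('i \<Rightarrow> ('i, 'k) vec) \<Rightarrow> ('i \<Rightarrow> ('i, 'k) vec) \<Rightarrow>
     letter \<Rightarrow> ('i, 'k::field) vec \<Rightarrow> ('i, 'k) vec" where
  "letter_act I \<xi> \<eta> \<theta> Letter_x = linear_ext \<xi>"
| "letter_act I \<xi> \<eta> \<theta> Letter_y = linear_ext \<eta>"
| "letter_act I \<xi> \<eta> \<theta> Letter_g = linear_ext \<theta>"
| "letter_act I \<xi> \<eta> \<theta> Letter_ginv = inv_into (span_on I) (linear_ext \<theta>)"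

definition free_act ::
  "'i set \<Rightarrow> ('i \<Rightarrow> ('i, 'k) vec) \<Rightarrow> ('i \<Rightarrow> ('i, 'k) vec) \<Rightarrow> ('i \<Rightarrow> ('i, 'k) vec) \<Rightarrow>
     'k free_alg \<Rightarrow> ('i, 'k::field) vec \<Rightarrow> ('i, 'k) vec" where
  "free_act I \<xi> \<eta> \<theta> a u =
     (\<Sum>w\<in>Poly_Mapping.keys a.
        Poly_Mapping.lookup a w *\<^sub>v foldr (letter_act I \<xi> \<eta> \<theta>) (letters w) u)"

text \<open>An element of \<open>A\<close> acts as any of its representatives in the free algebra; this is
  independent of the choice whenever the three operators satisfy the relations of \<open>A\<close>.\<close>

definition basis_module ::
  "'i set \<Rightarrow> ('i \<Rightarrow> ('i, 'k) vec) \<Rightarrow> ('i \<Rightarrow> ('i, 'k) vec) \<Rightarrow> ('i \<Rightarrow> ('i, 'k) vec) \<Rightarrow>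
     ('k::field free_alg set, ('i, 'k) vec) module" where
  "basis_module I \<xi> \<eta> \<theta> = \<lparr>carrier = span_on I, monoid.mult = undefined, one = undefined,
     ring.zero = 0, ring.add = (+),
     module.smult = (\<lambda>C u. the_elem ((\<lambda>a. free_act I \<xi> \<eta> \<theta> a u) ` C))\<rparr>"


datatype e_index = E0 | E1

abbreviation basis_e :: "e_index \<Rightarrow> (e_index, 'k::field) vec" where
  "basis_e i \<equiv> Poly_Mapping.single i 1"

fun T_y :: "'k \<Rightarrow> e_index \<Rightarrow> (e_index, 'k::field) vec" where
  "T_y \<alpha> E0 = \<alpha> *\<^sub>v basis_e E0"
| "T_y \<alpha> E1 = (- \<alpha>) *\<^sub>v basis_e E1"

fun T_g :: "'k \<Rightarrow> e_index \<Rightarrow> (e_index, 'k::field) vec" where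
  "T_g \<beta> E0 = basis_e E1"
| "T_g \<beta> E1 = \<beta> *\<^sub>v basis_e E0"

text \<open>The action of \<open>s = x y + y x\<close> need not be prescribed: it is \<open>0\<close> because \<open>x\<close> acts by \<open>0\<close>.\<close>

definition mod_T :: "'k::field \<Rightarrow> 'k \<Rightarrow> ('k free_alg set, (e_index, 'k) vec) module" where
  "mod_T \<alpha> \<beta> = basis_module UNIV (\<lambda>i. 0) (T_y \<alpha>) (T_g \<beta>)"


datatype vw = V_index nat | W_index nat

abbreviation basis_v :: "nat \<Rightarrow> (vw, 'k::field) vec" where
  "basis_v i \<equiv> Poly_Mapping.single (V_index i) 1"

abbreviation basis_w :: "nat \<Rightarrow> (vw, 'k::field) vec" where
  "basis_w i \<equiv> Poly_Mapping.single (W_index i) 1"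

fun V_x :: "vw \<Rightarrow> (vw, 'k::field) vec" where
  "V_x (V_index i) = 0"
| "V_x (W_index i) = basis_v i"

fun V_y :: "nat \<Rightarrow> 'k \<Rightarrow> 'k \<Rightarrow> vw \<Rightarrow> (vw, 'k::field) vec" where
  "V_y p \<beta> \<gamma> (V_index i) = (if i < p - 1 then basis_w (i + 1) else \<beta> *\<^sub>v basis_w 0)"
| "V_y p \<beta> \<gamma> (W_index i) =
     (if i < p - 1 then of_nat (i + 1) *\<^sub>v basis_v i + \<gamma> *\<^sub>v basis_v (i + 1)
      else (\<beta> * \<gamma>) *\<^sub>v basis_v 0)"

fun V_g :: "nat \<Rightarrow> 'k \<Rightarrow> 'k \<Rightarrow> vw \<Rightarrow> (vw, 'k::field) vec" where
  "V_g p \<alpha> \<beta> (V_index i) =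
     (if i < p - 1 then (- inverse \<alpha>) *\<^sub>v basis_v (i + 1)
      else (- inverse \<alpha> * \<beta>) *\<^sub>v basis_v 0)"
| "V_g p \<alpha> \<beta> (W_index i) =
     (if i < p - 1 then inverse \<alpha> *\<^sub>v basis_w (i + 1)
      else (inverse \<alpha> * \<beta>) *\<^sub>v basis_w 0)"

definition mod_V :: "nat \<Rightarrow> 'k::field \<Rightarrow> 'k \<Rightarrow> 'k \<Rightarrow> ('k free_alg set, (vw, 'k) vec) module" where
  "mod_V p \<alpha> \<beta> \<gamma> =
     basis_module (V_index ` {0..<p} \<union> W_index ` {0..<p}) V_x (V_y p \<beta> \<gamma>) (V_g p \<alpha> \<beta>)"

end

theory Submission
  imports Defs
begin

text \<open>Put \<open>Y = y\<^sup>2\<close>. In \<open>A\<close> one has \<open>y s = s (y + x)\<close> and \<open>Y s = s (Y + s)\<close>; the latter gives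
  \<open>(Y + s)\<^sup>n\<^sup>+\<^sup>1 = Y\<^sup>n\<^sup>+\<^sup>1 + (n + 1) s (Y + s)\<^sup>n\<close>, hence \<open>(Y + s)\<^sup>p = Y\<^sup>p\<close> in characteristic \<open>p\<close>. It follows
  that \<open>s\<^sup>p\<close>, \<open>y\<^sup>2\<^sup>p\<close> and \<open>g\<^sup>\<plusminus>\<^sup>2\<^sup>p\<close> are central and that \<open>A\<close> is finitely generated over them, so by the
  Nullstellensatz they act by scalars on every simple module. The element \<open>s\<close> acts by zero or
  injectively, since its kernel is a submodule. If \<open>s = 0\<close>, then \<open>x = 0\<close> because \<open>x\<close> is
  nilpotent, and eigenvectors of \<open>g\<close> or of \<open>y\<close> and \<open>g\<^sup>2\<close> generate a module \<open>S\<close> or \<open>T\<close>. If \<open>s\<close> is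
  injective, the kernel of \<open>x\<close> contains a common eigenvector \<open>w\<close> of \<open>s g\<^sup>-\<^sup>1\<close> and
  \<open>s\<^sup>p\<^sup>-\<^sup>2 Y\<close>, whose \<open>p\<close>-th power is central as in a Weyl algebra, and \<open>s\<^sup>2 w\<close> satisfies the
  equations of \<open>v\<^sub>0\<close> in some \<open>V\<close>. Modules are compared through the annihilators of these vectors:
  a simple module is \<open>A/L\<close> for a maximal left ideal \<open>L\<close>.\<close>

section \<open>Goldman ideals and the Nullstellensatz\<close>

text \<open>The obstacle is that a simple module is not known in advance to be finite-dimensional.
  Since the field may be countable, for instance an algebraic closure of a finite prime field,
  Schur's lemma gives only a division ring, and no cardinality argument reduces it to scalars. Hence
  the Nullstellensatz is proved in Kaplansky's style: Goldman ideals contract to Goldman ideals, one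
  variable at a time. The inverse of the central element \<open>g ^ (2 * p)\<close> counts as a
  fourth generator, so that polynomials suffice. An abstract simple module is used only through
  equations for one vector modulo a left ideal. They say that suitable algebra elements, taken as
  images of the basis vectors of the explicit module, define a homomorphism. As the explicit modules
  are shown to be simple independently, one inclusion of annihilators then gives an isomorphism. The
  two operators that are diagonalized come from \<open>V\<close>: there
  \<open>s v_i = v_{i+1}\<close>, so \<open>g v_0\<close> is a multiple of \<open>s v_0\<close>,
  while \<open>y (y v_0) = 2 v_1 + \<gamma> v_2\<close> explains the passage from \<open>w\<close>
  to \<open>s^2 w\<close>.\<close>

lemma nakayama_localized:
  fixes scale :: "'r::comm_ring_1 \<Rightarrow> 'm::ab_group_add \<Rightarrow> 'm" and g a :: 'r
  assumes mod: "Modules.module scale" and "finite B" and N: "Modules.module.subspace scale N"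
    and gen: "\<And>u. \<exists>k. scale (g ^ k) u \<in> Modules.module.span scale (B \<union> N)"
    and div: "\<And>u. \<exists>n u'. scale (g ^ n) u - scale a u' \<in> N"
  shows "\<exists>t c. \<forall>u. \<exists>k. scale (g ^ k * (g ^ t - a * c)) u \<in> N"
proof -
  interpret m: Modules.module scale by (rule mod)
  \<comment> \<open>Nakayama without determinants: the generators are removed one at a time. The
    invariant says that, with \<open>g\<close> inverted, \<open>g ^ t - a * c\<close> maps the whole
    module into the span of those still present; for \<open>t = 0\<close> and \<open>c = 0\<close>
    it is \<open>gen\<close>.\<close>
  have "\<exists>t c. \<forall>u. \<exists>k. scale (g ^ k * (g ^ t - a * c)) u \<in> N"
    if "\<forall>u. \<exists>k. scale (g ^ k * (g ^ t - a * c)) u \<in> m.span (B \<union> N)" for t c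
    using \<open>finite B\<close> that
  proof (induction B arbitrary: t c rule: finite_induct)
    case empty
    then show ?case using N by (auto simp: m.span_eq_iff[THEN iffD2])
  next
    case (insert b B)
    let ?S = "m.span (B \<union> N)"
    define r where "r = g ^ t - a * c"
    have H: "\<exists>k d. scale (g ^ k * r) u - scale d b \<in> ?S" for u
      using insert.prems m.span_breakdown_eq[of _ b "B \<union> N"] unfolding r_def by auto
    obtain n u' where nu: "scale (g ^ n) b - scale a u' \<in> N" using div by blast
    obtain k d where kd: "scale (g ^ k * r) u' - scale d b \<in> ?S" using H by blast
    \<comment> \<open>Up to \<open>g ^ n\<close>, \<open>b\<close> equals \<open>a u'\<close>, and
      \<open>g ^ k * r\<close> sends \<open>u'\<close> to \<open>d b\<close>. Comparing the two,
      \<open>\<rho>\<close> sends \<open>b\<close> into the remaining span. Since \<open>r\<close>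
      sends everything to multiples of \<open>b\<close>, the new factor is
      \<open>r * \<rho>\<close>.\<close>
    define \<rho> where "\<rho> = g ^ (k + n) * r - a * d"
    have "scale (g ^ k * r) (scale (g ^ n) b - scale a u') \<in> ?S"
      using nu N by (meson Un_iff m.span_base m.span_scale)
    moreover have "scale a (scale (g ^ k * r) u' - scale d b) \<in> ?S"
      using kd by (rule m.span_scale)
    ultimately have "scale (g ^ k * r) (scale (g ^ n) b - scale a u') +
        scale a (scale (g ^ k * r) u' - scale d b) \<in> ?S" by (rule m.span_add)
    also have "scale (g ^ k * r) (scale (g ^ n) b - scale a u') +
        scale a (scale (g ^ k * r) u' - scale d b) = scale \<rho> b"
      by (simp add: \<rho>_def m.scale_right_diff_distrib m.scale_left_diff_distrib power_add mult_ac)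
    finally have \<rho>b: "scale \<rho> b \<in> ?S" .
    define c' where "c' = c * g ^ (k + n) * r + g ^ t * g ^ (k + n) * c + r * d"
    have r': "r * \<rho> = g ^ (t + k + n + t) - a * c'"
      by (simp add: \<rho>_def c'_def r_def power_add algebra_simps)
    have "\<exists>k'. scale (g ^ k' * (g ^ (t + k + n + t) - a * c')) u \<in> ?S" for u
    proof -
      obtain k' e where ke: "scale (g ^ k' * r) u - scale e b \<in> ?S" using H by blast
      have "scale \<rho> (scale (g ^ k' * r) u - scale e b) + scale e (scale \<rho> b) \<in> ?S"
        by (rule m.span_add[OF m.span_scale[OF ke] m.span_scale[OF \<rho>b]])
      also have "scale \<rho> (scale (g ^ k' * r) u - scale e b) + scale e (scale \<rho> b)
          = scale (g ^ k' * (r * \<rho>)) u"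
        by (simp add: m.scale_right_diff_distrib mult_ac)
      finally show ?thesis unfolding r' by blast
    qed
    then show ?case by (intro insert.IH[of "t + k + n + t" c']) blast
  qed
  from this[of 0 0] gen show ?thesis by simp
qed

definition is_prime_ideal :: "'a::comm_ring_1 set \<Rightarrow> bool" where
  "is_prime_ideal P \<longleftrightarrow> 0 \<in> P \<and> (\<forall>a\<in>P. \<forall>b\<in>P. a + b \<in> P) \<and> (\<forall>a. \<forall>b\<in>P. a * b \<in> P) \<and>
     1 \<notin> P \<and> (\<forall>a b. a * b \<in> P \<longrightarrow> a \<in> P \<or> b \<in> P)"

text \<open>The localization of the quotient by \<open>P\<close> at \<open>g\<close> is a field.\<close>

definition goldman :: "'a::comm_ring_1 set \<Rightarrow> 'a \<Rightarrow> bool" where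
  "goldman P g \<longleftrightarrow> g \<notin> P \<and> (\<forall>a. a \<notin> P \<longrightarrow> (\<exists>b n. a * b - g ^ n \<in> P))"

lemma prime_idealD:
  assumes "is_prime_ideal P"
  shows "0 \<in> P" "a \<in> P \<Longrightarrow> b \<in> P \<Longrightarrow> a + b \<in> P" "b \<in> P \<Longrightarrow> a * b \<in> P" "a \<in> P \<Longrightarrow> a * b \<in> P"
    "1 \<notin> P" "a * b \<in> P \<Longrightarrow> a \<in> P \<or> b \<in> P" "a \<in> P \<Longrightarrow> - a \<in> P"
    "a \<in> P \<Longrightarrow> b \<in> P \<Longrightarrow> a - b \<in> P" "(\<And>i. i \<in> I \<Longrightarrow> f i \<in> P) \<Longrightarrow> sum f I \<in> P"
    "a ^ n \<in> P \<Longrightarrow> a \<in> P"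
proof -
  show A: "0 \<in> P" "a \<in> P \<Longrightarrow> b \<in> P \<Longrightarrow> a + b \<in> P" "b \<in> P \<Longrightarrow> a * b \<in> P" "1 \<notin> P"
    "a * b \<in> P \<Longrightarrow> a \<in> P \<or> b \<in> P" for a b
    using assms by (auto simp: is_prime_ideal_def)
  show "a \<in> P \<Longrightarrow> a * b \<in> P" using A(3)[of a b] by (simp add: mult.commute)
  show M: "a \<in> P \<Longrightarrow> - a \<in> P" for a using A(3)[of a "-1"] by simp
  show "a \<in> P \<Longrightarrow> b \<in> P \<Longrightarrow> a - b \<in> P" using A(2)[of a "- b"] M by simp
  show "(\<And>i. i \<in> I \<Longrightarrow> f i \<in> P) \<Longrightarrow> sum f I \<in> P"
    by (induction I rule: infinite_finite_induct) (auto intro: A)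
  show "a ^ n \<in> P \<Longrightarrow> a \<in> P" by (induction n) (use A(4,5) in auto)
qed

lemma prime_ideal_contract:
  assumes "is_prime_ideal (Q :: 'r::comm_ring_1 poly set)"
  shows "is_prime_ideal {r. [:r:] \<in> Q}"
proof -
  note Q = prime_idealD[OF assms]
  have m: "[:a * b:] = [:a:] * [:b:]" and p: "[:a + b:] = [:a:] + [:b:]" for a b :: 'r by simp_all
  show ?thesis
    unfolding is_prime_ideal_def mem_Collect_eq m p using Q(1-3,5,6)
    by (auto simp flip: one_pCons simp del: mult_pCons_left mult_pCons_right add_pCons)
qed

text \<open>Leading coefficients multiply over the domain \<open>R/P\<close>, which is never formed:
  \<open>m\<close> and \<open>n\<close> bound the degrees modulo \<open>P\<close>, and every other
  term of the convolution has a factor in \<open>P\<close>.\<close>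

lemma coeff_mult_leading:
  assumes P: "is_prime_ideal P"
    and a: "\<And>i. i > m \<Longrightarrow> coeff a i \<in> P" and b: "\<And>i. i > n \<Longrightarrow> coeff b i \<in> P"
    and ab: "coeff (a * b) (m + n) \<in> P"
  shows "coeff a m \<in> P \<or> coeff b n \<in> P"
proof -
  note P = prime_idealD[OF P]
  have "coeff (a * b) (m + n) = (\<Sum>i\<le>m + n. coeff a i * coeff b (m + n - i))"
    by (simp add: coeff_mult)
  also have "\<dots> = coeff a m * coeff b n + (\<Sum>i\<in>{..m + n} - {m}. coeff a i * coeff b (m + n - i))"
    by (subst sum.remove[of _ m]) auto
  finally have "coeff a m * coeff b n =
      coeff (a * b) (m + n) - (\<Sum>i\<in>{..m + n} - {m}. coeff a i * coeff b (m + n - i))" by simp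
  also have "\<dots> \<in> P"
  proof (intro P(8) ab P(9))
    fix i assume i: "i \<in> {..m + n} - {m}"
    then consider "i > m" | "m + n - i > n" by force
    then show "coeff a i * coeff b (m + n - i) \<in> P" by cases (auto intro: P(3,4) a b)
  qed
  finally show ?thesis using P(6) by blast
qed

text \<open>\<open>m\<close> is the degree of \<open>q\<close> modulo \<open>P\<close>, which may be
  smaller than \<open>degree q\<close>.\<close>

lemma top_coeff_outside:
  assumes "coeff q i \<notin> P" "0 \<in> P"
  obtains m where "coeff q m \<notin> P" "\<And>j. j > m \<Longrightarrow> coeff q j \<in> P" "m \<ge> i" "m \<le> degree q"
proof -
  let ?M = "{j. coeff q j \<notin> P}"
  have sub: "?M \<subseteq> {..degree q}"
    using assms(2) by (auto intro!: le_degree)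
  then have fin: "finite ?M" by (rule finite_subset) auto
  show thesis
  proof (rule that[of "Max ?M"])
    show "coeff q (Max ?M) \<notin> P" using Max_in[OF fin] assms by auto
    show "coeff q j \<in> P" if "j > Max ?M" for j using Max_ge[OF fin, of j] that by force
    show "Max ?M \<ge> i" using fin assms by (auto intro: Max_ge)
    then show "Max ?M \<le> degree q" using Max_in[OF fin] assms sub by auto
  qed
qed

lemma extended_coeffs:
  assumes Q: "is_prime_ideal Q" and "\<And>i. [:coeff q i:] \<in> Q"
  shows "q \<in> Q"
proof -
  have "q = (\<Sum>i\<le>degree q. [:coeff q i:] * monom 1 i)"
    by (subst poly_as_sum_of_monoms[symmetric]) (simp add: smult_monom)
  also have "\<dots> \<in> Q" by (intro prime_idealD(9)[OF Q] prime_idealD(4)[OF Q] assms)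
  finally show ?thesis .
qed

text \<open>The generator is transcendental over \<open>R/P\<close>: then \<open>1 + X f\<close> would be a unit of the
  polynomial ring over the domain \<open>R/P\<close>.\<close>

lemma goldman_not_extended:
  fixes Q :: "'r::comm_ring_1 poly set"
  assumes Q: "is_prime_ideal Q" and f: "goldman Q f"
  obtains q i where "q \<in> Q" "[:coeff q i:] \<notin> Q"
proof (rule ccontr)
  note Q' = prime_idealD[OF Q]
  define P where "P = {r. [:r:] \<in> Q}"
  have P: "is_prime_ideal P" unfolding P_def by (rule prime_ideal_contract[OF Q])
  note P' = prime_idealD[OF P]
  assume "\<not> thesis"
  then have *: "\<And>q i. q \<in> Q \<Longrightarrow> coeff q i \<in> P" using that unfolding P_def by blast
  have fQ: "f \<notin> Q" using f by (auto simp: goldman_def)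
  then obtain i where "coeff f i \<notin> P"
    using extended_coeffs[OF Q, of f] unfolding P_def by auto
  then obtain m where m: "coeff f m \<notin> P" "\<And>j. j > m \<Longrightarrow> coeff f j \<in> P"
    using top_coeff_outside P'(1) by blast
  define c where "c = 1 + pCons 0 f"
  have c: "coeff c (Suc m) \<notin> P" "\<And>j. j > Suc m \<Longrightarrow> coeff c j \<in> P"
    using m by (auto simp: c_def coeff_pCons split: nat.split)
  then have "c \<notin> Q" using * by blast
  then obtain b n where b: "c * b - f ^ n \<in> Q" using f by (auto simp: goldman_def)
  \<comment> \<open>With \<open>X\<close> the variable, \<open>c = 1 + X * f\<close>. Modulo
    \<open>c\<close> the product \<open>- X * f\<close> is 1, so \<open>(- X) ^ n\<close> inverts
    \<open>f ^ n\<close> there, and modulo \<open>Q\<close> a multiple of \<open>c\<close> equals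
    \<open>f ^ n\<close>. Together this makes \<open>c\<close> a unit modulo
    \<open>Q\<close>.\<close>
  have "\<exists>e. c * e - 1 \<in> Q"
  proof -
    have "\<exists>d. c * d = 1 - (- pCons 0 f) ^ n"
      by (rule exI[of _ "\<Sum>i<n. (- pCons 0 f) ^ i"])
        (simp only: c_def one_diff_power_eq diff_minus_eq_add)
    then obtain d where d: "c * d = 1 - (- pCons 0 f) ^ n" by blast
    have p: "(- pCons 0 f) ^ n = (- [:0,1:]) ^ n * f ^ n"
      by (simp flip: power_mult_distrib)
    have "c * (d + (- [:0,1:]) ^ n * b) - 1 = (- [:0,1:]) ^ n * (c * b - f ^ n)"
      unfolding distrib_left d p by (simp add: algebra_simps)
    then show ?thesis using Q'(3) b by metis
  qed
  then obtain e where e: "c * e - 1 \<in> Q" by blast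
  have "e \<notin> Q" using e Q'(5) Q'(3)[of e c] Q'(8)[of "c * e" "c * e - 1"] by auto
  then obtain i where "coeff e i \<notin> P"
    using extended_coeffs[OF Q, of e] unfolding P_def by auto
  then obtain n where n: "coeff e n \<notin> P" "\<And>j. j > n \<Longrightarrow> coeff e j \<in> P"
    using top_coeff_outside P'(1) by blast
  \<comment> \<open>Elements of \<open>Q\<close> are assumed to have all coefficients in
    \<open>P\<close>, and the constant 1 does not reach the positive degree
    \<open>Suc m + n\<close>; yet modulo \<open>P\<close> this is the degree of the product.\<close>
  have "coeff (c * e) (Suc m + n) \<in> P"
    using *[OF e, of "Suc m + n"] by (simp add: coeff_diff)
  then show False using coeff_mult_leading[OF P c(2) n(2)] c n by blast
qed

lemma pseudo_division:
  fixes f g :: "'a::comm_ring_1 poly"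
  assumes "g \<noteq> 0"
  obtains k q r where "smult (lead_coeff g ^ k) f = g * q + r" "r = 0 \<or> degree r < degree g"
  using pseudo_divmod[OF assms, of f] by (metis surj_pair)

text \<open>A power of the leading coefficient of \<open>q\<close> clears denominators when reducing modulo \<open>q\<close>, so
  after localizing at \<open>g\<close> the module \<open>R[X]/Q\<close> is finitely generated over \<open>R\<close> and Nakayama applies;
  \<open>r\<close> is a norm of \<open>f\<close>.\<close>

lemma goldman_contract:
  fixes Q :: "'r::comm_ring_1 poly set"
  assumes Q: "is_prime_ideal Q" and f: "goldman Q f"
  shows "\<exists>g. goldman {r. [:r:] \<in> Q} g"
proof -
  note Q' = prime_idealD[OF Q]
  define P where "P = {r. [:r:] \<in> Q}"
  have P: "is_prime_ideal P" unfolding P_def by (rule prime_ideal_contract[OF Q])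
  note P' = prime_idealD[OF P]
  have fQ: "f \<notin> Q" and finv: "\<And>a. a \<notin> Q \<Longrightarrow> \<exists>b n. a * b - f ^ n \<in> Q"
    using f by (auto simp: goldman_def)
  have PQ: "c \<in> P \<Longrightarrow> monom c n \<in> Q" for c n
    using Q'(4)[of "[:c:]" "monom 1 n"] by (simp add: P_def smult_monom)
  have smQ: "q \<in> Q \<Longrightarrow> smult c q \<in> Q" for c q using Q'(3)[of q "[:c:]"] by simp
  have smP: "smult c q \<in> Q \<Longrightarrow> c \<notin> P \<Longrightarrow> q \<in> Q" for c q
    using Q'(6)[of "[:c:]" q] by (simp add: P_def)
  have truncate: "\<exists>q'. q - q' \<in> Q \<and> degree q' < degree q"
    if "lead_coeff q \<in> P" "q \<notin> Q" for q
  proof (intro exI conjI)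
    let ?q = "q - monom (lead_coeff q) (degree q)"
    show "q - ?q \<in> Q" using PQ that by simp
    have "degree q \<noteq> 0"
    proof
      assume "degree q = 0"
      then have "q = monom (lead_coeff q) 0" using degree_0_id[of q] by (simp add: monom_0)
      then show False using PQ[OF that(1), of 0] that(2) by simp
    qed
    then show "degree ?q < degree q"
      by (intro degree_lessI) (auto simp: coeff_eq_0 le_less)
  qed
  \<comment> \<open>By \<open>goldman_not_extended\<close>, \<open>Q\<close> is larger than the
    extension of \<open>P\<close>. A witness of least degree acts as a minimal polynomial of the
    variable over \<open>R/P\<close>, and minimality keeps its leading coefficient out of
    \<open>P\<close>.\<close>
  define QX where "QX = {q \<in> Q. \<exists>i. coeff q i \<notin> P}"
  obtain q1 i1 where "q1 \<in> Q" "[:coeff q1 i1:] \<notin> Q" using goldman_not_extended[OF Q f] by blast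
  then have "q1 \<in> QX" by (auto simp: QX_def P_def)
  then obtain q where qX: "q \<in> QX" and qmin: "\<And>q'. q' \<in> QX \<Longrightarrow> degree q \<le> degree q'"
    using ex_has_least_nat[of "\<lambda>q. q \<in> QX" q1 degree] by blast
  have qQ: "q \<in> Q" using qX by (simp add: QX_def)
  define l where "l = lead_coeff q"
  have lP: "l \<notin> P"
  proof
    assume l: "l \<in> P"
    obtain i where i: "coeff q i \<notin> P" using qX by (auto simp: QX_def)
    let ?q = "q - monom (lead_coeff q) (degree q)"
    have ne: "i \<noteq> degree q" using i l by (auto simp: l_def)
    moreover have "i \<le> degree q" using i P'(1) by (auto intro: le_degree)
    ultimately have pos: "degree q > 0" by linarith
    have "?q \<in> Q" using qQ PQ l Q'(8) by (auto simp: l_def)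
    moreover have "coeff ?q i \<notin> P" using i ne by simp
    ultimately have "?q \<in> QX" unfolding QX_def by blast
    moreover have "degree ?q < degree q"
      by (intro degree_lessI) (use pos in \<open>auto simp: coeff_eq_0 le_less\<close>)
    ultimately show False using qmin by fastforce
  qed
  have q0: "q \<noteq> 0" using lP P'(1) by (auto simp: l_def)
  have lnP: "l ^ k \<notin> P" for k using lP P'(10) by blast
  \<comment> \<open>\<open>J\<close> is the ideal generated by \<open>f\<close> and
    \<open>Q\<close>. An element of least degree in \<open>J - Q\<close> will turn out to be a
    constant \<open>c\<close>, so that modulo \<open>Q\<close> the element \<open>f\<close> divides
    a nonzero constant.\<close>
  define J where "J = {f * h + j | h j. j \<in> Q}"
  have J_mult: "v * u \<in> J" if u: "u \<in> J" for u v
  proof -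
    from u obtain h j where "u = f * h + j" "j \<in> Q" by (auto simp: J_def)
    then have "v * u = f * (v * h) + v * j" "v * j \<in> Q" by (auto simp: algebra_simps intro: Q'(3,4))
    then show ?thesis unfolding J_def by blast
  qed
  have J_diff: "u - v \<in> J" if uv: "u \<in> J" "v \<in> J" for u v
  proof -
    from uv obtain h j h' j' where "u = f * h + j" "j \<in> Q" "v = f * h' + j'" "j' \<in> Q"
      by (auto simp: J_def)
    then have "u - v = f * (h - h') + (j - j')" "j - j' \<in> Q"
      by (auto simp: algebra_simps intro: Q'(8))
    then show ?thesis unfolding J_def by blast
  qed
  have QJ: "u \<in> J" if "u \<in> Q" for u
  proof -
    have "u = f * 0 + u" by simp
    then show ?thesis using that unfolding J_def by blast
  qed
  have "f = f * 1 + 0" by simp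
  then have fJ: "f \<in> J - Q" unfolding J_def using fQ Q'(1) by blast
  obtain j where j: "j \<in> J - Q" and jmin: "\<And>j'. j' \<in> J - Q \<Longrightarrow> degree j \<le> degree j'"
    using ex_has_least_nat[of "\<lambda>j. j \<in> J - Q" f degree] fJ by blast
  define c where "c = lead_coeff j"
  have cP: "c \<notin> P"
  proof
    assume "c \<in> P"
    then obtain j' where j': "j - j' \<in> Q" "degree j' < degree j"
      using truncate[of j] j by (auto simp: c_def)
    have "j' = j - (j - j')" by simp
    then have "j' \<in> J" using J_diff[of j "j - j'"] QJ j' j by auto
    moreover have "j' \<notin> Q" using Q'(2)[of "j - j'" j'] j' j by auto
    ultimately show False using jmin j' by fastforce
  qed
  have j0: "j \<noteq> 0" using j Q'(1) by auto
  have "degree j = 0"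
  proof (rule ccontr)
    assume dj: "degree j \<noteq> 0"
    have dle: "degree j \<le> degree q"
    proof (rule ccontr)
      assume gt: "\<not> degree j \<le> degree q"
      obtain k a r where d: "smult (l ^ k) j = q * a + r" "r = 0 \<or> degree r < degree q"
        using pseudo_division[OF q0, of j] unfolding l_def by blast
      have "r = [:l ^ k:] * j - a * q" using d(1) by (simp add: algebra_simps)
      then have "r \<in> J" using J_diff[OF J_mult J_mult[OF QJ[OF qQ]]] j by (metis DiffD1)
      moreover have "r \<notin> Q"
        using smP[of "l ^ k" j] lnP j d(1) Q'(2)[of "q * a" r] Q'(4)[OF qQ] by auto
      ultimately show False using jmin[of r] d(2) gt Q'(1) by auto
    qed
    \<comment> \<open>Division of \<open>q\<close> by \<open>j\<close>: the remainder has too small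
      a degree to lie outside \<open>Q\<close>, so the quotient \<open>a\<close> is in
      \<open>Q\<close> by primality. If \<open>a\<close> has a coefficient outside \<open>P\<close>,
      its degree modulo \<open>P\<close> is at least that of \<open>q\<close>, too large for a
      factor of \<open>smult (c ^ k) q\<close>; otherwise the leading coefficient of the latter
      would lie in \<open>P\<close>.\<close>
    obtain k a r where d: "smult (c ^ k) q = j * a + r" "r = 0 \<or> degree r < degree j"
      using pseudo_division[OF j0, of q] unfolding c_def by blast
    have "r = [:c ^ k:] * q - a * j" using d(1) by (simp add: algebra_simps)
    then have "r \<in> J" using J_diff[OF J_mult[OF QJ[OF qQ]] J_mult] j by (metis DiffD1)
    then have rQ: "r \<in> Q" using jmin[of r] d(2) dj by fastforce
    have "j * a = smult (c ^ k) q - r" using d(1) by simp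
    then have "j * a \<in> Q" using rQ smQ qQ Q'(8) by metis
    then have aQ: "a \<in> Q" using Q'(6) j by auto
    have high: "coeff r i = 0" if "i \<ge> degree j" for i using d(2) that by (auto simp: coeff_eq_0)
    show False
    proof (cases "\<exists>i. coeff a i \<notin> P")
      case True
      then obtain i where i: "coeff a i \<notin> P" by blast
      obtain n where n: "coeff a n \<notin> P" "\<And>i. i > n \<Longrightarrow> coeff a i \<in> P" "n \<le> degree a"
        using top_coeff_outside[OF i P'(1)] by blast
      have "n \<ge> degree q"
      proof (rule ccontr)
        assume "\<not> n \<ge> degree q"
        define a' where "a' = poly_cutoff (Suc n) a"
        have ca: "coeff a' i = (if i \<le> n then coeff a i else 0)" for i
          by (auto simp: a'_def coeff_poly_cutoff)
        have "a - a' \<in> Q"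
          by (rule extended_coeffs[OF Q]) (use n(2) P'(1) ca in \<open>auto simp: P_def not_le\<close>)
        then have "a' \<in> Q" using aQ Q'(8)[of a "a - a'"] by simp
        then have "a' \<in> QX" using n(1) ca by (auto simp: QX_def)
        then have "degree q \<le> degree a'" by (rule qmin)
        also have "\<dots> \<le> n" by (rule degree_le) (auto simp: ca)
        finally show False using \<open>\<not> n \<ge> degree q\<close> by simp
      qed
      then have "coeff (smult (c ^ k) q) (degree j + n) = 0"
        using dj by (simp add: coeff_eq_0)
      then have "coeff (j * a) (degree j + n) = 0"
        using high[of "degree j + n"] unfolding d(1) by simp
      then have "coeff j (degree j) \<in> P \<or> coeff a n \<in> P"
        by (intro coeff_mult_leading[OF P]) (use n P'(1) in \<open>auto simp: coeff_eq_0\<close>)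
      then show False using n cP by (auto simp: c_def)
    next
      case False
      then have "coeff (j * a) (degree q) \<in> P"
        by (auto simp: coeff_mult intro!: P'(9) P'(3))
      moreover have "coeff (smult (c ^ k) q) (degree q) = coeff (j * a) (degree q)"
        unfolding d(1) using high[OF dle] by simp
      ultimately have "c ^ k * l \<in> P" by (simp add: l_def)
      then show False using P'(6,10) lP cP by blast
    qed
  qed
  then have jc: "j = [:c:]" unfolding c_def by (metis degree_0_id)
  from j obtain h j' where fh: "j = f * h + j'" "j' \<in> Q" by (auto simp: J_def)
  have fhc: "f * h - [:c:] \<in> Q" using Q'(7)[OF fh(2)] fh(1) jc by (simp add: algebra_simps)
  have fhcn: "(f * h) ^ n - [:c:] ^ n \<in> Q" for n
    using Q'(4)[OF fhc] by (simp add: power_diff_sumr2)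
  \<comment> \<open>Inverting \<open>l\<close> makes the quotient by \<open>Q\<close> finitely
    generated over \<open>R\<close>; inverting \<open>c\<close> makes \<open>f\<close> a unit in
    it.\<close>
  define g where "g = l * c"
  have gP: "g \<notin> P" using P'(6) lP cP by (auto simp: g_def)
  have modl: "Modules.module (smult :: 'r \<Rightarrow> 'r poly \<Rightarrow> 'r poly)"
    by unfold_locales (auto simp: smult_add_right smult_add_left)
  interpret m: Modules.module "smult :: 'r \<Rightarrow> 'r poly \<Rightarrow> 'r poly" by (rule modl)
  have subQ: "m.subspace Q" by (rule m.subspaceI) (auto intro: Q' smQ)
  define B where "B = (\<lambda>i. monom (1::'r) i) ` {..<degree q}"
  have gen: "\<exists>k. smult (g ^ k) u \<in> m.span (B \<union> Q)" for u
  proof -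
    obtain k a r where d: "smult (l ^ k) u = q * a + r" "r = 0 \<or> degree r < degree q"
      using pseudo_division[OF q0, of u] unfolding l_def by blast
    have "r \<in> m.span (B \<union> Q)"
    proof (cases "r = 0")
      case False
      have "r = (\<Sum>i\<le>degree r. smult (coeff r i) (monom 1 i))"
        by (subst poly_as_sum_of_monoms[symmetric]) (simp add: smult_monom)
      also have "\<dots> \<in> m.span (B \<union> Q)"
        by (intro m.span_sum m.span_scale m.span_base) (use d(2) False in \<open>auto simp: B_def\<close>)
      finally show ?thesis .
    qed (simp add: m.span_zero)
    then have "smult (l ^ k) u \<in> m.span (B \<union> Q)"
      unfolding d(1) using Q'(4)[OF qQ, of a] by (meson UnI2 m.span_add m.span_base)
    then have "smult (c ^ k) (smult (l ^ k) u) \<in> m.span (B \<union> Q)" by (rule m.span_scale)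
    then show ?thesis by (intro exI[of _ k]) (simp add: g_def power_mult_distrib mult.commute)
  qed
  have "goldman P g"
    unfolding goldman_def
  proof (intro conjI allI impI gP)
    fix a assume "a \<notin> P"
    then have "[:a:] \<notin> Q" by (simp add: P_def)
    then obtain b n where b: "[:a:] * b - f ^ n \<in> Q" using finv by blast
    \<comment> \<open>Modulo \<open>Q\<close>, \<open>a * b = f ^ n\<close> and
      \<open>f * h = c\<close>, so \<open>a\<close> divides a power of \<open>c\<close>.\<close>
    have "[:c:] ^ n - [:a:] * (b * h ^ n) \<in> Q"
    proof -
      have "h ^ n * ([:a:] * b - f ^ n) + ((f * h) ^ n - [:c:] ^ n) \<in> Q"
        by (intro Q'(2) Q'(3) b fhcn)
      from Q'(7)[OF this] show ?thesis by (simp add: algebra_simps power_mult_distrib)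
    qed
    then have cn: "smult (c ^ n) 1 - smult a (b * h ^ n) \<in> Q"
      by (simp add: poly_const_pow one_pCons del: smult_one)
    have div: "\<exists>n u'. smult (g ^ n) u - smult a u' \<in> Q" for u
    proof (intro exI)
      have "smult (g ^ n) u - smult a (smult (l ^ n) (b * h ^ n) * u) =
          smult (l ^ n) u * (smult (c ^ n) 1 - smult a (b * h ^ n))"
        by (simp add: g_def power_mult_distrib algebra_simps)
      also have "\<dots> \<in> Q" by (rule Q'(3)[OF cn])
      finally show "smult (g ^ n) u - smult a (smult (l ^ n) (b * h ^ n) * u) \<in> Q" .
    qed
    \<comment> \<open>Divisibility by \<open>a\<close> was established with polynomial cofactors
      only; Nakayama provides a cofactor \<open>d\<close> in \<open>R\<close> itself, and applying
      the result to 1 brings it down to \<open>P\<close>.\<close>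
    obtain t d where td: "\<And>u. \<exists>k. smult (g ^ k * (g ^ t - a * d)) u \<in> Q"
      using nakayama_localized[OF modl _ subQ gen div] by (auto simp: B_def)
    obtain k where "smult (g ^ k * (g ^ t - a * d)) 1 \<in> Q" using td by blast
    then have "g ^ k * (g ^ t - a * d) \<in> P" by (simp add: P_def)
    then have "g ^ t - a * d \<in> P" using P'(6,10) gP by blast
    then have "a * d - g ^ t \<in> P" using P'(7) by fastforce
    then show "\<exists>b n. a * b - g ^ n \<in> P" by blast
  qed
  then show ?thesis unfolding P_def by blast
qed

lemma alg_closed_infinite: "infinite (UNIV :: 'k::alg_closed_field set)"
proof
  assume fin: "finite (UNIV :: 'k set)"
  define q where "q = (\<Prod>a\<in>(UNIV :: 'k set). [:- a, 1:])"
  have "degree q = card (UNIV :: 'k set)" unfolding q_def by (simp add: degree_prod_eq_sum_degree)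
  moreover have "card (UNIV :: 'k set) > 0" using fin by (simp add: finite_UNIV_card_ge_0)
  ultimately have "degree (q + 1) > 0"
    by (metis add.commute degree_1 degree_add_eq_right)
  then obtain x where "poly (q + 1) x = 0" using alg_closed_imp_poly_has_root by blast
  moreover have "poly q x = 0" using fin by (simp add: q_def poly_prod prod_zero_iff)
  ultimately show False by simp
qed

text \<open>The zero ideal is excluded because every \<open>X - c\<close> would divide a power of
  the fixed nonzero \<open>g\<close>, although an infinite field contains some \<open>c\<close> that
  is not a root of \<open>g\<close>. A nonzero element of \<open>P\<close> then splits into linear
  factors, one of which lies in \<open>P\<close>.\<close>

lemma prime_goldman_linear:
  fixes P :: "'k::alg_closed_field poly set"
  assumes P: "is_prime_ideal P" and "goldman P g"
  shows "\<exists>c. [:- c, 1:] \<in> P"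
proof -
  note P' = prime_idealD[OF P]
  have gP: "g \<notin> P" and inv: "\<And>a. a \<notin> P \<Longrightarrow> \<exists>b n. a * b - g ^ n \<in> P"
    using assms(2) by (auto simp: goldman_def)
  obtain f where f: "f \<in> P" "f \<noteq> 0"
  proof (rule ccontr)
    assume "\<not> thesis"
    then have P0: "P = {0}" using that P'(1) by blast
    have "finite {x. poly g x = 0}" using gP P0 by (auto intro: poly_roots_finite)
    then obtain c where c: "poly g c \<noteq> 0"
      using alg_closed_infinite by (metis (mono_tags) ex_new_if_finite mem_Collect_eq)
    obtain b n where "[:- c, 1:] * b - g ^ n = 0" using inv[of "[:- c, 1:]"] P0 by auto
    then have "poly ([:- c, 1:] * b) c = poly (g ^ n) c" by simp
    then show False using c by simp
  qed
  have "f \<noteq> 0 \<Longrightarrow> f \<in> P \<Longrightarrow> ?thesis" for f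
  proof (induction "degree f" arbitrary: f rule: less_induct)
    case less
    show ?case
    proof (cases "degree f = 0")
      case True
      then obtain a where a: "f = [:a:]" by (meson degree_eq_zeroE)
      then have "[:inverse a:] * f = 1" using less.prems by (simp add: one_pCons)
      then show ?thesis using P'(3,5) less.prems by metis
    next
      case False
      then obtain c where "poly f c = 0" using alg_closed_imp_poly_has_root by blast
      then obtain h where h: "f = [:- c, 1:] * h" by (metis dvdE poly_eq_0_iff_dvd)
      then have "h \<noteq> 0" using less.prems by auto
      then have "degree f = Suc (degree h)" unfolding h by (subst degree_mult_eq) auto
      moreover have "[:- c, 1:] \<in> P \<or> h \<in> P" using P'(6) less.prems h by blast
      ultimately show ?thesis using less.hyps[of h] \<open>h \<noteq> 0\<close> by auto
    qed
  qed
  then show ?thesis using f by blast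
qed

text \<open>Three contractions lead to a Goldman ideal in one variable. Only the innermost variable
  receives its value; the others are reached by permuting the roles of the variables.\<close>

lemma nullstellensatz4:
  fixes P :: "'k::alg_closed_field poly poly poly poly set"
  assumes P: "is_prime_ideal P" and g: "goldman P g"
  shows "\<exists>c. [:[:[:[:- c, 1:]:]:]:] \<in> P"

proof -
  let ?P1 = "{r. [:r:] \<in> P}" let ?P2 = "{r. [:r:] \<in> ?P1}" let ?P3 = "{r. [:r:] \<in> ?P2}"
  have 1: "is_prime_ideal ?P1" by (rule prime_ideal_contract[OF P])
  have 2: "is_prime_ideal ?P2" by (rule prime_ideal_contract[OF 1])
  have 3: "is_prime_ideal ?P3" by (rule prime_ideal_contract[OF 2])
  obtain g1 where "goldman ?P1 g1" using goldman_contract[OF P g] by blast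
  then obtain g2 where "goldman ?P2 g2" using goldman_contract[OF 1] by blast
  then obtain g3 where "goldman ?P3 g3" using goldman_contract[OF 2] by blast
  then show ?thesis using prime_goldman_linear[OF 3] by auto
qed

section \<open>Central elements act by scalars\<close>

definition central_hom :: "('c::comm_ring_1 \<Rightarrow> 'r::ring_1) \<Rightarrow> bool" where
  "central_hom \<phi> \<longleftrightarrow> \<phi> 0 = 0 \<and> \<phi> 1 = 1 \<and> (\<forall>a b. \<phi> (a + b) = \<phi> a + \<phi> b) \<and>
     (\<forall>a b. \<phi> (a * b) = \<phi> a * \<phi> b) \<and> (\<forall>a m. \<phi> a * m = m * \<phi> a)"

lemma central_homD:
  assumes "central_hom \<phi>"
  shows "\<phi> 0 = 0" "\<phi> 1 = 1" "\<phi> (a + b) = \<phi> a + \<phi> b" "\<phi> (a * b) = \<phi> a * \<phi> b" "\<phi> a * m = m * \<phi> a"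
    "\<phi> (- a) = - \<phi> a" "\<phi> (a - b) = \<phi> a - \<phi> b"
proof -
  show A: "\<phi> 0 = 0" "\<phi> 1 = 1" "\<phi> (a + b) = \<phi> a + \<phi> b" "\<phi> (a * b) = \<phi> a * \<phi> b" "\<phi> a * m = m * \<phi> a" for a b m
    using assms unfolding central_hom_def by blast+
  show M: "\<phi> (- a) = - \<phi> a" for a
    using A(3)[of a "- a"] A(1) by (simp add: eq_neg_iff_add_eq_0 add.commute)
  show "\<phi> (a - b) = \<phi> a - \<phi> b" using A(3)[of a "- b"] by (simp add: M)
qed

definition poly_lift :: "('c::comm_ring_1 \<Rightarrow> 'r::ring_1) \<Rightarrow> 'r \<Rightarrow> 'c poly \<Rightarrow> 'r" where
  "poly_lift \<phi> z q = fold_coeffs (\<lambda>a b. \<phi> a + b * z) q 0"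

lemma poly_lift_pCons:
  "\<phi> 0 = 0 \<Longrightarrow> poly_lift \<phi> z (pCons a q) = \<phi> a + poly_lift \<phi> z q * z"
  by (simp add: poly_lift_def fold_coeffs_def cCons_def)

text \<open>Evaluation is multiplicative even if \<open>z\<close> is not central: the coefficients
  are central and the powers of \<open>z\<close> commute with each other.
  \<open>central_acts_by_scalar\<close> iterates it at central elements, \<open>eigenvector\<close>
  uses it at arbitrary ones.\<close>

lemma poly_lift_hom:
  assumes \<phi>: "central_hom \<phi>"
  shows "poly_lift \<phi> z 0 = 0" "poly_lift \<phi> z (a + b) = poly_lift \<phi> z a + poly_lift \<phi> z b"
    "poly_lift \<phi> z (a * b) = poly_lift \<phi> z a * poly_lift \<phi> z b"
    "poly_lift \<phi> z [:c:] = \<phi> c" "poly_lift \<phi> z [:c, 1:] = \<phi> c + z"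
    "poly_lift \<phi> z (monom 1 n) = z ^ n"
proof -
  note \<phi>' = central_homD[OF \<phi>]
  note pC = poly_lift_pCons[of \<phi>, OF \<phi>'(1)]
  let ?l = "poly_lift \<phi> z"
  show l0: "?l 0 = 0" by (simp add: poly_lift_def)
  show "?l [:c:] = \<phi> c" "?l [:c, 1:] = \<phi> c + z" by (simp_all add: pC l0 \<phi>'(2))
  show add: "?l (a + b) = ?l a + ?l b" for a b
    by (induction a b rule: poly_induct2) (simp_all add: pC l0 \<phi>'(1-4) algebra_simps)
  have sm: "?l (smult c a) = \<phi> c * ?l a" for c a
    by (induction a) (simp_all add: pC l0 \<phi>'(1-4) distrib_left mult.assoc)
  have com: "z * ?l a = ?l a * z" for a
    by (induction a) (simp_all add: pC l0 distrib_left distrib_right \<phi>'(5)[of _ z] flip: mult.assoc)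
  show "?l (a * b) = ?l a * ?l b" for a b
    by (induction a) (simp_all add: pC l0 add sm \<phi>'(1) distrib_right mult.assoc com[of b])
  show "?l (monom 1 n) = z ^ n"
    by (induction n) (simp_all add: monom_0 monom_Suc pC l0 \<phi>'(1,2) power_commutes)
qed

lemma central_hom_poly_lift:
  assumes \<phi>: "central_hom \<phi>" and z: "\<And>m. z * m = m * z"
  shows "central_hom (poly_lift \<phi> z)" "poly_lift \<phi> z [:a:] = \<phi> a" "poly_lift \<phi> z [:0, 1:] = z"
proof -
  note \<phi>' = central_homD[OF \<phi>] and l = poly_lift_hom[OF \<phi>, of z]
  show C: "poly_lift \<phi> z [:a:] = \<phi> a" for a by (rule l(4))
  show "poly_lift \<phi> z [:0, 1:] = z" by (simp add: l(5) \<phi>'(1))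
  have cen: "poly_lift \<phi> z a * m = m * poly_lift \<phi> z a" for a m
  proof (induction a arbitrary: m)
    case (pCons a q)
    have "poly_lift \<phi> z q * z * m = m * (poly_lift \<phi> z q * z)" using pCons.IH z by (metis mult.assoc)
    then show ?case using \<phi>'(5)[of a m]
      by (simp add: poly_lift_pCons[of \<phi>, OF \<phi>'(1)] distrib_left distrib_right)
  qed (simp add: l(1))
  show "central_hom (poly_lift \<phi> z)"
    unfolding central_hom_def using l(1-3) cen C[of 1] \<phi>'(2) unfolding one_pCons by metis
qed

definition left_ideal :: "'r::ring_1 set \<Rightarrow> bool" where
  "left_ideal L \<longleftrightarrow> 0 \<in> L \<and> (\<forall>a\<in>L. \<forall>b\<in>L. a + b \<in> L) \<and> (\<forall>a. \<forall>b\<in>L. a * b \<in> L)"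

definition maximal_left_ideal :: "'r::ring_1 set \<Rightarrow> bool" where
  "maximal_left_ideal L \<longleftrightarrow> left_ideal L \<and> 1 \<notin> L \<and>
     (\<forall>N. left_ideal N \<longrightarrow> L \<subseteq> N \<longrightarrow> N = L \<or> N = UNIV)"

lemma left_idealD:
  assumes "left_ideal L"
  shows "0 \<in> L" "a \<in> L \<Longrightarrow> b \<in> L \<Longrightarrow> a + b \<in> L" "b \<in> L \<Longrightarrow> a * b \<in> L" "a \<in> L \<Longrightarrow> - a \<in> L"
    "a \<in> L \<Longrightarrow> b \<in> L \<Longrightarrow> a - b \<in> L"
proof -
  show A: "0 \<in> L" "a \<in> L \<Longrightarrow> b \<in> L \<Longrightarrow> a + b \<in> L" "b \<in> L \<Longrightarrow> a * b \<in> L" for a b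
    using assms by (auto simp: left_ideal_def)
  show M: "a \<in> L \<Longrightarrow> - a \<in> L" for a using A(3)[of a "-1"] by simp
  show "a \<in> L \<Longrightarrow> b \<in> L \<Longrightarrow> a - b \<in> L" using A(2)[of a "- b"] M by simp
qed

text \<open>By Schur and Nakayama the kernel of \<open>k[X\<^sub>1,\<dots>,X\<^sub>4] \<rightarrow> End(A/L)\<close> is a maximal ideal.\<close>

lemma central_acts_by_scalar:
  fixes \<sigma> :: "'k::alg_closed_field \<Rightarrow> 'r::ring_1"
  assumes \<sigma>: "central_hom \<sigma>" and L: "maximal_left_ideal L"
    and z: "\<And>m. z1 * m = m * z1" "\<And>m. z2 * m = m * z2" "\<And>m. z3 * m = m * z3" "\<And>m. z4 * m = m * z4"
    and B: "finite B"
    and gen: "\<And>N. B \<subseteq> N \<Longrightarrow> 0 \<in> N \<Longrightarrow> (\<And>a b. a \<in> N \<Longrightarrow> b \<in> N \<Longrightarrow> a + b \<in> N) \<Longrightarrow>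
      (\<And>c a. a \<in> N \<Longrightarrow> \<sigma> c * a \<in> N) \<Longrightarrow>
      (\<And>a. a \<in> N \<Longrightarrow> z1 * a \<in> N \<and> z2 * a \<in> N \<and> z3 * a \<in> N \<and> z4 * a \<in> N) \<Longrightarrow> N = UNIV"
  shows "\<exists>c. \<forall>m. (z1 - \<sigma> c) * m \<in> L"
proof -
  have LI: "left_ideal L" and L1: "1 \<notin> L"
    and Lmax: "\<And>N. left_ideal N \<Longrightarrow> L \<subseteq> N \<Longrightarrow> N = L \<or> N = UNIV"
    using L by (auto simp: maximal_left_ideal_def)
  note L' = left_idealD[OF LI]
  define \<phi>1 where "\<phi>1 = poly_lift \<sigma> z1"
  define \<phi>2 where "\<phi>2 = poly_lift \<phi>1 z2"
  define \<phi>3 where "\<phi>3 = poly_lift \<phi>2 z3"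
  define \<Phi> where "\<Phi> = poly_lift \<phi>3 z4"
  note h1 = central_hom_poly_lift[OF \<sigma> z(1), folded \<phi>1_def]
  note h2 = central_hom_poly_lift[OF h1(1) z(2), folded \<phi>2_def]
  note h3 = central_hom_poly_lift[OF h2(1) z(3), folded \<phi>3_def]
  note h4 = central_hom_poly_lift[OF h3(1) z(4), folded \<Phi>_def]
  note \<Phi> = central_homD[OF h4(1)] and \<sigma>' = central_homD[OF \<sigma>]
  define scale where "scale f m = \<Phi> f * m" for f m
  have mod: "Modules.module scale"
    by unfold_locales (auto simp: scale_def \<Phi>(1-4) algebra_simps)
  interpret m: Modules.module scale by (rule mod)
  have subL: "m.subspace L" by (rule m.subspaceI) (auto intro: L' simp: scale_def)
  have "m.span (B \<union> L) = UNIV"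
  proof (rule gen)
    show "B \<subseteq> m.span (B \<union> L)" using m.span_superset by blast
    show "\<sigma> c * a \<in> m.span (B \<union> L)" if "a \<in> m.span (B \<union> L)" for c a
      using m.span_scale[OF that, of "[:[:[:[:c:]:]:]:]"] by (simp add: scale_def h1 h2 h3 h4)
    show "z1 * a \<in> m.span (B \<union> L) \<and> z2 * a \<in> m.span (B \<union> L) \<and> z3 * a \<in> m.span (B \<union> L) \<and>
        z4 * a \<in> m.span (B \<union> L)" if "a \<in> m.span (B \<union> L)" for a
      using m.span_scale[OF that, of "[:[:[:[:0,1:]:]:]:]"] m.span_scale[OF that, of "[:[:[:0,1:]:]:]"]
        m.span_scale[OF that, of "[:[:0,1:]:]"] m.span_scale[OF that, of "[:0,1:]"]
      by (simp add: scale_def h1 h2 h3 h4)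
  qed (auto intro: m.span_zero m.span_add)
  then have sp: "\<exists>k. scale (1 ^ k) u \<in> m.span (B \<union> L)" for u by auto
  define P where "P = {f. \<Phi> f \<in> L}"
  \<comment> \<open>Schur's lemma: as \<open>\<Phi> f\<close> is central, its image and
    \<open>L\<close> together form a left ideal \<open>N\<close>, which is everything as soon as it
    leaves \<open>L\<close>.\<close>
  have div: "\<exists>u'. u - \<Phi> f * u' \<in> L" if "f \<notin> P" for f u
  proof -
    define N where "N = {\<Phi> f * v + l | v l. l \<in> L}"
    have LN: "L \<subseteq> N"
    proof
      fix l assume "l \<in> L"
      moreover have "l = \<Phi> f * 0 + l" by simp
      ultimately show "l \<in> N" unfolding N_def by blast
    qed
    have "left_ideal N"
      unfolding left_ideal_def
    proof (intro conjI ballI allI)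
      show "0 \<in> N" using LN L'(1) by blast
      show "a + b \<in> N" if "a \<in> N" "b \<in> N" for a b
      proof -
        from that obtain v l v' l' where "a = \<Phi> f * v + l" "l \<in> L" "b = \<Phi> f * v' + l'" "l' \<in> L"
          unfolding N_def by blast
        then have "a + b = \<Phi> f * (v + v') + (l + l')" "l + l' \<in> L"
          by (auto simp: algebra_simps intro: L')
        then show ?thesis unfolding N_def by blast
      qed
      show "a * b \<in> N" if "b \<in> N" for a b
      proof -
        from that obtain v l where "b = \<Phi> f * v + l" "l \<in> L" unfolding N_def by blast
        moreover have "a * (\<Phi> f * v) = \<Phi> f * (a * v)" by (metis \<Phi>(5) mult.assoc)
        ultimately have "a * b = \<Phi> f * (a * v) + a * l" "a * l \<in> L"
          using L'(3) by (simp_all only: distrib_left)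
        then show ?thesis unfolding N_def by blast
      qed
    qed
    moreover have "\<Phi> f = \<Phi> f * 1 + 0" by simp
    then have "\<Phi> f \<in> N" unfolding N_def using L'(1) by blast
    ultimately have "N = UNIV" using Lmax[OF _ LN] that by (auto simp: P_def)
    then obtain v l where "u = \<Phi> f * v + l" "l \<in> L" unfolding N_def by blast
    then show ?thesis by (intro exI[of _ v]) simp
  qed
  have prime: "is_prime_ideal P"
    unfolding is_prime_ideal_def
  proof (intro conjI ballI allI impI)
    show "f \<in> P \<or> h \<in> P" if "f * h \<in> P" for f h
    proof (rule disjCI)
      assume "h \<notin> P"
      then obtain u where u: "1 - \<Phi> h * u \<in> L" using div by blast
      have "\<Phi> f * \<Phi> h \<in> L" using that by (simp add: P_def \<Phi>(4))
      then have "u * (\<Phi> f * \<Phi> h) + \<Phi> f * (1 - \<Phi> h * u) \<in> L" using u L'(2,3) by blast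
      also have "u * (\<Phi> f * \<Phi> h) = \<Phi> f * (\<Phi> h * u)" by (metis \<Phi>(4,5) mult.assoc)
      also have "\<Phi> f * (\<Phi> h * u) + \<Phi> f * (1 - \<Phi> h * u) = \<Phi> f" by (simp add: right_diff_distrib)
      finally show "f \<in> P" by (simp add: P_def)
    qed
  qed (auto simp: P_def \<Phi>(1-4) L1 intro: L')
  \<comment> \<open>With exponent base 1 the Goldman condition says that \<open>P\<close> is
    maximal. By \<open>div\<close> the element \<open>\<Phi> a\<close> acts surjectively on the
    quotient by \<open>L\<close>; Nakayama finds an inverse of it among the polynomials.\<close>
  have "goldman P 1"
    unfolding goldman_def
  proof (intro conjI allI impI)
    show "1 \<notin> P" by (simp add: P_def \<Phi>(2) L1)
    fix a assume "a \<notin> P"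
    then have "\<exists>n u'. scale (1 ^ n) u - scale a u' \<in> L" for u
      using div[of a u] by (simp add: scale_def \<Phi>(2))
    from nakayama_localized[OF mod B subL sp this]
    obtain t c where "\<And>u. \<exists>k. scale (1 ^ k * (1 ^ t - a * c)) u \<in> L" by blast
    from this[of 1] have "\<Phi> (1 - a * c) \<in> L" by (simp add: scale_def \<Phi>(2))
    then have "\<Phi> (a * c - 1) \<in> L" using L'(4)[of "\<Phi> (1 - a * c)"] by (simp add: \<Phi>(2,7))
    then show "\<exists>b n. a * b - 1 ^ n \<in> P" by (auto simp: P_def)
  qed
  then obtain c where "[:[:[:[:- c, 1:]:]:]:] \<in> P" using nullstellensatz4[OF prime] by blast
  then have "\<phi>1 [:- c, 1:] \<in> L" by (simp add: P_def h2 h3 h4)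
  also have "\<phi>1 [:- c, 1:] = z1 - \<sigma> c"
    unfolding \<phi>1_def by (simp add: poly_lift_pCons[of \<sigma>, OF \<sigma>'(1)] \<sigma>'(1-4,6) poly_lift_def)
  finally have *: "z1 - \<sigma> c \<in> L" .
  have "(z1 - \<sigma> c) * m = m * (z1 - \<sigma> c)" for m
    by (simp add: left_diff_distrib right_diff_distrib z(1)[of m] \<sigma>'(5)[of c m])
  then show ?thesis using L'(3)[OF *] by metis
qed

section \<open>Simple modules in terms of maximal left ideals\<close>

lemma jordan_plane_power:
  fixes Y s :: "'r::ring_1"
  assumes "Y * s = s * (Y + s)"
  shows "Y ^ n * s = s * (Y + s) ^ n"
    and "(Y + s) ^ Suc n = Y ^ Suc n + of_nat (Suc n) * s * (Y + s) ^ n"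
    and "Y * s ^ n = s ^ n * (Y + of_nat n * s)"
proof -
  show A: "Y ^ n * s = s * (Y + s) ^ n" for n
  proof (induction n)
    case (Suc n)
    have "Y ^ Suc n * s = Y * (Y ^ n * s)" by (simp add: mult.assoc)
    also have "\<dots> = Y * s * (Y + s) ^ n" by (simp only: Suc.IH mult.assoc)
    finally show ?case by (simp only: assms mult.assoc power_Suc)
  qed simp
  show "(Y + s) ^ Suc n = Y ^ Suc n + of_nat (Suc n) * s * (Y + s) ^ n"
  proof (induction n)
    case (Suc n)
    have "(Y + s) ^ Suc (Suc n) = (Y + s) ^ Suc n * (Y + s)" by (rule power_Suc2)
    also have "\<dots> = Y ^ Suc n * Y + Y ^ Suc n * s + of_nat (Suc n) * s * ((Y + s) ^ n * (Y + s))"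
      by (subst Suc.IH) (simp only: distrib_left distrib_right mult.assoc add_ac)
    also have "\<dots> = Y ^ Suc n * Y + s * (Y + s) ^ Suc n + of_nat (Suc n) * s * (Y + s) ^ Suc n"
      by (simp only: A power_Suc2[of "Y + s" n])
    also have "\<dots> = Y ^ Suc (Suc n) + of_nat (Suc (Suc n)) * s * (Y + s) ^ Suc n"
      by (simp only: power_Suc2[of Y "Suc n"] of_nat_Suc[of "Suc n"] distrib_right mult_1_left add.assoc)
    finally show ?case .
  qed simp
  show "Y * s ^ n = s ^ n * (Y + of_nat n * s)"
  proof (induction n)
    case (Suc n)
    have "Y * s ^ Suc n = Y * s ^ n * s" by (simp only: power_Suc2 mult.assoc)
    also have "\<dots> = s ^ n * (Y * s + of_nat n * s * s)"
      by (simp only: Suc.IH distrib_right mult.assoc)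
    also have "Y * s + of_nat n * s * s = s * (Y + of_nat (Suc n) * s)"
      by (simp add: assms distrib_left distrib_right mult.assoc mult_of_nat_commute)
    finally show ?case by (simp only: power_Suc2 mult.assoc)
  qed simp
qed

lemma jordan_plane_frobenius:
  fixes Y s :: "'r::ring_1"
  assumes "Y * s = s * (Y + s)" "of_nat p = (0 :: 'r)" "p > 0"
  shows "(Y + s) ^ p = Y ^ p"
  using jordan_plane_power(2)[OF assms(1), of "p - 1"] assms(2,3) by simp

text \<open>With \<open>s\<close> inverted, \<open>s\<^sup>-\<^sup>2 Y\<close> and \<open>s\<close> generate a Weyl algebra, in which \<open>p\<close>-th powers are
  central; the exponent \<open>p - 2\<close> replaces \<open>- 2\<close> because \<open>s\<^sup>p\<close> is central.\<close>

lemma jordan_plane_weyl_power: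
  fixes Y s :: "'r::ring_1"
  assumes Ys: "Y * s = s * (Y + s)" and p: "of_nat p = (0 :: 'r)" "p > 2"
  shows "(s ^ (p - 2) * Y) ^ p = s ^ ((p - 2) * p) * Y ^ p"
proof -
  have p2: "of_nat (p - 2) = (- 2 :: 'r)" using p by (simp add: of_nat_diff)
  \<comment> \<open>Moving \<open>Y\<close> past \<open>s ^ ((p - 2) * n)\<close> adds
    \<open>- 2 * n * s\<close> to it, as \<open>p - 2\<close> is \<open>- 2\<close> in the ring. The
    shift by \<open>n - 1\<close> is the one for which \<open>jordan_plane_power(2)\<close>, applied
    to \<open>Y'\<close>, collapses the remaining product to a single power. At \<open>n = p\<close>
    the base becomes \<open>Y + s\<close>, and Frobenius applies.\<close>
  have *: "(s ^ (p - 2) * Y) ^ n = s ^ ((p - 2) * n) * (Y - (of_nat n - 1) * s) ^ n" for n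
  proof (induction n)
    case (Suc n)
    define Y' where "Y' = Y - of_nat n * s"
    have cs: "of_nat n * s * s = s * (of_nat n * s)"
      by (simp add: mult_of_nat_commute mult.assoc)
    have Y's: "Y' * s = s * (Y' + s)"
      by (simp add: Y'_def Ys left_diff_distrib right_diff_distrib distrib_left cs)
    have key: "(Y' - of_nat n * s) * (Y' + s) ^ n = Y' ^ Suc n"
    proof -
      have "Y' ^ Suc n = (Y' + s) * (Y' + s) ^ n - of_nat (Suc n) * s * (Y' + s) ^ n"
        using jordan_plane_power(2)[OF Y's, of n] by simp
      also have "\<dots> = ((Y' + s) - of_nat (Suc n) * s) * (Y' + s) ^ n"
        by (simp only: left_diff_distrib)
      also have "(Y' + s) - of_nat (Suc n) * s = Y' - of_nat n * s" by (simp add: distrib_right)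
      finally show ?thesis by simp
    qed
    have "(s ^ (p - 2) * Y) ^ Suc n =
        s ^ (p - 2) * (Y * s ^ ((p - 2) * n)) * (Y - (of_nat n - 1) * s) ^ n"
      by (simp only: Suc.IH power_Suc mult.assoc)
    also have "Y * s ^ ((p - 2) * n) = s ^ ((p - 2) * n) * (Y' - of_nat n * s)"
      unfolding jordan_plane_power(3)[OF Ys] of_nat_mult p2 by (simp add: Y'_def mult_2 algebra_simps)
    also have "Y - (of_nat n - 1) * s = Y' + s" by (simp add: Y'_def algebra_simps)
    also have "s ^ (p - 2) * (s ^ ((p - 2) * n) * (Y' - of_nat n * s)) * (Y' + s) ^ n =
        s ^ (p - 2) * s ^ ((p - 2) * n) * ((Y' - of_nat n * s) * (Y' + s) ^ n)"
      by (simp only: mult.assoc)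
    also have "\<dots> = s ^ ((p - 2) * Suc n) * Y' ^ Suc n"
      by (simp only: key power_add mult_Suc_right)
    also have "Y' = Y - (of_nat (Suc n) - 1) * s" by (simp add: Y'_def)
    finally show ?case .
  qed simp
  have "(s ^ (p - 2) * Y) ^ p = s ^ ((p - 2) * p) * (Y + s) ^ p"
    using *[of p] p by simp
  then show ?thesis using jordan_plane_frobenius[OF Ys p(1)] p(2) by simp
qed

text \<open>Returns central factors split off from a monomial to their places. In
  \<open>finitely_generated\<close> they are central powers of \<open>s\<close>, \<open>y\<close>
  and \<open>g\<close>, and \<open>W ^ e\<close>.\<close>

lemma central_shuffle:
  fixes Z :: "'r::semigroup_mult"
  assumes Z: "\<And>m. Z * m = m * Z" "\<And>m. Z' * m = m * Z'" "\<And>m. Z'' * m = m * Z''" "\<And>m. U * m = m * U"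
  shows "Z * (Z' * (Z'' * (U * (a * (b * (c * d)))))) = a * ((Z * b) * ((Z' * c) * ((Z'' * d) * U)))"
proof -
  have push: "Z * (v * w) = v * (Z * w)" "Z' * (v * w) = v * (Z' * w)" "Z'' * (v * w) = v * (Z'' * w)" for v w
    by (metis Z mult.assoc)+
  have "Z * (Z' * (Z'' * (U * (a * (b * (c * d)))))) = Z * (Z' * (Z'' * (a * (b * (c * (d * U))))))"
    by (simp only: Z(4)[of "a * (b * (c * d))"] mult.assoc)
  also have "\<dots> = a * (Z * (b * (Z' * (c * (Z'' * (d * U))))))"
    by (simp only: push(1)[of a] push(2)[of a] push(2)[of b] push(3)[of a] push(3)[of b] push(3)[of c])
  finally show ?thesis by (simp only: mult.assoc)
qed

text \<open>\<open>\<sigma>\<close> embeds the field, \<open>h\<close> is the inverse of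
  \<open>g\<close>, and the conjugation relations become rules for moving \<open>g\<close> to the
  right. \<open>gen\<close> is induction over words in the form that suits left ideals: a word grows
  by letters on the left.\<close>

locale super_jordan_bosonization =
  fixes \<sigma> :: "'k::alg_closed_field \<Rightarrow> 'r::ring_1" and x y g h s :: 'r and p :: nat
  assumes \<sigma>: "central_hom \<sigma>"
    and s_def: "s = x * y + y * x"
    and xx: "x * x = 0" and ys0: "y * s = s * y + x * s"
    and gh: "g * h = 1" and hg: "h * g = 1"
    and gx: "g * x = - (x * g)" and gy: "g * y = (x - y) * g"
    and CHAR_p: "of_nat p = (0 :: 'k)" and p: "p > 2"
    and gen: "1 \<in> N \<Longrightarrow> (\<And>a b. a \<in> N \<Longrightarrow> b \<in> N \<Longrightarrow> a + b \<in> N) \<Longrightarrow>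
      (\<And>c a. a \<in> N \<Longrightarrow> \<sigma> c * a \<in> N) \<Longrightarrow> (\<And>a. a \<in> N \<Longrightarrow> x * a \<in> N) \<Longrightarrow>
      (\<And>a. a \<in> N \<Longrightarrow> y * a \<in> N) \<Longrightarrow> (\<And>a. a \<in> N \<Longrightarrow> g * a \<in> N) \<Longrightarrow>
      (\<And>a. a \<in> N \<Longrightarrow> h * a \<in> N) \<Longrightarrow> N = UNIV"
begin

section \<open>Commutation rules\<close>

lemmas \<sigma>' = central_homD[OF \<sigma>]

lemma \<sigma>_commute: "a * (\<sigma> c * m) = \<sigma> c * (a * m)"
  by (metis \<sigma>'(5) mult.assoc)

lemma \<sigma>_of_nat: "\<sigma> (of_nat n) = of_nat n"
  by (induction n) (simp_all add: \<sigma>'(1-3))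

lemma of_nat_p: "of_nat p = (0 :: 'r)"
  using CHAR_p \<sigma>_of_nat[of p] \<sigma>'(1) by simp

lemma xs: "x * s = s * x"
proof -
  have "x * s = x * x * y + x * y * x" "s * x = x * y * x + y * (x * x)"
    by (simp_all only: s_def distrib_left distrib_right mult.assoc)
  then show ?thesis by (simp add: xx)
qed

lemma ys: "y * s = s * (y + x)"
  by (simp add: ys0 xs distrib_left)

lemma yx: "y * x = s - x * y"
  by (simp add: s_def)

lemma gs: "g * s = s * g"
proof -
  have "g * s = (g * x) * y + (g * y) * x" by (simp only: s_def distrib_left mult.assoc)
  also have "\<dots> = - (x * (g * y)) + (x - y) * (g * x)" by (simp add: gx gy mult.assoc)
  also have "\<dots> = - (x * x * g) + x * y * g - (x * x * g) + y * x * g"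
    by (simp only: gx gy) (simp add: algebra_simps)
  finally show ?thesis by (simp add: xx s_def distrib_right mult.assoc)
qed

lemma hs: "h * s = s * h"
  by (metis gh gs hg mult.assoc mult_1_left mult_1_right)

lemma hx: "h * x = - (x * h)"
proof -
  have "h * x = - (h * (g * x) * h)" using gh hg by (simp add: gx mult.assoc)
  then show ?thesis using hg by (simp flip: mult.assoc)
qed

lemma hy: "h * y = - ((y + x) * h)"
proof -
  have "h * (g * y) * h = h * ((x - y) * g) * h" by (simp only: gy)
  then have "y * h = h * x - h * y"
    using gh hg by (simp add: mult.assoc right_diff_distrib) (simp flip: mult.assoc)
  then have "h * y = h * x - y * h" by simp
  then show ?thesis by (simp add: hx distrib_right)
qed

lemma yg: "y * g = x * g - g * y"
  by (simp add: gy left_diff_distrib)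

lemma yh: "y * h = - (h * y) - x * h"
  by (simp add: hy distrib_right)

definition "Y = y * y"
definition "G = g * g"
text \<open>The inverse of the central element \<open>G ^ p\<close>, kept as an element of its own
  so that negative powers of \<open>g\<close> become polynomial expressions.\<close>

definition "W = (h * h) ^ p"

lemma Ys: "Y * s = s * (Y + s)"
proof -
  have "Y * s = s * ((y + x) * (y + x))" unfolding Y_def by (metis ys mult.assoc)
  also have "\<dots> = s * (y * y + (x * y + y * x) + x * x)" by (simp only: distrib_left distrib_right add_ac)
  finally show ?thesis by (simp add: xx Y_def s_def)
qed

lemma Yx: "Y * x = x * (Y + s)"
proof -
  have "Y * x = y * (s - x * y)" by (simp only: Y_def mult.assoc yx)
  also have "\<dots> = y * s - (y * x) * y" by (simp only: right_diff_distrib mult.assoc)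
  also have "\<dots> = s * (y + x) - (s - x * y) * y" by (simp only: ys yx)
  finally show ?thesis by (simp add: Y_def xs algebra_simps)
qed

lemma hY: "h * Y = (Y + s) * h"
proof -
  have "h * Y = (h * y) * y" by (simp add: Y_def mult.assoc)
  also have "\<dots> = - ((y + x) * (h * y))" by (simp add: hy mult.assoc)
  also have "\<dots> = (y * y + (x * y + y * x) + x * x) * h" by (simp only: hy) (simp add: algebra_simps)
  finally show ?thesis by (simp add: xx Y_def s_def)
qed

section \<open>Central elements and finite generation over them\<close>

lemma central_if_commutes:
  assumes "z * x = x * z" "z * y = y * z" "z * g = g * z"
  shows "z * m = m * z"
proof -
  have h: "z * h = h * z" using assms(3) gh hg by (metis mult.assoc mult_1_left mult_1_right)
  have "{m. z * m = m * z} = UNIV"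
    by (rule gen) (simp_all add: distrib_left distrib_right, (metis \<sigma>'(5) assms h mult.assoc)+)
  then show ?thesis by blast
qed

lemma power_commutes_if:
  fixes a b :: 'r
  shows "a * b = b * a \<Longrightarrow> a ^ n * b = b * a ^ n"
  by (simp add: power_commuting_commutes)

lemma y_spow: "y * s ^ n = s ^ n * y + of_nat n * (s ^ n * x)"
proof (induction n)
  case (Suc n)
  have "y * s ^ Suc n = (y * s ^ n) * s" by (simp only: power_Suc2 mult.assoc)
  also have "\<dots> = s ^ n * (y * s) + of_nat n * (s ^ n * (x * s))"
    by (simp only: Suc.IH distrib_right mult.assoc)
  also have "\<dots> = s ^ Suc n * y + of_nat (Suc n) * (s ^ Suc n * x)"
    by (simp only: ys xs power_Suc2) (simp add: algebra_simps)
  finally show ?case .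
qed simp

lemma spow_central: "s ^ p * m = m * s ^ p"
  by (rule central_if_commutes) (simp_all add: power_commutes_if xs gs y_spow of_nat_p)

text \<open>Moving \<open>Y\<close> past \<open>x\<close> or past \<open>h\<close> exchanges
  \<open>Y\<close> and \<open>Y + s\<close>, and these have the same \<open>p\<close>-th power. For
  \<open>g\<close> the claim follows from that for its inverse \<open>h\<close>.\<close>

lemma Ypow_central: "Y ^ p * m = m * Y ^ p"
proof (rule central_if_commutes)
  have F: "(Y + s) ^ p = Y ^ p" using jordan_plane_frobenius[OF Ys of_nat_p] p by simp
  have "Y ^ n * x = x * (Y + s) ^ n" for n
  proof (induction n)
    case (Suc n)
    have "Y ^ Suc n * x = Y * (Y ^ n * x)" by (simp add: mult.assoc)
    also have "\<dots> = (Y * x) * (Y + s) ^ n" by (simp only: Suc.IH mult.assoc)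
    finally show ?case by (simp only: Yx power_Suc mult.assoc)
  qed simp
  then show "Y ^ p * x = x * Y ^ p" using F by simp
  show "Y ^ p * y = y * Y ^ p" by (rule power_commutes_if) (simp add: Y_def mult.assoc)
  have "h * Y ^ n = (Y + s) ^ n * h" for n
  proof (induction n)
    case (Suc n)
    have "h * Y ^ Suc n = h * Y * Y ^ n" by (simp add: mult.assoc)
    also have "\<dots> = (Y + s) * (h * Y ^ n)" by (simp only: hY mult.assoc)
    finally show ?case by (simp only: Suc.IH power_Suc mult.assoc)
  qed simp
  then have "h * Y ^ p = Y ^ p * h" using F by simp
  then show "Y ^ p * g = g * Y ^ p" using gh hg by (metis mult.assoc mult_1_left mult_1_right)
qed

lemma Gx: "G * x = x * G"
proof -
  have "G * x = g * - (x * g)" by (simp only: G_def mult.assoc gx)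
  also have "\<dots> = - (g * x) * g" by (simp add: mult.assoc)
  also have "\<dots> = x * G" by (simp only: gx) (simp add: G_def mult.assoc)
  finally show ?thesis .
qed

lemma Gy: "G * y = (y - 2 * x) * G"
proof -
  have "G * y = g * ((x - y) * g)" by (simp only: G_def mult.assoc gy)
  also have "\<dots> = (g * x - g * y) * g" by (simp add: algebra_simps)
  also have "\<dots> = (y - 2 * x) * G" unfolding gx gy G_def by (simp add: mult_2 algebra_simps)
  finally show ?thesis .
qed

text \<open>Each \<open>G\<close> that passes \<open>y\<close> subtracts \<open>2 * x\<close> from
  it, and \<open>x\<close> commutes with \<open>G\<close>; after \<open>p\<close> passages the
  correction \<open>2 * p * x\<close> vanishes.\<close>

lemma Gpow_central: "G ^ p * m = m * G ^ p"
proof (rule central_if_commutes)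
  show "G ^ p * x = x * G ^ p" by (rule power_commutes_if) (rule Gx)
  show "G ^ p * g = g * G ^ p" by (rule power_commutes_if) (simp add: G_def mult.assoc)
  have "G ^ n * y = (y - of_nat (2 * n) * x) * G ^ n" for n
  proof (induction n)
    case (Suc n)
    have "G ^ Suc n * y = G * ((y - of_nat (2 * n) * x) * G ^ n)"
      by (simp only: Suc.IH[symmetric] power_Suc mult.assoc)
    also have "\<dots> = (G * y - G * (of_nat (2 * n) * x)) * G ^ n"
      by (simp only: right_diff_distrib mult.assoc[symmetric])
    also have "G * (of_nat (2 * n) * x) = of_nat (2 * n) * (x * G)"
      by (metis Gx mult.assoc mult_of_nat_commute)
    also have "(G * y - of_nat (2 * n) * (x * G)) * G ^ n = (y - of_nat (2 * Suc n) * x) * G ^ Suc n"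
      unfolding Gy by (simp add: mult_2 algebra_simps)
    finally show ?case .
  qed simp
  from this[of p] show "G ^ p * y = y * G ^ p" using of_nat_p by simp
qed

lemma GW: "G ^ p * W = 1" "W * G ^ p = 1"
proof -
  have "g * g * (h * h) = 1" "h * h * (g * g) = 1"
    by (metis gh hg mult.assoc mult_1_left mult_1_right)+
  then show "G ^ p * W = 1" "W * G ^ p = 1"
    unfolding G_def W_def by (metis left_right_inverse_power)+
qed

lemma W_central: "W * m = m * W"
proof -
  have "W * m = W * (m * G ^ p) * W" by (simp add: mult.assoc GW)
  also have "\<dots> = W * G ^ p * (m * W)" by (metis Gpow_central mult.assoc)
  finally show ?thesis by (simp add: GW)
qed

text \<open>The monomials \<open>x ^ a * s ^ b * y ^ c * g ^ d * W ^ e\<close> with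
  \<open>a < 2\<close> span the algebra, since their span contains 1 and is stable under left
  multiplication by the generators. The central elements then absorb all but finitely many
  exponents.\<close>

lemma finitely_generated:
  assumes B: "B = (\<lambda>(a, b, c, d). x ^ a * (s ^ b * (y ^ c * g ^ d))) `
      ({..<2} \<times> {..<p} \<times> {..<2 * p} \<times> {..<2 * p})"
    and "B \<subseteq> N" "0 \<in> N" and add: "\<And>a b. a \<in> N \<Longrightarrow> b \<in> N \<Longrightarrow> a + b \<in> N"
    and sm: "\<And>c a. a \<in> N \<Longrightarrow> \<sigma> c * a \<in> N"
    and z: "\<And>a. a \<in> N \<Longrightarrow> s ^ p * a \<in> N" "\<And>a. a \<in> N \<Longrightarrow> Y ^ p * a \<in> N"
      "\<And>a. a \<in> N \<Longrightarrow> G ^ p * a \<in> N" "\<And>a. a \<in> N \<Longrightarrow> W * a \<in> N"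
  shows "N = UNIV"
proof -
  define scale where "scale c m = \<sigma> c * m" for c m
  interpret m: Modules.module scale
    by unfold_locales (simp_all add: scale_def \<sigma>'(1-4) algebra_simps)
  define mon where "mon a b c d e = x ^ a * (s ^ b * (y ^ c * (g ^ d * W ^ e)))" for a b c d e
  define M where "M = {mon a b c d e | a b c d e. a < 2}"
  have monM: "mon a b c d e \<in> m.span M" if "a < 2" for a b c d e
    using that unfolding M_def by (intro m.span_base) blast
  have sc: "\<sigma> c * m \<in> m.span M" if "m \<in> m.span M" for c m
    using m.span_scale[OF that, of c] by (simp add: scale_def)
  have closure: "l * m \<in> m.span M"
    if m: "m \<in> m.span M" and l: "\<And>a b c d e. a < 2 \<Longrightarrow> l * mon a b c d e \<in> m.span M" for l m
  proof -
    have "m.subspace {m. l * m \<in> m.span M}"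
      by (rule m.subspaceI) (auto simp: distrib_left scale_def \<sigma>_commute m.span_zero intro: m.span_add sc)
    moreover have "M \<subseteq> {m. l * m \<in> m.span M}"
    proof
      fix u assume "u \<in> M"
      then obtain a b c d e where "u = mon a b c d e" "a < 2" unfolding M_def by blast
      then show "u \<in> {m. l * m \<in> m.span M}" using l by simp
    qed
    ultimately show ?thesis using m.span_minimal m by blast
  qed
  have cW: "W * m \<in> m.span M" if "m \<in> m.span M" for m
  proof (rule closure[OF that])
    fix a b c d e assume a: "(a::nat) < 2"
    have "W * mon a b c d e = mon a b c d (Suc e)"
      by (simp only: W_central[of "mon a b c d e"]) (simp only: mon_def mult.assoc power_Suc2)
    then show "W * mon a b c d e \<in> m.span M" using monM[OF a] by simp
  qed
  have cx: "x * m \<in> m.span M" if "m \<in> m.span M" for m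
  proof (rule closure[OF that])
    fix a b c d e assume "(a::nat) < 2"
    then consider "a = 0" | "a = 1" by linarith
    then show "x * mon a b c d e \<in> m.span M"
    proof cases
      case 1
      then show ?thesis using monM[of 1 b c d e] by (simp add: mon_def)
    next
      case 2
      then show ?thesis using xx by (simp add: mon_def m.span_zero flip: mult.assoc)
    qed
  qed
  have cs: "s * m \<in> m.span M" if "m \<in> m.span M" for m
  proof (rule closure[OF that])
    fix a b c d e assume a: "(a::nat) < 2"
    have "s * mon a b c d e = (x ^ a * s) * (s ^ b * (y ^ c * (g ^ d * W ^ e)))"
      by (simp add: mon_def power_commutes_if[OF xs] flip: mult.assoc)
    also have "\<dots> = mon a (Suc b) c d e" by (simp add: mon_def mult.assoc)
    finally show "s * mon a b c d e \<in> m.span M" using monM[OF a] by simp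
  qed
  have csn: "s ^ n * m \<in> m.span M" if "m \<in> m.span M" for n m
    by (induction n) (simp_all add: that mult.assoc cs)
  have cxn: "x ^ n * m \<in> m.span M" if "m \<in> m.span M" for n m
    by (induction n) (simp_all add: that mult.assoc cx)
  have cn: "of_nat n * m \<in> m.span M" if "m \<in> m.span M" for n m
    using m.span_scale[OF that, of "of_nat n"] by (simp add: scale_def \<sigma>_of_nat)
  \<comment> \<open>Passing \<open>s ^ b\<close> costs \<open>y\<close> a term with
    \<open>x\<close>, which commutes with \<open>s\<close> and returns to the front. If
    \<open>x\<close> is already in front, \<open>y * x = s - x * y\<close> reduces to this
    case.\<close>
  have y0: "y * mon 0 b c d e \<in> m.span M" for b c d e
  proof -
    have "y * mon 0 b c d e = mon 0 b (Suc c) d e + of_nat b * (x * mon 0 b c d e)"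
      by (simp add: mon_def y_spow distrib_right power_commutes_if[OF xs[symmetric]] flip: mult.assoc)
    then show ?thesis using monM by (auto intro!: m.span_add cn cx)
  qed
  have cy: "y * m \<in> m.span M" if "m \<in> m.span M" for m
  proof (rule closure[OF that])
    fix a b c d e assume "(a::nat) < 2"
    then consider "a = 0" | "a = 1" by linarith
    then show "y * mon a b c d e \<in> m.span M"
    proof cases
      case 2
      have "y * mon 1 b c d e = (y * x) * mon 0 b c d e" by (simp add: mon_def mult.assoc)
      also have "\<dots> = s * mon 0 b c d e - x * (y * mon 0 b c d e)"
        by (simp add: yx left_diff_distrib mult.assoc)
      finally show ?thesis using 2 monM by (auto intro!: m.span_diff cs cx y0)
    qed (simp add: y0)
  qed
  have cg: "g * m \<in> m.span M" if "m \<in> m.span M" for m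
  proof (rule closure[OF that])
    fix a b c d e assume "(a::nat) < 2"
    have y: "g * (y ^ c * (g ^ d * W ^ e)) \<in> m.span M"
    proof (induction c)
      case 0
      show ?case using monM[of 0 0 0 "Suc d" e] by (simp add: mon_def mult.assoc)
    next
      case (Suc c)
      have "g * (y ^ Suc c * (g ^ d * W ^ e)) = (x - y) * (g * (y ^ c * (g ^ d * W ^ e)))"
        using gy by (metis mult.assoc power_Suc)
      then show ?case using Suc by (auto simp: left_diff_distrib intro!: m.span_diff cx cy)
    qed
    have gxn: "g * x ^ a = (- 1) ^ a * (x ^ a * g)" for a
    proof (induction a)
      case (Suc a)
      have "g * x ^ Suc a = - (x * (g * x ^ a))" by (simp add: gx flip: mult.assoc)
      also have "\<dots> = - (x * (- 1) ^ a * (x ^ a * g))" by (simp add: Suc.IH mult.assoc)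
      also have "x * (- 1) ^ a = (- 1) ^ a * x" by (cases "even a") auto
      finally show ?case by (simp add: mult.assoc)
    qed simp
    have "g * mon a b c d e = (- 1) ^ a * (x ^ a * (g * s ^ b * (y ^ c * (g ^ d * W ^ e))))"
      by (simp add: mon_def gxn flip: mult.assoc)
    also have "g * s ^ b = s ^ b * g" by (rule power_commutes_if[OF gs[symmetric], symmetric])
    also have "(- 1) ^ a * (x ^ a * (s ^ b * g * (y ^ c * (g ^ d * W ^ e)))) =
        (- 1) ^ a * (x ^ a * (s ^ b * (g * (y ^ c * (g ^ d * W ^ e)))))" by (simp only: mult.assoc)
    also have "\<dots> \<in> m.span M"
      using cxn[OF csn[OF y], of a b] m.span_neg[OF cxn[OF csn[OF y], of a b]] by (cases "even a") simp_all
    finally show "g * mon a b c d e \<in> m.span M" .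
  qed
  have cgn: "g ^ n * m \<in> m.span M" if "m \<in> m.span M" for n m
    by (induction n) (simp_all add: that mult.assoc cg)
  \<comment> \<open>\<open>W\<close> is the inverse of \<open>g ^ (2 * p)\<close>; leaving out one
    factor \<open>g\<close> gives the inverse of \<open>g\<close> without negative
    exponents.\<close>
  have hW: "h = W * g ^ (2 * p - 1)"
  proof -
    have "G ^ p = g ^ (2 * p - 1) * g"
      using p by (simp add: G_def flip: power2_eq_square power_mult power_Suc2)
    then have "W * g ^ (2 * p - 1) * g * h = h" using GW by (simp add: mult.assoc)
    then show ?thesis by (simp add: mult.assoc gh)
  qed
  have ch: "h * m \<in> m.span M" if "m \<in> m.span M" for m
    by (subst hW) (simp only: mult.assoc cW cgn that)
  have "m.span M = UNIV"
  proof (rule gen)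
    show "1 \<in> m.span M" using monM[of 0 0 0 0 0] by (simp add: mon_def)
  qed (auto intro: m.span_add sc cx cy cg ch)
  moreover have subN: "m.subspace N"
    by (rule m.subspaceI) (auto simp: scale_def intro: assms)
  moreover have "M \<subseteq> N"
  proof -
    \<comment> \<open>Division with remainder of the exponents: quotients count central powers,
      remainders fall into the ranges of \<open>B\<close>. The period is \<open>p\<close> for
      \<open>s\<close> but \<open>2 * p\<close> for \<open>y\<close> and \<open>g\<close>, because
      \<open>Y\<close> and \<open>G\<close> are squares.\<close>
    have red: "(u ^ q) ^ (n div q) * u ^ (n mod q) = u ^ n" for u :: 'r and q n
      by (simp flip: power_mult power_add)
    have zn: "z ^ n * a \<in> N" if "a \<in> N" "\<And>a. a \<in> N \<Longrightarrow> z * a \<in> N" for z a n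
      by (induction n) (simp_all add: that mult.assoc)
    have Y2: "y ^ (2 * p) = Y ^ p" "g ^ (2 * p) = G ^ p"
      by (simp_all add: Y_def G_def power_mult power2_eq_square)
    have "mon a b c d e \<in> N" if "a < 2" for a b c d e
    proof -
      let ?zs = "(s ^ p) ^ (b div p)" let ?zy = "(Y ^ p) ^ (c div (2 * p))"
      let ?zg = "(G ^ p) ^ (d div (2 * p))" let ?u = "x ^ a * (s ^ (b mod p) * (y ^ (c mod (2 * p)) * g ^ (d mod (2 * p))))"
      have "(a, b mod p, c mod (2 * p), d mod (2 * p)) \<in> {..<2} \<times> {..<p} \<times> {..<2 * p} \<times> {..<2 * p}"
        using that p by simp
      then have "?u \<in> B" unfolding B by (rule rev_image_eqI) simp
      then have u: "?u \<in> N" using \<open>B \<subseteq> N\<close> by blast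
      have "?zs * (?zy * (?zg * (W ^ e * ?u))) \<in> N"
        by (rule zn[OF zn[OF zn[OF zn[OF u z(4)] z(3)] z(2)] z(1)])
      also have "?zs * (?zy * (?zg * (W ^ e * ?u))) = mon a b c d e"
      proof -
        have com: "?zs * m = m * ?zs" "?zy * m = m * ?zy" "?zg * m = m * ?zg" "W ^ e * m = m * W ^ e" for m
          by (intro power_commutes_if spow_central Ypow_central Gpow_central W_central)+
        have b: "s ^ b = ?zs * s ^ (b mod p)" by (simp add: red)
        have c: "y ^ c = ?zy * y ^ (c mod (2 * p))" by (simp add: red flip: Y2)
        have d: "g ^ d = ?zg * g ^ (d mod (2 * p))" by (simp add: red flip: Y2)
        show ?thesis
          unfolding central_shuffle[of ?zs ?zy ?zg "W ^ e", OF com] mon_def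
          by (simp only: b[symmetric] c[symmetric] d[symmetric] mult.assoc[of _ "g ^ d" "W ^ e", symmetric])
      qed
      finally show ?thesis .
    qed
    then show ?thesis by (auto simp: M_def)
  qed
  ultimately show ?thesis using m.span_minimal by blast
qed

section \<open>Scalars and eigenvectors modulo a left ideal\<close>

lemma left_ideal_if_closed:
  assumes "0 \<in> N" and add: "\<And>a b. a \<in> N \<Longrightarrow> b \<in> N \<Longrightarrow> a + b \<in> N"
    and "\<And>c a. a \<in> N \<Longrightarrow> \<sigma> c * a \<in> N" "\<And>a. a \<in> N \<Longrightarrow> x * a \<in> N" "\<And>a. a \<in> N \<Longrightarrow> y * a \<in> N"
      "\<And>a. a \<in> N \<Longrightarrow> g * a \<in> N" "\<And>a. a \<in> N \<Longrightarrow> h * a \<in> N"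
  shows "left_ideal N"
proof -
  have "{a. \<forall>m\<in>N. a * m \<in> N} = UNIV"
    by (rule gen) (auto simp: distrib_right mult.assoc intro: assms)
  then show ?thesis using assms(1) add by (auto simp: left_ideal_def)
qed

lemma generators_act_by_scalars:
  assumes L: "maximal_left_ideal L"
  obtains \<beta> \<zeta> \<nu> \<omega> where "\<And>m. (s ^ p - \<sigma> \<beta>) * m \<in> L" "\<And>m. (Y ^ p - \<sigma> \<zeta>) * m \<in> L"
    "\<And>m. (G ^ p - \<sigma> \<nu>) * m \<in> L" "\<And>m. (W - \<sigma> \<omega>) * m \<in> L"
proof -
  define B where B: "B = (\<lambda>(a, b, c, d). x ^ a * (s ^ b * (y ^ c * g ^ d))) `
      ({..<2} \<times> {..<p} \<times> {..<2 * p} \<times> {..<2 * p})"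
  have fin: "finite B" unfolding B by simp
  note scalar = central_acts_by_scalar[OF \<sigma> L _ _ _ _ fin]
  note cen = spow_central Ypow_central Gpow_central W_central
  \<comment> \<open>The scalar lemma speaks about its first element, so the four central elements
    take the first place in turn.\<close>
  have "\<exists>c. \<forall>m. (s ^ p - \<sigma> c) * m \<in> L"
    by (rule scalar[OF cen(1) cen(2) cen(3) cen(4)], rule finitely_generated[OF B]) blast+
  moreover have "\<exists>c. \<forall>m. (Y ^ p - \<sigma> c) * m \<in> L"
    by (rule scalar[OF cen(2) cen(1) cen(3) cen(4)], rule finitely_generated[OF B]) blast+
  moreover have "\<exists>c. \<forall>m. (G ^ p - \<sigma> c) * m \<in> L"
    by (rule scalar[OF cen(3) cen(2) cen(1) cen(4)], rule finitely_generated[OF B]) blast+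
  moreover have "\<exists>c. \<forall>m. (W - \<sigma> c) * m \<in> L"
    by (rule scalar[OF cen(4) cen(2) cen(3) cen(1)], rule finitely_generated[OF B]) blast+
  ultimately show thesis using that by blast
qed

text \<open>\<open>X ^ n - c\<close> splits into linear factors; when they are peeled off, the last
  vector still outside \<open>L\<close> is an eigenvector modulo \<open>L\<close>. The stable set
  \<open>E\<close> preserves what has been achieved before, such as lying in the kernel of
  \<open>x\<close> or in an eigenspace of another operator.\<close>

lemma eigenvector:
  assumes L: "left_ideal L" and E: "\<And>a b. a \<in> E \<Longrightarrow> b \<in> E \<Longrightarrow> a + b \<in> E" "0 \<in> E"
      "\<And>c m. m \<in> E \<Longrightarrow> \<sigma> c * m \<in> E" "\<And>m. m \<in> E \<Longrightarrow> a * m \<in> E"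
    and m: "m \<in> E" "m \<notin> L" and n: "n > 0" "(a ^ n - \<sigma> c) * m \<in> L"
  obtains m' \<mu> where "m' \<in> E" "m' \<notin> L" "(a - \<sigma> \<mu>) * m' \<in> L"
proof -
  note L' = left_idealD[OF L] and ev = poly_lift_hom[OF \<sigma>, of a]
  have Eev: "poly_lift \<sigma> a q * u \<in> E" if "u \<in> E" for q u
    using that
  proof (induction q arbitrary: u)
    case (pCons b q)
    then show ?case
      by (simp add: poly_lift_pCons[of \<sigma>, OF \<sigma>'(1)] distrib_right mult.assoc E)
  qed (simp add: ev E)
  have "\<exists>m' \<mu>. m' \<in> E \<and> m' \<notin> L \<and> (a - \<sigma> \<mu>) * m' \<in> L"
    if "q \<noteq> 0" "poly_lift \<sigma> a q * m \<in> L" for q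
    using that
  proof (induction "degree q" arbitrary: q rule: less_induct)
    case less
    show ?case
    proof (cases "degree q = 0")
      case True
      then obtain b where b: "q = [:b:]" by (meson degree_eq_zeroE)
      then have "b \<noteq> 0" using less.prems by auto
      have "\<sigma> (inverse b) * (\<sigma> b * m) \<in> L" using less.prems(2) L'(3) unfolding b ev(4) by blast
      also have "\<sigma> (inverse b) * (\<sigma> b * m) = m"
        using \<open>b \<noteq> 0\<close> by (simp add: \<sigma>'(2) flip: mult.assoc \<sigma>'(4))
      finally show ?thesis using m by blast
    next
      case False
      then obtain \<mu> where "poly q \<mu> = 0" using alg_closed_imp_poly_has_root by blast
      then obtain r where r: "q = [:- \<mu>, 1:] * r" by (metis dvdE poly_eq_0_iff_dvd)
      have r0: "r \<noteq> 0" using r less.prems by auto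
      have e: "(a - \<sigma> \<mu>) * (poly_lift \<sigma> a r * m) \<in> L"
        using less.prems(2) unfolding r ev(3,5) by (simp add: \<sigma>'(6) mult.assoc)
      show ?thesis
      proof (cases "poly_lift \<sigma> a r * m \<in> L")
        case True
        have "degree q = Suc (degree r)" unfolding r by (subst degree_mult_eq) (use r0 in auto)
        then show ?thesis using less.hyps[of r] r0 True by simp
      next
        case False
        then show ?thesis using e Eev m by blast
      qed
    qed
  qed
  moreover have "monom 1 n + [:- c:] \<noteq> 0"
    using n(1) by (metis coeff_0 coeff_add coeff_monom coeff_pCons_Suc Suc_pred add.right_neutral one_neq_zero)
  moreover have "poly_lift \<sigma> a (monom 1 n + [:- c:]) * m \<in> L"
    unfolding ev(2,4,6) using n(2) by (simp add: \<sigma>'(6))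
  ultimately show thesis using that by blast
qed

lemma acts_by_scalar_mult:
  assumes L: "left_ideal L" and a: "\<And>m. (a - \<sigma> c) * m \<in> L" and b: "\<And>m. (b - \<sigma> d) * m \<in> L"
  shows "(a * b - \<sigma> (c * d)) * m \<in> L"
proof -
  have "(a * b - \<sigma> (c * d)) * m = a * ((b - \<sigma> d) * m) + \<sigma> d * ((a - \<sigma> c) * m)"
    by (simp add: left_diff_distrib right_diff_distrib mult.assoc \<sigma>_commute[of a] mult.commute[of c]
      \<sigma>'(4))
  then show ?thesis using left_idealD(2,3)[OF L] a b by simp
qed

lemma acts_by_scalar_power:
  assumes L: "left_ideal L" and a: "\<And>m. (a - \<sigma> c) * m \<in> L"
  shows "(a ^ n - \<sigma> (c ^ n)) * m \<in> L"
proof (induction n arbitrary: m)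
  case (Suc n)
  then show ?case using acts_by_scalar_mult[OF L a] by simp
qed (simp add: \<sigma>'(2) left_idealD(1)[OF L])

lemma scalar_mult_iff:
  assumes L: "left_ideal L" and "c \<noteq> 0"
  shows "\<sigma> c * m \<in> L \<longleftrightarrow> m \<in> L"
proof
  assume "\<sigma> c * m \<in> L"
  then have "\<sigma> (inverse c) * (\<sigma> c * m) \<in> L" using left_idealD(3)[OF L] by blast
  also have "\<sigma> (inverse c) * (\<sigma> c * m) = m"
    using \<open>c \<noteq> 0\<close> by (simp add: \<sigma>'(2) flip: mult.assoc \<sigma>'(4))
  finally show "m \<in> L" .
qed (rule left_idealD(3)[OF L])

text \<open>The equations satisfied by a generator of the class of \<open>S\<^sub>\<gamma>\<close>, by \<open>e\<^sub>0\<close> in \<open>T\<^sub>\<alpha>\<^sub>,\<^sub>\<beta>\<close> and by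
  \<open>v\<^sub>0\<close> in \<open>V\<^sub>\<alpha>\<^sub>,\<^sub>\<beta>\<^sub>,\<^sub>\<gamma>\<close>.\<close>

definition S_vector :: "'k \<Rightarrow> 'r set \<Rightarrow> 'r \<Rightarrow> bool" where
  "S_vector \<gamma> L m \<longleftrightarrow> x * m \<in> L \<and> y * m \<in> L \<and> s * m \<in> L \<and> (g - \<sigma> \<gamma>) * m \<in> L"

definition T_vector :: "'k \<Rightarrow> 'k \<Rightarrow> 'r set \<Rightarrow> 'r \<Rightarrow> bool" where
  "T_vector \<alpha> \<beta> L m \<longleftrightarrow> x * m \<in> L \<and> x * (g * m) \<in> L \<and> (y - \<sigma> \<alpha>) * m \<in> L \<and> (G - \<sigma> \<beta>) * m \<in> L"

definition V_vector :: "'k \<Rightarrow> 'k \<Rightarrow> 'k \<Rightarrow> 'r set \<Rightarrow> 'r \<Rightarrow> bool" where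
  "V_vector \<alpha> \<beta> \<gamma> L m \<longleftrightarrow> x * m \<in> L \<and> g * m + \<sigma> (inverse \<alpha>) * (s * m) \<in> L \<and>
     (s ^ p - \<sigma> \<beta>) * m \<in> L \<and> Y * m - 2 * (s * m) - \<sigma> \<gamma> * (s * (s * m)) \<in> L"

section \<open>Generating vectors of the simple modules\<close>

lemma g_in_iff: "left_ideal L \<Longrightarrow> g * m \<in> L \<longleftrightarrow> m \<in> L"
  by (metis hg left_idealD(3) mult.assoc mult_1_left)

lemma h_in_iff: "left_ideal L \<Longrightarrow> h * m \<in> L \<longleftrightarrow> m \<in> L"
  by (metis gh left_idealD(3) mult.assoc mult_1_left)

lemma simple_s_zero:
  assumes L: "maximal_left_ideal L" and s0: "\<And>m. s * m \<in> L"
  shows "(\<exists>\<gamma> m. \<gamma> \<noteq> 0 \<and> m \<notin> L \<and> S_vector \<gamma> L m) \<or>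
    (\<exists>\<alpha> \<beta> m. \<alpha> \<noteq> 0 \<and> \<beta> \<noteq> 0 \<and> m \<notin> L \<and> T_vector \<alpha> \<beta> L m)"
proof -
  have LI: "left_ideal L" and L1: "1 \<notin> L"
    and Lmax: "\<And>N. left_ideal N \<Longrightarrow> L \<subseteq> N \<Longrightarrow> N = L \<or> N = UNIV"
    using L by (auto simp: maximal_left_ideal_def)
  note L' = left_idealD[OF LI]
  obtain \<beta> \<zeta> \<nu> \<omega> where sc: "\<And>m. (s ^ p - \<sigma> \<beta>) * m \<in> L" "\<And>m. (Y ^ p - \<sigma> \<zeta>) * m \<in> L"
    "\<And>m. (G ^ p - \<sigma> \<nu>) * m \<in> L" "\<And>m. (W - \<sigma> \<omega>) * m \<in> L"
    using generators_act_by_scalars[OF L] by blast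
  \<comment> \<open>As \<open>s\<close> acts by zero, \<open>x\<close> and \<open>y\<close>
    anticommute, so the kernel of \<open>x\<close> is a left ideal \<open>N\<close>. It is not
    \<open>L\<close>: since \<open>x * x = 0\<close>, it contains \<open>x\<close>, and
    \<open>x\<close> in \<open>L\<close> would put 1 into \<open>N\<close>.\<close>
  have x0: "x * m \<in> L" for m
  proof -
    define N where "N = {m. x * m \<in> L}"
    have "left_ideal N"
    proof (rule left_ideal_if_closed)
      fix a assume "a \<in> N"
      then have a: "x * a \<in> L" by (simp add: N_def)
      have "x * (x * a) = 0" using xx by (simp flip: mult.assoc)
      then show "x * a \<in> N" using L'(1) by (simp add: N_def)
      have "x * (y * a) = s * a - y * (x * a)" by (simp add: s_def distrib_right mult.assoc)
      then show "y * a \<in> N" using s0 L'(3)[OF a] L'(5) by (simp add: N_def)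
      have "x * (g * a) = - (g * (x * a))" by (simp add: gx flip: mult.assoc)
      then show "g * a \<in> N" using L'(3)[OF a] L'(4) by (simp add: N_def)
      have "x * (h * a) = - (h * (x * a))" by (simp add: hx flip: mult.assoc)
      then show "h * a \<in> N" using L'(3)[OF a] L'(4) by (simp add: N_def)
    qed (auto simp: N_def L' distrib_left \<sigma>_commute)
    moreover have "L \<subseteq> N" using L'(3) by (auto simp: N_def)
    ultimately have "N = L \<or> N = UNIV" by (rule Lmax)
    moreover have "N \<noteq> L"
    proof
      assume N: "N = L"
      have "x \<in> N" using xx L'(1) by (simp add: N_def)
      then have "x * 1 \<in> L" using N by simp
      then have "1 \<in> N" by (simp add: N_def)
      then show False using N L1 by simp
    qed
    ultimately show ?thesis by (auto simp: N_def)
  qed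
  \<comment> \<open>With \<open>x\<close> acting by zero, \<open>y\<close> and \<open>g\<close>
    anticommute, so the kernel of \<open>y\<close> is a left ideal as well. Either \<open>y\<close>
    acts by zero, which leads to \<open>S\<close>, or it is injective and has a nonzero eigenvalue,
    which leads to \<open>T\<close>.\<close>
  define N where "N = {m. y * m \<in> L}"
  have "left_ideal N"
  proof (rule left_ideal_if_closed)
    fix a assume "a \<in> N"
    then have a: "y * a \<in> L" by (simp add: N_def)
    show "x * a \<in> N" using x0 L'(3) by (simp add: N_def)
    show "y * a \<in> N" using a L'(3) by (simp add: N_def)
    have "y * (g * a) = x * (g * a) - g * (y * a)"
      by (simp add: yg left_diff_distrib mult.assoc flip: mult.assoc[of y])
    then show "g * a \<in> N" using x0 L'(3)[OF a] L'(5) by (simp add: N_def)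
    have "y * (h * a) = - (h * (y * a)) - x * (h * a)"
      by (simp add: yh left_diff_distrib mult.assoc flip: mult.assoc[of y])
    then show "h * a \<in> N" using x0 L'(3)[OF a] L'(4,5) by (simp add: N_def)
  qed (auto simp: N_def L' distrib_left \<sigma>_commute)
  moreover have "L \<subseteq> N" using L'(3) by (auto simp: N_def)
  ultimately consider "N = UNIV" | "N = L" using Lmax by blast
  then show ?thesis
  proof cases
    case 1
    then have y0: "y * m \<in> L" for m by (auto simp: N_def)
    have "g ^ (2 * p) = G ^ p" by (simp add: G_def power_mult power2_eq_square)
    then have "(g ^ (2 * p) - \<sigma> \<nu>) * 1 \<in> L" using sc(3) by metis
    then obtain m \<gamma> where m: "m \<notin> L" "(g - \<sigma> \<gamma>) * m \<in> L"
      using eigenvector[OF LI, of UNIV g 1 "2 * p" \<nu>] L1 p by auto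
    have "\<gamma> \<noteq> 0"
    proof
      assume "\<gamma> = 0"
      then have "g * m \<in> L" using m(2) by (simp add: \<sigma>'(1))
      then show False using m(1) g_in_iff[OF LI] by blast
    qed
    moreover have "S_vector \<gamma> L m" using m x0 y0 s0 by (simp add: S_vector_def)
    ultimately show ?thesis using m(1) by blast
  next
    case 2
    have "y ^ (2 * p) = Y ^ p" by (simp add: Y_def power_mult power2_eq_square)
    then have "(y ^ (2 * p) - \<sigma> \<zeta>) * 1 \<in> L" using sc(2) by metis
    then obtain m \<alpha> where m: "m \<notin> L" "(y - \<sigma> \<alpha>) * m \<in> L"
      using eigenvector[OF LI, of UNIV y 1 "2 * p" \<zeta>] L1 p by auto
    have "\<alpha> \<noteq> 0"
    proof
      assume "\<alpha> = 0"
      then have "m \<in> N" using m(2) by (simp add: \<sigma>'(1) N_def)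
      then show False using m(1) 2 by blast
    qed
    \<comment> \<open>\<open>g\<close> turns the eigenvalue \<open>\<alpha>\<close> of
      \<open>y\<close> into \<open>- \<alpha>\<close>, so it is \<open>G = g * g\<close> that
      preserves the eigenspace.\<close>
    define E where "E = {m. (y - \<sigma> \<alpha>) * m \<in> L}"
    have EG: "G * a \<in> E" if "a \<in> E" for a
    proof -
      have "G * (y * a) = (y - 2 * x) * (G * a)" using Gy by (metis mult.assoc)
      then have "y * (G * a) = G * (y * a) + 2 * (x * (G * a))"
        by (simp add: left_diff_distrib mult.assoc)
      then have "(y - \<sigma> \<alpha>) * (G * a) = G * ((y - \<sigma> \<alpha>) * a) + 2 * (x * (G * a))"
        by (simp add: left_diff_distrib right_diff_distrib \<sigma>_commute mult.assoc)
      then show ?thesis using that x0 L'(2,3) by (simp add: E_def)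
    qed
    obtain m' \<beta> where m': "m' \<in> E" "m' \<notin> L" "(G - \<sigma> \<beta>) * m' \<in> L"
    proof (rule eigenvector[OF LI, of E G m p \<nu>])
      show "\<sigma> c * a \<in> E" if "a \<in> E" for c a
        using that L'(3) by (simp add: E_def \<sigma>_commute)
    qed (use m sc(3) p EG in \<open>auto simp: E_def distrib_left L'\<close>)
    have "\<beta> \<noteq> 0"
    proof
      assume "\<beta> = 0"
      then have "g * (g * m') \<in> L" using m'(3) by (simp add: \<sigma>'(1) G_def mult.assoc)
      then show False using m'(2) g_in_iff[OF LI] by blast
    qed
    moreover have "T_vector \<alpha> \<beta> L m'" using m' x0 by (simp add: T_vector_def E_def)
    ultimately show ?thesis using m'(2) \<open>\<alpha> \<noteq> 0\<close> by blast
  qed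
qed

lemma simple_s_injective:
  assumes L: "maximal_left_ideal L" and s_inj: "\<And>m. s * m \<in> L \<Longrightarrow> m \<in> L"
  shows "\<exists>\<alpha> \<beta> \<gamma> m. \<alpha> \<noteq> 0 \<and> \<beta> \<noteq> 0 \<and> m \<notin> L \<and> V_vector \<alpha> \<beta> \<gamma> L m"
proof -
  have LI: "left_ideal L" and L1: "1 \<notin> L"
    using L by (auto simp: maximal_left_ideal_def)
  note L' = left_idealD[OF LI]
  obtain \<beta> \<zeta> \<nu> \<omega> where sc: "\<And>m. (s ^ p - \<sigma> \<beta>) * m \<in> L" "\<And>m. (Y ^ p - \<sigma> \<zeta>) * m \<in> L"
    "\<And>m. (G ^ p - \<sigma> \<nu>) * m \<in> L" "\<And>m. (W - \<sigma> \<omega>) * m \<in> L"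
    using generators_act_by_scalars[OF L] by blast
  have spow_inj: "s ^ n * m \<in> L \<Longrightarrow> m \<in> L" for n m
    by (induction n) (auto simp: mult.assoc dest: s_inj)
  have \<beta>: "\<beta> \<noteq> 0"
    using sc(1)[of 1] spow_inj[of p 1] L1 by (auto simp: \<sigma>'(1))
  define K where "K = {m. x * m \<in> L}"
  have K: "\<And>a b. a \<in> K \<Longrightarrow> b \<in> K \<Longrightarrow> a + b \<in> K" "0 \<in> K" "\<And>c m. m \<in> K \<Longrightarrow> \<sigma> c * m \<in> K"
    using L' by (auto simp: K_def distrib_left \<sigma>_commute)
  \<comment> \<open>Since \<open>x * x = 0\<close>, the kernel of \<open>x\<close> contains the
    class of 1 or else the nonzero class of \<open>x\<close>.\<close>
  obtain m0 where m0: "m0 \<in> K" "m0 \<notin> L"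
  proof (cases "x \<in> L")
    case True
    then show ?thesis using that[of 1] L1 by (simp add: K_def)
  next
    case False
    then show ?thesis using that[of x] xx L'(1) by (simp add: K_def)
  qed
  have Ks: "s * m \<in> K" if "m \<in> K" for m
  proof -
    have "x * (s * m) = s * (x * m)" by (simp add: xs flip: mult.assoc)
    then show ?thesis using that L'(3) by (simp add: K_def)
  qed
  have Kh: "h * m \<in> K" if "m \<in> K" for m
  proof -
    have "x * (h * m) = - (h * (x * m))" by (simp add: hx flip: mult.assoc)
    then show ?thesis using that L'(3,4) by (simp add: K_def)
  qed
  have KY: "Y * m \<in> K" if "m \<in> K" for m
  proof -
    have "x * Y = Y * x - s * x" by (simp add: Yx distrib_left xs)
    then have "x * (Y * m) = Y * (x * m) - s * (x * m)"
      by (simp add: left_diff_distrib flip: mult.assoc)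
    then show ?thesis using that L'(3,5) by (simp add: K_def)
  qed
  \<comment> \<open>In \<open>V\<close> one has \<open>g v_0 = - inverse \<alpha> v_1\<close> and
    \<open>v_1 = s v_0\<close>, hence \<open>t v_0 = - \<alpha> v_0\<close>; this is the origin of
    the parameter \<open>- \<alpha>'\<close> at the end. Anticommuting with \<open>y\<close>, the
    operator \<open>t\<close> commutes with \<open>Y\<close>, and so a common eigenvector can be
    sought.\<close>
  define t where "t = s * h"
  have ts: "t * s = s * t" by (simp add: t_def hs mult.assoc)
  have ty: "t * y = - (y * t)"
  proof -
    have "t * y = - (s * (y + x) * h)" by (simp only: t_def hy mult.assoc mult_minus_right)
    also have "\<dots> = - (y * t)" by (simp only: t_def ys[symmetric] mult.assoc)
    finally show ?thesis .
  qed
  have tY: "t * Y = Y * t"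
  proof -
    have "t * Y = (t * y) * y" by (simp add: Y_def mult.assoc)
    also have "\<dots> = - (y * (t * y))" by (simp add: ty mult.assoc)
    finally show ?thesis by (simp add: ty Y_def mult.assoc)
  qed
  have Kt: "t * m \<in> K" if "m \<in> K" for m using that by (simp add: t_def mult.assoc Ks Kh)
  \<comment> \<open>\<open>s\<close> and \<open>h\<close> commute, so this power is a product of
    central elements acting by known scalars.\<close>
  have "t ^ (2 * p) = s ^ p * s ^ p * W"
  proof -
    have "t ^ n = s ^ n * h ^ n" for n
    proof (induction n)
      case (Suc n)
      have "t ^ Suc n = s * (h * s ^ n) * h ^ n" by (simp only: power_Suc Suc.IH) (simp only: t_def mult.assoc)
      also have "h * s ^ n = s ^ n * h" by (rule power_commutes_if[OF hs[symmetric], symmetric])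
      finally show ?case by (simp add: mult.assoc)
    qed simp
    then have "t ^ (2 * p) = s ^ (2 * p) * h ^ (2 * p)" .
    also have "s ^ (2 * p) = s ^ p * s ^ p" by (simp add: mult_2 power_add)
    also have "h ^ (2 * p) = W" by (simp add: W_def power_mult power2_eq_square)
    finally show ?thesis .
  qed
  then have "(t ^ (2 * p) - \<sigma> (\<beta> * \<beta> * \<omega>)) * m0 \<in> L"
    using acts_by_scalar_mult[OF LI acts_by_scalar_mult[OF LI sc(1) sc(1)] sc(4)] by simp
  then obtain m1 \<alpha>' where m1: "m1 \<in> K" "m1 \<notin> L" "(t - \<sigma> \<alpha>') * m1 \<in> L"
    using eigenvector[OF LI, of K t m0 "2 * p"] K Kt m0 p by auto
  have \<alpha>': "\<alpha>' \<noteq> 0"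
  proof
    assume "\<alpha>' = 0"
    then have "s * (h * m1) \<in> L" using m1(3) by (simp add: \<sigma>'(1) t_def mult.assoc)
    then show False using m1(2) s_inj h_in_iff[OF LI] by blast
  qed
  define E where "E = {m \<in> K. (t - \<sigma> \<alpha>') * m \<in> L}"
  have E: "\<And>a b. a \<in> E \<Longrightarrow> b \<in> E \<Longrightarrow> a + b \<in> E" "0 \<in> E" "\<And>c m. m \<in> E \<Longrightarrow> \<sigma> c * m \<in> E"
    using K L' by (auto simp: E_def distrib_left \<sigma>_commute)
  have Es: "s * m \<in> E" if "m \<in> E" for m
  proof -
    have "t * (s * m) = s * (t * m)" by (simp add: ts flip: mult.assoc)
    then have "(t - \<sigma> \<alpha>') * (s * m) = s * ((t - \<sigma> \<alpha>') * m)"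
      by (simp add: left_diff_distrib right_diff_distrib \<sigma>_commute mult.assoc)
    then show ?thesis using that Ks L'(3) by (simp add: E_def)
  qed
  have EY: "Y * m \<in> E" if "m \<in> E" for m
  proof -
    have "t * (Y * m) = Y * (t * m)" by (simp add: tY flip: mult.assoc)
    then have "(t - \<sigma> \<alpha>') * (Y * m) = Y * ((t - \<sigma> \<alpha>') * m)"
      by (simp add: left_diff_distrib right_diff_distrib \<sigma>_commute mult.assoc)
    then show ?thesis using that KY L'(3) by (simp add: E_def)
  qed
  have Esn: "s ^ n * m \<in> E" if "m \<in> E" for n m
    by (induction n) (simp_all add: that Es mult.assoc)
  \<comment> \<open>Up to the scalar \<open>\<beta>\<close> by which \<open>s ^ p\<close> acts,
    \<open>r\<close> is \<open>s^{-2} Y\<close>. An eigenvalue \<open>c\<close> of \<open>r\<close>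
    therefore means \<open>Y w = \<gamma> s s w\<close> with
    \<open>\<gamma> = c / \<beta>\<close>.\<close>
  define r where "r = s ^ (p - 2) * Y"
  have "r ^ p = (s ^ p) ^ (p - 2) * Y ^ p"
    using jordan_plane_weyl_power[OF Ys of_nat_p p] by (simp add: r_def mult.commute flip: power_mult)
  moreover have "((s ^ p) ^ (p - 2) * Y ^ p - \<sigma> (\<beta> ^ (p - 2) * \<zeta>)) * m1 \<in> L"
    by (rule acts_by_scalar_mult[OF LI acts_by_scalar_power[OF LI sc(1)] sc(2)])
  ultimately have "(r ^ p - \<sigma> (\<beta> ^ (p - 2) * \<zeta>)) * m1 \<in> L" by simp
  then obtain w c where w: "w \<in> E" "w \<notin> L" "(r - \<sigma> c) * w \<in> L"
    using eigenvector[OF LI, of E r m1 p] E Esn EY m1 p by (auto simp: r_def mult.assoc E_def)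
  define \<gamma> where "\<gamma> = c / \<beta>"
  have Yw: "Y * w - \<sigma> \<gamma> * (s * (s * w)) \<in> L"
  proof -
    have "s ^ p = s * (s * s ^ (p - 2))"
      using p by (simp flip: power_Suc) (simp add: Suc_diff_Suc numeral_2_eq_2)
    then have ssr: "s * (s * (r * w)) = s ^ p * (Y * w)"
      by (simp add: r_def mult.assoc)
    have bc: "\<sigma> \<beta> * (\<sigma> \<gamma> * u) = \<sigma> c * u" for u
      using \<beta> by (simp add: \<gamma>_def flip: mult.assoc \<sigma>'(4))
    have "\<sigma> \<beta> * (Y * w - \<sigma> \<gamma> * (s * (s * w))) =
        s * (s * ((r - \<sigma> c) * w)) - (s ^ p - \<sigma> \<beta>) * (Y * w)"
      by (simp only: left_diff_distrib right_diff_distrib ssr bc \<sigma>_commute[of s]) simp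
    then have "\<sigma> \<beta> * (Y * w - \<sigma> \<gamma> * (s * (s * w))) \<in> L"
      using w sc(1) L'(3,5) by simp
    then show ?thesis using scalar_mult_iff[OF LI \<beta>] by simp
  qed
  \<comment> \<open>\<open>Y * s ^ 2 = s ^ 2 * (Y + 2 * s)\<close>, so the passage from
    \<open>w\<close> to \<open>v\<close> creates the summand \<open>2 v_1\<close> of
    \<open>y (y v_0) = 2 v_1 + \<gamma> v_2\<close>.\<close>
  define v where "v = s * (s * w)"
  have vE: "v \<in> E" and vL: "v \<notin> L" using w Es s_inj by (auto simp: v_def)
  have "Y * v - 2 * (s * v) - \<sigma> \<gamma> * (s * (s * v)) = s * (s * (Y * w - \<sigma> \<gamma> * (s * (s * w))))"
  proof -
    have "Y * s ^ 2 = s ^ 2 * Y + 2 * (s * s ^ 2)"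
      using jordan_plane_power(3)[OF Ys, of 2] by (simp add: distrib_left power2_eq_square mult_2 mult_2_right mult.assoc)
    then have "Y * v = s * (s * (Y * w)) + 2 * (s * v)"
      by (simp add: v_def power2_eq_square distrib_right flip: mult.assoc)
    then show ?thesis by (simp add: v_def right_diff_distrib \<sigma>_commute)
  qed
  then have Yv: "Y * v - 2 * (s * v) - \<sigma> \<gamma> * (s * (s * v)) \<in> L" using Yw L'(3) by simp
  have "g * (t * v) = s * v"
    using gh by (simp add: t_def gs mult.assoc flip: mult.assoc[of g])
  then have "g * ((t - \<sigma> \<alpha>') * v) = s * v - \<sigma> \<alpha>' * (g * v)"
    by (simp add: left_diff_distrib right_diff_distrib mult.assoc \<sigma>_commute)
  then have "s * v - \<sigma> \<alpha>' * (g * v) \<in> L" using vE L'(3) by (simp add: E_def) metis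
  then have "\<sigma> (- inverse \<alpha>') * (s * v - \<sigma> \<alpha>' * (g * v)) \<in> L" by (rule L'(3))
  also have "\<sigma> (- inverse \<alpha>') * (s * v - \<sigma> \<alpha>' * (g * v)) = g * v + \<sigma> (inverse (- \<alpha>')) * (s * v)"
    using \<alpha>' by (simp add: right_diff_distrib \<sigma>'(6) \<sigma>'(2) flip: mult.assoc \<sigma>'(4))
  finally have "V_vector (- \<alpha>') \<beta> \<gamma> L v"
    using vE Yv sc(1) by (auto simp: V_vector_def E_def K_def)
  moreover have "- \<alpha>' \<noteq> 0" using \<alpha>' by simp
  ultimately show ?thesis using \<beta> vL by blast
qed

theorem simple_classification:
  assumes L: "maximal_left_ideal L"
  shows "(\<exists>\<gamma> m. \<gamma> \<noteq> 0 \<and> m \<notin> L \<and> S_vector \<gamma> L m) \<or>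
    (\<exists>\<alpha> \<beta> m. \<alpha> \<noteq> 0 \<and> \<beta> \<noteq> 0 \<and> m \<notin> L \<and> T_vector \<alpha> \<beta> L m) \<or>
    (\<exists>\<alpha> \<beta> \<gamma> m. \<alpha> \<noteq> 0 \<and> \<beta> \<noteq> 0 \<and> m \<notin> L \<and> V_vector \<alpha> \<beta> \<gamma> L m)"
proof -
  have LI: "left_ideal L"
    and Lmax: "\<And>N. left_ideal N \<Longrightarrow> L \<subseteq> N \<Longrightarrow> N = L \<or> N = UNIV"
    using L by (auto simp: maximal_left_ideal_def)
  note L' = left_idealD[OF LI]
  define N where "N = {m. s * m \<in> L}"
  have "left_ideal N"
  proof (rule left_ideal_if_closed)
    fix a assume "a \<in> N"
    then have a: "s * a \<in> L" by (simp add: N_def)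
    have "s * (x * a) = x * (s * a)" by (simp add: xs flip: mult.assoc)
    then show "x * a \<in> N" using L'(3)[OF a] by (simp add: N_def)
    have "s * y = y * s - x * s" by (simp add: ys0)
    then have "s * (y * a) = y * (s * a) - x * (s * a)" by (simp add: left_diff_distrib flip: mult.assoc)
    then show "y * a \<in> N" using L'(3)[OF a] L'(5) by (simp add: N_def)
    have "s * (g * a) = g * (s * a)" by (simp add: gs flip: mult.assoc)
    then show "g * a \<in> N" using L'(3)[OF a] by (simp add: N_def)
    have "s * (h * a) = h * (s * a)" by (simp add: hs flip: mult.assoc)
    then show "h * a \<in> N" using L'(3)[OF a] by (simp add: N_def)
  qed (auto simp: N_def L' distrib_left \<sigma>_commute)
  moreover have "L \<subseteq> N" using L'(3) by (auto simp: N_def)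
  ultimately consider "N = UNIV" | "N = L" using Lmax by blast
  then show ?thesis
  proof cases
    case 1
    then have "s * m \<in> L" for m by (auto simp: N_def)
    then show ?thesis using simple_s_zero[OF L] by blast
  next
    case 2
    then have "m \<in> L" if "s * m \<in> L" for m using that by (auto simp: N_def)
    then show ?thesis using simple_s_injective[OF L] by blast
  qed
qed

end

section \<open>Modules given by a basis\<close>

lemma poly_mapping_add_induct:
  assumes "P 0" "\<And>k c. P (Poly_Mapping.single k c)" "\<And>a b. P a \<Longrightarrow> P b \<Longrightarrow> P (a + b)"
  shows "P (a :: 'i \<Rightarrow>\<^sub>0 'b::comm_monoid_add)"
proof (induction a rule: update_induct)
  case (update f k c)
  have "Poly_Mapping.update k c f = f + Poly_Mapping.single k c"
    using update(1) by (intro poly_mapping_eqI)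
      (auto simp: lookup_update lookup_add lookup_single in_keys_iff when_def)
  then show ?case using update assms by simp
qed (rule assms(1))

lemma lookup_scale [simp]: "Poly_Mapping.lookup (c *\<^sub>v u) i = c * Poly_Mapping.lookup u i"
  by (simp add: scale_def Poly_Mapping.map.rep_eq when_def)

lemma scale_simps [simp]:
  "c *\<^sub>v (u + v) = c *\<^sub>v u + c *\<^sub>v v" "(c + d) *\<^sub>v u = c *\<^sub>v u + d *\<^sub>v u"
  "c *\<^sub>v (d *\<^sub>v u) = (c * d) *\<^sub>v u" "1 *\<^sub>v u = u" "0 *\<^sub>v u = 0" "c *\<^sub>v 0 = 0"
  "c *\<^sub>v (- u) = - (c *\<^sub>v u)" "(- c) *\<^sub>v u = - (c *\<^sub>v u)"
  "c *\<^sub>v Poly_Mapping.single i d = Poly_Mapping.single i (c * d)"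
  by (auto intro!: poly_mapping_eqI simp: lookup_add lookup_single when_def algebra_simps)

lemma scale_sum: "c *\<^sub>v sum f A = (\<Sum>i\<in>A. c *\<^sub>v f i)"
  by (induction A rule: infinite_finite_induct) simp_all

definition lin :: "(('i, 'k::field) vec \<Rightarrow> ('j, 'k) vec) \<Rightarrow> bool" where
  "lin f \<longleftrightarrow> (\<forall>u v. f (u + v) = f u + f v) \<and> (\<forall>c u. f (c *\<^sub>v u) = c *\<^sub>v f u)"

lemma linD:
  assumes "lin f"
  shows "f (u + v) = f u + f v" "f (c *\<^sub>v u) = c *\<^sub>v f u" "f 0 = 0" "f (- u) = - f u"
    "f (u - v) = f u - f v"
proof -
  show A: "f (u + v) = f u + f v" "f (c *\<^sub>v u) = c *\<^sub>v f u" for u v c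
    using assms by (auto simp: lin_def)
  show "f 0 = 0" using A(2)[of 0 0] by simp
  show M: "f (- u) = - f u" for u using A(2)[of "- 1" u] by simp
  show "f (u - v) = f u - f v" using A(1)[of u "- v"] M by simp
qed

lemma lin_intros:
  "lin (\<lambda>u. 0)" "lin (\<lambda>u. u)" "lin f \<Longrightarrow> lin f' \<Longrightarrow> lin (\<lambda>u. f u + f' u)" "lin f \<Longrightarrow> lin (\<lambda>u. - f u)"
  by (auto simp: lin_def algebra_simps)

lemma linear_ext_superset:
  assumes "finite S" "Poly_Mapping.keys u \<subseteq> S"
  shows "linear_ext \<phi> u = (\<Sum>i\<in>S. Poly_Mapping.lookup u i *\<^sub>v \<phi> i)"
  unfolding linear_ext_def
  by (rule sum.mono_neutral_left) (use assms in \<open>auto simp: in_keys_iff\<close>)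

lemma lin_linear_ext: "lin (linear_ext \<phi>)"
  unfolding lin_def
proof (intro conjI allI)
  fix u v :: "('a, 'b) vec" and c :: 'b
  let ?S = "Poly_Mapping.keys u \<union> Poly_Mapping.keys v"
  have k: "Poly_Mapping.keys (u + v) \<subseteq> ?S" "Poly_Mapping.keys (c *\<^sub>v u) \<subseteq> ?S"
    using keys_add[of u v] by (auto simp: in_keys_iff)
  show "linear_ext \<phi> (u + v) = linear_ext \<phi> u + linear_ext \<phi> v"
    using k by (simp add: linear_ext_superset[of ?S] lookup_add sum.distrib)
  show "linear_ext \<phi> (c *\<^sub>v u) = c *\<^sub>v linear_ext \<phi> u"
    using k by (simp add: linear_ext_superset[of ?S] scale_sum)
qed

lemma lin_linear_ext_comp: "lin f \<Longrightarrow> lin (\<lambda>u. linear_ext \<phi> (f u))"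
  using lin_linear_ext[of \<phi>] by (auto simp: lin_def)

lemma linear_ext_single [simp]: "linear_ext \<phi> (Poly_Mapping.single i c) = c *\<^sub>v \<phi> i"
  by (simp add: linear_ext_def)

lemmas linear_ext_simps [simp] = linD[OF lin_linear_ext]

lemma span_on_closed:
  "0 \<in> span_on I" "u \<in> span_on I \<Longrightarrow> v \<in> span_on I \<Longrightarrow> u + v \<in> span_on I"
  "u \<in> span_on I \<Longrightarrow> c *\<^sub>v u \<in> span_on I" "u \<in> span_on I \<Longrightarrow> - u \<in> span_on I"
  "i \<in> I \<Longrightarrow> Poly_Mapping.single i c \<in> span_on I"
  using keys_add[of u v] by (auto simp: span_on_def in_keys_iff lookup_single when_def split: if_splits)

lemma span_on_sum: "(\<And>i. i \<in> A \<Longrightarrow> f i \<in> span_on I) \<Longrightarrow> sum f A \<in> span_on I"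
  by (induction A rule: infinite_finite_induct) (auto intro: span_on_closed)

lemma linear_ext_in_span:
  "(\<And>i. i \<in> I \<Longrightarrow> \<phi> i \<in> span_on J) \<Longrightarrow> u \<in> span_on I \<Longrightarrow> linear_ext \<phi> u \<in> span_on J"
  unfolding linear_ext_def by (intro span_on_sum span_on_closed) (auto simp: span_on_def)

lemma vec_expand: "u = (\<Sum>i\<in>Poly_Mapping.keys u. Poly_Mapping.lookup u i *\<^sub>v Poly_Mapping.single i 1)"
  by (rule poly_mapping_eqI) (auto simp: lookup_sum lookup_single when_def in_keys_iff)

lemma lin_sum: "lin f \<Longrightarrow> f (sum h A) = (\<Sum>i\<in>A. f (h i))"
  by (induction A rule: infinite_finite_induct) (simp_all add: linD)

lemma lin_eq_on_span:
  assumes "lin f" "lin f'" "\<And>i. i \<in> I \<Longrightarrow> f (Poly_Mapping.single i 1) = f' (Poly_Mapping.single i 1)"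
    and u: "u \<in> span_on I"
  shows "f u = f' u"
proof -
  have "i \<in> I" if "i \<in> Poly_Mapping.keys u" for i using u that by (auto simp: span_on_def)
  then show ?thesis
    by (subst (1 2) vec_expand[of u])
      (simp only: lin_sum[OF assms(1)] lin_sum[OF assms(2)] linD(2)[OF assms(1)] linD(2)[OF assms(2)] assms(3)
        cong: sum.cong)
qed

text \<open>The relations of the algebra, demanded on basis vectors only. \<open>\<theta>'\<close>
  describes the action of the inverse of \<open>g\<close>, which the definition of the module gives
  merely through \<open>inv_into\<close>.\<close>

locale basis_rep =
  fixes I :: "'i set" and \<xi> \<eta> \<theta> \<theta>' :: "'i \<Rightarrow> ('i, 'k::field) vec"
  assumes span: "i \<in> I \<Longrightarrow> \<xi> i \<in> span_on I" "i \<in> I \<Longrightarrow> \<eta> i \<in> span_on I" "i \<in> I \<Longrightarrow> \<theta> i \<in> span_on I"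
      "i \<in> I \<Longrightarrow> \<theta>' i \<in> span_on I"
    and inverse: "i \<in> I \<Longrightarrow> linear_ext \<theta> (\<theta>' i) = Poly_Mapping.single i 1"
      "i \<in> I \<Longrightarrow> linear_ext \<theta>' (\<theta> i) = Poly_Mapping.single i 1"
    and xx: "i \<in> I \<Longrightarrow> linear_ext \<xi> (\<xi> i) = 0"
    and ys: "i \<in> I \<Longrightarrow> linear_ext \<eta> (linear_ext \<xi> (\<eta> i) + linear_ext \<eta> (\<xi> i)) =
      linear_ext \<xi> (linear_ext \<eta> (\<eta> i)) + linear_ext \<eta> (linear_ext \<xi> (\<eta> i)) +
      linear_ext \<xi> (linear_ext \<xi> (\<eta> i) + linear_ext \<eta> (\<xi> i))"
    and gx: "i \<in> I \<Longrightarrow> linear_ext \<theta> (\<xi> i) = - linear_ext \<xi> (\<theta> i)"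
    and gy: "i \<in> I \<Longrightarrow> linear_ext \<theta> (\<eta> i) = - linear_ext \<eta> (\<theta> i) + linear_ext \<xi> (\<theta> i)"
begin

abbreviation "op_x \<equiv> linear_ext \<xi>"
abbreviation "op_y \<equiv> linear_ext \<eta>"
abbreviation "op_g \<equiv> linear_ext \<theta>"
abbreviation "op_h \<equiv> linear_ext \<theta>'"
abbreviation "op \<equiv> letter_act I \<xi> \<eta> \<theta>"
abbreviation "word_act ls \<equiv> foldr op ls"
abbreviation "alg_act \<equiv> free_act I \<xi> \<eta> \<theta>"

lemma ops_in_span: "u \<in> span_on I \<Longrightarrow> op_x u \<in> span_on I" "u \<in> span_on I \<Longrightarrow> op_y u \<in> span_on I"
  "u \<in> span_on I \<Longrightarrow> op_g u \<in> span_on I" "u \<in> span_on I \<Longrightarrow> op_h u \<in> span_on I"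
  by (rule linear_ext_in_span[OF span(1)] linear_ext_in_span[OF span(2)] linear_ext_in_span[OF span(3)]
    linear_ext_in_span[OF span(4)]; assumption)+

lemma op_relations:
  assumes "u \<in> span_on I"
  shows "op_g (op_h u) = u" "op_h (op_g u) = u" "op_x (op_x u) = 0"
    "op_y (op_x (op_y u) + op_y (op_x u)) = op_x (op_y (op_y u)) + op_y (op_x (op_y u)) +
      op_x (op_x (op_y u) + op_y (op_x u))"
    "op_g (op_x u) = - op_x (op_g u)" "op_g (op_y u) = - op_y (op_g u) + op_x (op_g u)"
proof -
  note lin = lin_intros lin_linear_ext_comp
  note e = lin_eq_on_span[OF _ _ _ assms]
  show "op_g (op_h u) = u"
    by (rule e[of "\<lambda>u. op_g (op_h u)" "\<lambda>u. u"]; (intro lin)?; simp add: inverse xx gx gy ys[simplified])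
  show "op_h (op_g u) = u"
    by (rule e[of "\<lambda>u. op_h (op_g u)" "\<lambda>u. u"]; (intro lin)?; simp add: inverse xx gx gy ys[simplified])
  show "op_x (op_x u) = 0"
    by (rule e[of "\<lambda>u. op_x (op_x u)" "\<lambda>u. 0"]; (intro lin)?; simp add: inverse xx gx gy ys[simplified])
  show "op_y (op_x (op_y u) + op_y (op_x u)) = op_x (op_y (op_y u)) + op_y (op_x (op_y u)) +
      op_x (op_x (op_y u) + op_y (op_x u))"
    by (rule e[of "\<lambda>u. op_y (op_x (op_y u) + op_y (op_x u))" "\<lambda>u. op_x (op_y (op_y u)) + op_y (op_x (op_y u)) +
      op_x (op_x (op_y u) + op_y (op_x u))"]; (intro lin)?; simp add: inverse xx gx gy ys[simplified])
  show "op_g (op_x u) = - op_x (op_g u)"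
    by (rule e[of "\<lambda>u. op_g (op_x u)" "\<lambda>u. - op_x (op_g u)"]; (intro lin)?; simp add: inverse xx gx gy ys[simplified])
  show "op_g (op_y u) = - op_y (op_g u) + op_x (op_g u)"
    by (rule e[of "\<lambda>u. op_g (op_y u)" "\<lambda>u. - op_y (op_g u) + op_x (op_g u)"]; (intro lin)?; simp add: inverse xx gx gy ys[simplified])
qed

text \<open>\<open>op_h\<close> is a two-sided inverse of \<open>op_g\<close> on the span and thus
  agrees there with the chosen inverse. Outside the span that choice is uncontrolled, which is why
  membership in \<open>span_on I\<close> accompanies the lemmas below.\<close>

lemma letter_ginv: "u \<in> span_on I \<Longrightarrow> op Letter_ginv u = op_h u"
proof -
  assume u: "u \<in> span_on I"
  have "inj_on op_g (span_on I)" by (rule inj_on_inverseI[of _ op_h]) (rule op_relations)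
  from inv_into_f_f[OF this ops_in_span(4)[OF u]] show ?thesis
    using op_relations(1)[OF u] by simp
qed

lemma letter_act_span: "u \<in> span_on I \<Longrightarrow> op l u \<in> span_on I"
  using letter_ginv ops_in_span by (cases l) auto

lemma letter_act_lin:
  "u \<in> span_on I \<Longrightarrow> v \<in> span_on I \<Longrightarrow>
    op l (u + v) = op l u + op l v"
  "u \<in> span_on I \<Longrightarrow> op l (c *\<^sub>v u) = c *\<^sub>v op l u"
  by (cases l; simp add: letter_ginv span_on_closed del: letter_act.simps(4))+

lemma word_act_span: "u \<in> span_on I \<Longrightarrow> word_act ls u \<in> span_on I"
  by (induction ls) (auto intro: letter_act_span)

lemma word_act_lin:
  "u \<in> span_on I \<Longrightarrow> v \<in> span_on I \<Longrightarrow> word_act ls (u + v) = word_act ls u + word_act ls v"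
  "u \<in> span_on I \<Longrightarrow> word_act ls (c *\<^sub>v u) = c *\<^sub>v word_act ls u"
  by (induction ls) (simp_all add: letter_act_lin word_act_span del: letter_act.simps)

lemma free_act_superset:
  assumes "finite S" "Poly_Mapping.keys a \<subseteq> S"
  shows "alg_act a u = (\<Sum>w\<in>S. Poly_Mapping.lookup a w *\<^sub>v word_act (letters w) u)"
  unfolding free_act_def
  by (rule sum.mono_neutral_left) (use assms in \<open>auto simp: in_keys_iff\<close>)

lemma free_act_add: "alg_act (a + b) u = alg_act a u + alg_act b u"
  using keys_add[of a b]
  by (simp add: free_act_superset[of "Poly_Mapping.keys a \<union> Poly_Mapping.keys b"] lookup_add sum.distrib)

lemma free_act_0 [simp]: "alg_act 0 u = 0"
  by (simp add: free_act_def)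

lemma free_act_single [simp]:
  "alg_act (Poly_Mapping.single w c) u = c *\<^sub>v word_act (letters w) u"
  by (simp add: free_act_def)

lemma free_act_span: "u \<in> span_on I \<Longrightarrow> alg_act a u \<in> span_on I"
  unfolding free_act_def by (intro span_on_sum span_on_closed word_act_span)

lemma free_act_lin:
  "u \<in> span_on I \<Longrightarrow> v \<in> span_on I \<Longrightarrow>
    alg_act a (u + v) = alg_act a u + alg_act a v"
  "u \<in> span_on I \<Longrightarrow> alg_act a (c *\<^sub>v u) = c *\<^sub>v alg_act a u"
  by (simp_all add: free_act_def word_act_lin sum.distrib scale_sum mult.commute)

lemma free_act_zero_vector [simp]: "alg_act a 0 = 0"
  using free_act_lin(2)[OF span_on_closed(1), of a 0] by simp

lemma free_act_mult:
  assumes u: "u \<in> span_on I"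
  shows "alg_act (a * b) u = alg_act a (alg_act b u)"
proof (induction a rule: poly_mapping_add_induct)
  case (2 w c)
  show ?case
  proof (induction b rule: poly_mapping_add_induct)
    case (2 w' c')
    show ?case using u
      by (simp add: mult_single plus_word_def word_act_lin(2)[OF word_act_span])
  next
    case (3 a b)
    then show ?case using u
      by (simp only: distrib_left free_act_add free_act_lin(1)[OF free_act_span free_act_span])
  qed (use word_act_lin(2)[OF span_on_closed(1), of _ 0] in simp)
qed (simp_all add: free_act_add distrib_right)

lemma free_act_1: "alg_act 1 u = u"
  using free_act_single[of 0 1 u] unfolding single_one by (simp add: zero_word_def)

lemma free_act_minus:
  "alg_act (- a) u = - alg_act a u"
  "alg_act (a - b) u = alg_act a u - alg_act b u"
proof -
  show M: "alg_act (- a) u = - alg_act a u" for a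
    using free_act_add[of a "- a" u] by (simp add: eq_neg_iff_add_eq_0 add.commute)
  show "alg_act (a - b) u = alg_act a u - alg_act b u"
    using free_act_add[of a "- b" u] M by simp
qed

lemma free_act_letters:
  "alg_act fx u = op_x u" "alg_act fy u = op_y u" "alg_act fg u = op_g u"
  "u \<in> span_on I \<Longrightarrow> alg_act fginv u = op_h u" "alg_act (fscalar c) u = c *\<^sub>v u"
  using letter_ginv by (simp_all add: zero_word_def del: letter_act.simps(4))

lemma free_act_relations:
  assumes u: "u \<in> span_on I" and "r \<in> relations"
  shows "alg_act r u = 0"
proof -
  note simps = fs_def free_act_minus free_act_add free_act_mult[OF u] free_act_mult free_act_letters
    free_act_1 ops_in_span u op_relations span_on_closed
  have "op_g (op_x (op_h u)) = - op_x u" "op_g (op_y (op_h u)) = - op_y u + op_x u"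
    using op_relations(5,6)[OF ops_in_span(4)[OF u]] op_relations(1)[OF u] by simp_all
  then show ?thesis
    using assms(2) op_relations[OF u] unfolding relations_def by (auto simp: simps simp del: free_act_single)
qed

end

section \<open>The algebra as a type\<close>

lemma ring_of_type [simp]:
  "carrier ring_of_type_algebra = UNIV" "a \<otimes>\<^bsub>ring_of_type_algebra\<^esub> b = a * b" "a \<oplus>\<^bsub>ring_of_type_algebra\<^esub> b = a + b"
  "\<one>\<^bsub>ring_of_type_algebra\<^esub> = 1" "\<zero>\<^bsub>ring_of_type_algebra\<^esub> = 0"
  by (simp_all add: ring_of_type_algebra_def)

lemma ring_ring_of_type: "Ring.ring (ring_of_type_algebra :: 'a::ring_1 ring)"
proof -
  have "\<exists>y. x + y = 0" for x :: 'a using add.right_inverse by blast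
  then show ?thesis
    unfolding ring_of_type_algebra_def using add.right_inverse
    by unfold_locales (auto simp: algebra_simps Units_def)
qed

lemma ideal_relation_ideal: "ideal relation_ideal (ring_of_type_algebra :: 'k::field free_alg ring)"
  unfolding relation_ideal_def by (rule ring.genideal_ideal[OF ring_ring_of_type]) simp

lemma ring_alg_A: "Ring.ring (alg_A :: 'k::field free_alg set ring)"
  unfolding alg_A_def by (rule ideal.quotient_is_ring[OF ideal_relation_ideal])

lemma carrier_alg_A: "carrier alg_A = range to_A"
  unfolding alg_A_def to_A_def FactRing_def by (auto simp: A_RCOSETS_defs a_r_coset_def)

lemma to_A_hom:
  "to_A (a + b) = to_A a \<oplus>\<^bsub>alg_A\<^esub> to_A b" "to_A (a * b) = to_A a \<otimes>\<^bsub>alg_A\<^esub> to_A b" "to_A 1 = \<one>\<^bsub>alg_A\<^esub>"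
  using ring_hom_add[OF ideal.rcos_ring_hom[OF ideal_relation_ideal], of a b]
    ring_hom_mult[OF ideal.rcos_ring_hom[OF ideal_relation_ideal], of a b]
    ring_hom_one[OF ideal.rcos_ring_hom[OF ideal_relation_ideal]]
  by (simp_all add: to_A_def alg_A_def)

lemma to_A_set: "to_A a = {i + a | i. i \<in> relation_ideal}"
  by (auto simp: to_A_def a_r_coset_def' )

lemma to_A_eq_iff: "to_A a = \<zero>\<^bsub>alg_A\<^esub> \<longleftrightarrow> a \<in> relation_ideal"
proof -
  interpret ideal relation_ideal "ring_of_type_algebra :: 'a free_alg ring" by (rule ideal_relation_ideal)
  have "\<zero>\<^bsub>alg_A\<^esub> = (relation_ideal :: 'a free_alg set)" by (simp add: alg_A_def FactRing_def)
  then show ?thesis unfolding to_A_def using a_rcos_const[of a] a_rcos_self[of a] by auto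
qed

context basis_rep
begin

abbreviation "M \<equiv> basis_module I \<xi> \<eta> \<theta>"

text \<open>The elements annihilating every vector of the span, and not just one vector, form a
  two-sided ideal; it contains the relations.\<close>

lemma free_act_relation_ideal:
  assumes "a \<in> relation_ideal" "u \<in> span_on I"
  shows "alg_act a u = 0"
proof -
  let ?K = "{a. \<forall>u\<in>span_on I. alg_act a u = 0}"
  interpret R: Ring.ring "ring_of_type_algebra :: 'k free_alg ring" by (rule ring_ring_of_type)
  have inv: "a_inv ring_of_type_algebra a = - a" for a :: "'k free_alg"
    by (rule R.minus_equality) simp_all
  have "ideal ?K ring_of_type_algebra"
  proof (rule idealI[OF ring_ring_of_type])
    show "subgroup ?K (add_monoid ring_of_type_algebra)"
    proof (rule subgroup.intro)
      show "inv\<^bsub>add_monoid ring_of_type_algebra\<^esub> a \<in> ?K" if "a \<in> ?K" for a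
        using that by (simp only: a_inv_def[symmetric] inv) (simp add: free_act_minus)
    qed (auto simp: free_act_add)
  qed (auto simp: free_act_mult free_act_span)
  moreover have "relations \<subseteq> ?K" using free_act_relations by blast
  ultimately have "relation_ideal \<subseteq> ?K" unfolding relation_ideal_def by (rule R.genideal_minimal)
  then show ?thesis using assms by blast
qed

lemma smult_to_A:
  assumes "u \<in> span_on I"
  shows "to_A a \<odot>\<^bsub>M\<^esub> u = alg_act a u"
proof -
  have "0 \<in> (relation_ideal :: 'k free_alg set)"
    using to_A_eq_iff[of "0::'k free_alg"] ideal_relation_ideal
      additive_subgroup.zero_closed[OF ideal.axioms(1)[OF ideal_relation_ideal]] by simp
  \<comment> \<open>All representatives of the coset act alike on \<open>u\<close>, so
    \<open>the_elem\<close> is applied to a singleton.\<close>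
  then have "(\<lambda>a. alg_act a u) ` to_A a = {alg_act a u}"
    using assms by (auto simp: to_A_set free_act_add free_act_relation_ideal image_iff)
  then show ?thesis by (simp add: basis_module_def)
qed

lemma module_simps [simp]: "carrier M = span_on I" "\<zero>\<^bsub>M\<^esub> = 0" "u \<oplus>\<^bsub>M\<^esub> v = u + v"
  by (simp_all add: basis_module_def)

lemma left_module: "left_module alg_A M"
proof -
  have "abelian_group M"
  proof (rule abelian_groupI)
    show "\<exists>y\<in>carrier M. y \<oplus>\<^bsub>M\<^esub> x = \<zero>\<^bsub>M\<^esub>" if "x \<in> carrier M" for x
      using that by (intro bexI[of _ "- x"]) (auto intro: span_on_closed)
  qed (auto intro: span_on_closed simp: add_ac)
  then show ?thesis
    unfolding left_module_def left_module_axioms_def using ring_alg_A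
    by (auto simp: carrier_alg_A smult_to_A free_act_span free_act_add free_act_lin free_act_mult free_act_1
        span_on_closed simp flip: to_A_hom)
qed

end

text \<open>The one-dimensional representation with \<open>x\<close> and \<open>y\<close> zero and
  \<open>g\<close> the identity shows that the relations do not collapse the algebra; this supplies
  \<open>0 \<noteq> 1\<close> for the type class.\<close>

interpretation unit_rep: basis_rep "UNIV :: unit set" "\<lambda>i. 0" "\<lambda>i. 0"
  "\<lambda>i. Poly_Mapping.single i (1::'k::field)" "\<lambda>i. Poly_Mapping.single i 1"
  by unfold_locales (auto intro: span_on_closed)

lemma one_not_in_relation_ideal: "1 \<notin> (relation_ideal :: 'k::field free_alg set)"
proof
  assume "1 \<in> (relation_ideal :: 'k free_alg set)"
  from unit_rep.free_act_relation_ideal[OF this, of "Poly_Mapping.single () 1"]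
  have "Poly_Mapping.single () (1 :: 'k) = 0"
    unfolding unit_rep.free_act_1 by (simp add: span_on_closed)
  then show False by (metis lookup_single_eq lookup_zero one_neq_zero)
qed

text \<open>As a type of class \<open>ring_1\<close>, the algebra becomes accessible to the
  arguments about maximal left ideals, which are carried out in an arbitrary such ring.\<close>

typedef (overloaded) 'k bos = "carrier (alg_A :: 'k::field free_alg set ring)" morphisms coset Abs_bos
  using carrier_alg_A by blast

instantiation bos :: (field) ring_1
begin

definition zero_bos :: "'a bos" where "0 = Abs_bos \<zero>\<^bsub>alg_A\<^esub>"
definition one_bos :: "'a bos" where "1 = Abs_bos \<one>\<^bsub>alg_A\<^esub>"
definition plus_bos :: "'a bos \<Rightarrow> 'a bos \<Rightarrow> 'a bos" where "a + b = Abs_bos (coset a \<oplus>\<^bsub>alg_A\<^esub> coset b)"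
definition times_bos :: "'a bos \<Rightarrow> 'a bos \<Rightarrow> 'a bos" where "a * b = Abs_bos (coset a \<otimes>\<^bsub>alg_A\<^esub> coset b)"
definition uminus_bos :: "'a bos \<Rightarrow> 'a bos" where "- a = Abs_bos (\<ominus>\<^bsub>alg_A\<^esub> coset a)"
definition minus_bos :: "'a bos \<Rightarrow> 'a bos \<Rightarrow> 'a bos" where "a - b = a + - (b :: 'a bos)"

instance
proof -
  interpret A: Ring.ring "alg_A :: 'a free_alg set ring" by (rule ring_alg_A)
  have c: "coset 0 = \<zero>\<^bsub>alg_A\<^esub>" "coset 1 = \<one>\<^bsub>alg_A\<^esub>" "coset (a + b) = coset a \<oplus>\<^bsub>alg_A\<^esub> coset b"
    "coset (a * b) = coset a \<otimes>\<^bsub>alg_A\<^esub> coset b" "coset (- a) = \<ominus>\<^bsub>alg_A\<^esub> coset a" for a b :: "'a bos"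
    using coset[of a] coset[of b]
    by (simp_all add: zero_bos_def one_bos_def plus_bos_def times_bos_def uminus_bos_def Abs_bos_inverse)
  have "(\<one>\<^bsub>alg_A\<^esub> :: 'a free_alg set) \<noteq> \<zero>\<^bsub>alg_A\<^esub>"
    using to_A_eq_iff[of "1 :: 'a free_alg"] one_not_in_relation_ideal by (auto simp: to_A_hom(3))
  then show "OFCLASS('a bos, ring_1_class)"
    by intro_classes
      (simp_all add: minus_bos_def coset_inject[symmetric] c coset A.a_assoc A.a_comm A.a_lcomm A.r_neg A.m_assoc
        A.l_distr A.r_distr)
qed

end

lemma coset_simps:
  fixes a b :: "'k::field bos"
  shows "coset (0 :: 'k bos) = \<zero>\<^bsub>alg_A\<^esub>" "coset (1 :: 'k bos) = \<one>\<^bsub>alg_A\<^esub>"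
    "coset (a + b) = coset a \<oplus>\<^bsub>alg_A\<^esub> coset b" "coset (a * b) = coset a \<otimes>\<^bsub>alg_A\<^esub> coset b"
proof -
  interpret A: Ring.ring "alg_A :: 'k free_alg set ring" by (rule ring_alg_A)
  show "coset (0 :: 'k bos) = \<zero>\<^bsub>alg_A\<^esub>" "coset (1 :: 'k bos) = \<one>\<^bsub>alg_A\<^esub>" "coset (a + b) = coset a \<oplus>\<^bsub>alg_A\<^esub> coset b"
    "coset (a * b) = coset a \<otimes>\<^bsub>alg_A\<^esub> coset b"
    using coset[of a] coset[of b]
    by (simp_all add: zero_bos_def one_bos_def plus_bos_def times_bos_def Abs_bos_inverse)
qed

definition bos_of :: "'k::field free_alg \<Rightarrow> 'k bos" where "bos_of a = Abs_bos (to_A a)"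

lemma coset_bos_of [simp]: "coset (bos_of a) = to_A a"
  by (simp add: bos_of_def Abs_bos_inverse carrier_alg_A)

lemma bos_of_hom: "bos_of (a + b) = bos_of a + bos_of b" "bos_of (a * b) = bos_of a * bos_of b" "bos_of 1 = 1"
  by (simp_all add: coset_simps to_A_hom flip: coset_inject)

lemma bos_of_eq_0_iff: "bos_of a = 0 \<longleftrightarrow> a \<in> relation_ideal"
  by (simp add: coset_simps to_A_eq_iff flip: coset_inject)

lemma bos_of_minus:
  fixes a b :: "'k::field free_alg"
  shows "bos_of (0 :: 'k free_alg) = 0" "bos_of (- a) = - bos_of a" "bos_of (a - b) = bos_of a - bos_of b"
proof -
  show Z: "bos_of (0 :: 'k free_alg) = 0" using bos_of_hom(1)[of "0 :: 'k free_alg" 0] by simp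
  show M: "bos_of (- a) = - bos_of a" for a :: "'k free_alg"
    using bos_of_hom(1)[of "- a" a] Z by (simp add: eq_neg_iff_add_eq_0)
  show "bos_of (a - b) = bos_of a - bos_of b" using bos_of_hom(1)[of a "- b"] M by simp
qed

lemma bos_of_surj: "\<exists>b. a = bos_of b"
  using coset[of a] by (auto simp: carrier_alg_A simp flip: coset_inject)

definition bos_scalar :: "'k::field \<Rightarrow> 'k bos" where "bos_scalar c = bos_of (fscalar c)"

lemma bos_generated:
  fixes N :: "'k::field bos set"
  assumes N: "1 \<in> N" "\<And>a b. a \<in> N \<Longrightarrow> b \<in> N \<Longrightarrow> a + b \<in> N" "\<And>c a. a \<in> N \<Longrightarrow> bos_scalar c * a \<in> N"
    "\<And>a. a \<in> N \<Longrightarrow> bos_of fx * a \<in> N" "\<And>a. a \<in> N \<Longrightarrow> bos_of fy * a \<in> N"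
    "\<And>a. a \<in> N \<Longrightarrow> bos_of fg * a \<in> N" "\<And>a. a \<in> N \<Longrightarrow> bos_of fginv * a \<in> N"
  shows "N = UNIV"
proof -
  have L: "bos_of (fletter l) * a \<in> N" if "a \<in> N" for l a
    using N(4-7) that by (cases l) auto
  have W: "bos_of (Poly_Mapping.single (Word ls) 1) \<in> N" for ls
  proof (induction ls)
    case Nil
    have "Poly_Mapping.single (Word []) (1::'k) = 1" by (metis single_one zero_word_def)
    then show ?case using N(1) by (simp add: bos_of_hom)
  next
    case (Cons l ls)
    have "Poly_Mapping.single (Word (l # ls)) (1::'k) = fletter l * Poly_Mapping.single (Word ls) 1"
      by (simp add: mult_single plus_word_def)
    then show ?case using L[OF Cons.IH] by (simp add: bos_of_hom)
  qed
  have S: "bos_of (Poly_Mapping.single w c) \<in> N" for w c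
  proof -
    have "Poly_Mapping.single w c = fscalar c * Poly_Mapping.single w 1"
      by (simp add: mult_single)
    then show ?thesis using N(3)[OF W, of c "letters w"] by (simp add: bos_of_hom bos_scalar_def)
  qed
  have "bos_of a \<in> N" for a
    by (induction a rule: poly_mapping_add_induct)
      (use S[of 0 0] in \<open>simp_all add: S N(2) bos_of_hom bos_of_minus\<close>)
  then show ?thesis using bos_of_surj by (metis UNIV_eq_I)
qed

lemma super_jordan_bos:
  assumes "CHAR('k::alg_closed_field) = p" "p > 2"
  shows "super_jordan_bosonization bos_scalar (bos_of fx :: 'k bos) (bos_of fy) (bos_of fg) (bos_of fginv) (bos_of fs) p"
proof
  have com: "fscalar c * a = a * fscalar c" for c :: 'k and a
    by (induction a rule: poly_mapping_add_induct)
      (simp_all add: mult_single distrib_left distrib_right mult.commute)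
  show "central_hom (bos_scalar :: 'k \<Rightarrow> 'k bos)"
    unfolding central_hom_def
  proof (intro conjI allI)
    fix c and m :: "'k bos"
    obtain b where "m = bos_of b" using bos_of_surj by blast
    then show "bos_scalar c * m = m * bos_scalar c"
      by (simp add: bos_scalar_def com flip: bos_of_hom)
  qed (simp_all add: bos_scalar_def bos_of_minus single_add bos_of_hom mult_single flip: bos_of_hom(2))
  have rel: "bos_of r = 0" if "r \<in> relations" for r :: "'k free_alg"
    using that ring.genideal_self[OF ring_ring_of_type, of relations]
    by (auto simp: bos_of_eq_0_iff relation_ideal_def)
  have r: "bos_of (fx * fx) = (0 :: 'k bos)" "bos_of (fy * fs - fs * fy - fx * fs) = (0 :: 'k bos)"
    "bos_of (fg * fginv - 1) = (0 :: 'k bos)" "bos_of (fginv * fg - 1) = (0 :: 'k bos)"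
    "bos_of (fg * fx * fginv - (- fx)) = (0 :: 'k bos)" "bos_of (fg * fy * fginv - (- fy + fx)) = (0 :: 'k bos)"
    by (rule rel; simp add: relations_def)+
  show "bos_of fs = bos_of fx * bos_of fy + bos_of fy * (bos_of fx :: 'k bos)"
    by (simp add: fs_def bos_of_hom)
  show "bos_of fx * bos_of fx = (0 :: 'k bos)" using r(1) by (simp add: bos_of_hom)
  show "bos_of fy * bos_of fs = bos_of fs * bos_of fy + bos_of fx * (bos_of fs :: 'k bos)"
    using r(2) by (simp add: bos_of_hom bos_of_minus algebra_simps)
  show gh: "bos_of fg * bos_of fginv = (1 :: 'k bos)" using r(3) by (simp add: bos_of_hom bos_of_minus)
  show hg: "bos_of fginv * bos_of fg = (1 :: 'k bos)" using r(4) by (simp add: bos_of_hom bos_of_minus)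
  have "bos_of fg * bos_of fx * bos_of fginv = - (bos_of fx :: 'k bos)"
    using r(5) by (simp add: bos_of_hom bos_of_minus eq_neg_iff_add_eq_0)
  then have "bos_of fg * bos_of fx * (bos_of fginv * bos_of fg) = - (bos_of fx :: 'k bos) * bos_of fg"
    by (simp only: mult.assoc[symmetric])
  then show "bos_of fg * bos_of fx = - (bos_of fx * (bos_of fg :: 'k bos))" by (simp add: hg)
  have "bos_of fg * bos_of fy * bos_of fginv = bos_of fx - (bos_of fy :: 'k bos)"
    using r(6) by (simp add: bos_of_hom bos_of_minus)
  then have "bos_of fg * bos_of fy * (bos_of fginv * bos_of fg) = (bos_of fx - bos_of fy :: 'k bos) * bos_of fg"
    by (simp only: mult.assoc[symmetric])
  then show "bos_of fg * bos_of fy = (bos_of fx - bos_of fy) * (bos_of fg :: 'k bos)" by (simp add: hg)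
  show "of_nat p = (0 :: 'k)" using assms(1) by auto
  show "p > 2" by fact
qed (rule bos_generated)

section \<open>Modules over the algebra\<close>

definition act :: "('k::field free_alg set, 'm) module \<Rightarrow> 'k bos \<Rightarrow> 'm \<Rightarrow> 'm" where
  "act M a u = coset a \<odot>\<^bsub>M\<^esub> u"

definition ann :: "('k::field free_alg set, 'm) module \<Rightarrow> 'm \<Rightarrow> 'k bos set" where
  "ann M u = {a. act M a u = \<zero>\<^bsub>M\<^esub>}"

lemma coset_surj: "a \<in> carrier alg_A \<Longrightarrow> \<exists>b. a = coset b"
  by (rule exI[of _ "Abs_bos a"]) (simp add: Abs_bos_inverse)

lemma act_simps:
  assumes M: "left_module alg_A M" and u: "u \<in> carrier M"
  shows "act M a u \<in> carrier M" "act M (a + b) u = act M a u \<oplus>\<^bsub>M\<^esub> act M b u"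
    "act M (a * b) u = act M a (act M b u)" "act M 1 u = u" "act M 0 u = \<zero>\<^bsub>M\<^esub>" "act M a \<zero>\<^bsub>M\<^esub> = \<zero>\<^bsub>M\<^esub>"
    "v \<in> carrier M \<Longrightarrow> act M a (u \<oplus>\<^bsub>M\<^esub> v) = act M a u \<oplus>\<^bsub>M\<^esub> act M a v"
    "act M a u = act M b u \<longleftrightarrow> a - b \<in> ann M u"
proof -
  interpret MM: abelian_group M using M by (simp add: left_module_def)
  note ax = left_module.smult_closed[OF M] left_module.smult_l_distr[OF M] left_module.smult_r_distr[OF M]
    left_module.smult_assoc[OF M] left_module.smult_one[OF M]
  have cl: "act M a u \<in> carrier M" if "u \<in> carrier M" for a u by (simp add: act_def ax coset that)
  show "act M a u \<in> carrier M" by (rule cl[OF u])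
  show add: "act M (a + b) u = act M a u \<oplus>\<^bsub>M\<^esub> act M b u" for a b
    by (simp add: act_def coset_simps ax coset u)
  show "act M (a * b) u = act M a (act M b u)" "act M 1 u = u"
    by (simp_all add: act_def coset_simps ax coset u)
  show z: "act M 0 u = \<zero>\<^bsub>M\<^esub>"
    using add[of 0 0] cl[OF u, of 0] by (simp add: MM.add.r_cancel_one')
  have r: "act M a (u \<oplus>\<^bsub>M\<^esub> v) = act M a u \<oplus>\<^bsub>M\<^esub> act M a v" if "u \<in> carrier M" "v \<in> carrier M" for u v
    using that by (simp add: act_def ax coset)
  then show "v \<in> carrier M \<Longrightarrow> act M a (u \<oplus>\<^bsub>M\<^esub> v) = act M a u \<oplus>\<^bsub>M\<^esub> act M a v" using u by blast
  show "act M a \<zero>\<^bsub>M\<^esub> = \<zero>\<^bsub>M\<^esub>"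
    using r[of "\<zero>\<^bsub>M\<^esub>" "\<zero>\<^bsub>M\<^esub>"] cl[of "\<zero>\<^bsub>M\<^esub>" a] by (simp add: MM.add.r_cancel_one')
  show "act M a u = act M b u \<longleftrightarrow> a - b \<in> ann M u"
  proof -
    have "act M a u = act M (a - b) u \<oplus>\<^bsub>M\<^esub> act M b u" using add[of "a - b" b] by simp
    then show ?thesis
      unfolding ann_def mem_Collect_eq
      by (metis MM.add.right_cancel MM.l_zero MM.zero_closed cl[OF u])
  qed
qed

lemma left_module_zero: "left_module alg_A M \<Longrightarrow> \<zero>\<^bsub>M\<^esub> \<in> carrier M"
  by (simp add: left_module_def abelian_group.axioms abelian_monoid.zero_closed)

lemma left_module_add:
  "left_module alg_A M \<Longrightarrow> u \<in> carrier M \<Longrightarrow> v \<in> carrier M \<Longrightarrow> u \<oplus>\<^bsub>M\<^esub> v \<in> carrier M"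
  by (simp add: left_module_def abelian_group.axioms abelian_monoid.a_closed)

lemma submodule_iff:
  assumes M: "left_module alg_A M"
  shows "submodule H alg_A M \<longleftrightarrow> H \<subseteq> carrier M \<and> \<zero>\<^bsub>M\<^esub> \<in> H \<and> (\<forall>u\<in>H. \<forall>v\<in>H. u \<oplus>\<^bsub>M\<^esub> v \<in> H) \<and>
    (\<forall>a. \<forall>u\<in>H. act M a u \<in> H)"
proof -
  interpret MM: abelian_group M using M by (simp add: left_module_def)
  have inv: "inv\<^bsub>add_monoid M\<^esub> u = act M (- 1) u" if u: "u \<in> carrier M" for u
  proof -
    have "act M (- 1) u \<oplus>\<^bsub>M\<^esub> u = act M (- 1 + 1) u"
      by (simp only: act_simps[OF M u])
    then have "act M (- 1) u \<oplus>\<^bsub>M\<^esub> u = \<zero>\<^bsub>M\<^esub>" using act_simps(5)[OF M u] by simp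
    then show ?thesis using MM.minus_equality[of "act M (- 1) u" u] u act_simps(1)[OF M u] by (simp add: a_inv_def)
  qed
  show ?thesis
  proof (intro iffI conjI ballI allI)
    assume H: "submodule H alg_A M"
    then interpret H: subgroup H "add_monoid M" by (simp add: submodule_def)
    show "H \<subseteq> carrier M" "\<zero>\<^bsub>M\<^esub> \<in> H" using H.subset H.one_closed by auto
    show "u \<oplus>\<^bsub>M\<^esub> v \<in> H" if "u \<in> H" "v \<in> H" for u v using H.m_closed that by simp
    show "act M a u \<in> H" if "u \<in> H" for a u
      using submodule.smult_closed[OF H coset that] by (simp add: act_def)
  next
    assume *: "H \<subseteq> carrier M \<and> \<zero>\<^bsub>M\<^esub> \<in> H \<and> (\<forall>u\<in>H. \<forall>v\<in>H. u \<oplus>\<^bsub>M\<^esub> v \<in> H) \<and> (\<forall>a. \<forall>u\<in>H. act M a u \<in> H)"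
    have "subgroup H (add_monoid M)"
      by (rule subgroup.intro) (use * inv in auto)
    moreover have "a \<odot>\<^bsub>M\<^esub> u \<in> H" if "a \<in> carrier alg_A" "u \<in> H" for a u
      using coset_surj[OF that(1)] * that(2) by (auto simp: act_def)
    ultimately show "submodule H alg_A M"
      by (simp add: submodule_def submodule_axioms_def)
  qed
qed

lemma ann_left_ideal:
  assumes M: "left_module alg_A M" and u: "u \<in> carrier M"
  shows "left_ideal (ann M u)"
proof -
  have z: "\<zero>\<^bsub>M\<^esub> \<oplus>\<^bsub>M\<^esub> \<zero>\<^bsub>M\<^esub> = \<zero>\<^bsub>M\<^esub>"
    using act_simps(2)[OF M u, of 0 0] act_simps(5)[OF M u] by simp
  show ?thesis
    unfolding left_ideal_def ann_def by (simp add: act_simps[OF M u] z)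
qed

text \<open>A left ideal \<open>N\<close> yields the submodule \<open>N u\<close>, which is zero or
  all of \<open>M\<close>. If \<open>N\<close> lies above the annihilator, the first case gives
  \<open>N = ann M u\<close> and the second puts 1 into \<open>N\<close>.\<close>

lemma ann_maximal:
  assumes S: "simple_module alg_A M" and u: "u \<in> carrier M" "u \<noteq> \<zero>\<^bsub>M\<^esub>"
  shows "maximal_left_ideal (ann M u)" "w \<in> carrier M \<Longrightarrow> \<exists>a. w = act M a u"
proof -
  have M: "left_module alg_A M" using S by (simp add: simple_module_def)
  note a = act_simps[OF M]
  have orbit: "submodule ((\<lambda>a. act M a u) ` N) alg_A M" if N: "left_ideal N" for N
    unfolding submodule_iff[OF M]
  proof (intro conjI ballI allI)
    note N' = left_idealD[OF N]
    show "(\<lambda>a. act M a u) ` N \<subseteq> carrier M" using a(1)[OF u(1)] by blast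
    show "\<zero>\<^bsub>M\<^esub> \<in> (\<lambda>a. act M a u) ` N"
      by (rule image_eqI[of _ _ 0]) (simp_all add: a(5)[OF u(1)] N')
    fix w assume "w \<in> (\<lambda>a. act M a u) ` N"
    then obtain b where b: "w = act M b u" "b \<in> N" by blast
    show "act M c w \<in> (\<lambda>a. act M a u) ` N" for c
      by (rule image_eqI[of _ _ "c * b"]) (simp_all add: a(3)[OF u(1)] b N')
    fix w' assume "w' \<in> (\<lambda>a. act M a u) ` N"
    then obtain b' where b': "w' = act M b' u" "b' \<in> N" by blast
    show "w \<oplus>\<^bsub>M\<^esub> w' \<in> (\<lambda>a. act M a u) ` N"
      by (rule image_eqI[of _ _ "b + b'"]) (simp_all add: a(2)[OF u(1)] b b' N')
  qed
  have cases: "(\<lambda>a. act M a u) ` N = {\<zero>\<^bsub>M\<^esub>} \<or> (\<lambda>a. act M a u) ` N = carrier M" if "left_ideal N" for N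
    using S orbit[OF that] by (simp add: simple_module_def)
  show "maximal_left_ideal (ann M u)"
    unfolding maximal_left_ideal_def
  proof (intro conjI allI impI)
    show "left_ideal (ann M u)" by (rule ann_left_ideal[OF M u(1)])
    show "1 \<notin> ann M u" using a(4)[OF u(1)] u(2) by (simp add: ann_def)
    fix N assume N: "left_ideal N" "ann M u \<subseteq> N"
    note N' = left_idealD[OF N(1)]
    from cases[OF N(1)] show "N = ann M u \<or> N = UNIV"
    proof
      assume "(\<lambda>a. act M a u) ` N = {\<zero>\<^bsub>M\<^esub>}"
      then have "N \<subseteq> ann M u" by (auto simp: ann_def)
      then show ?thesis using N(2) by blast
    next
      assume "(\<lambda>a. act M a u) ` N = carrier M"
      then obtain b where b: "b \<in> N" "act M b u = u" using u(1) by (metis imageE)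
      then have "1 - b \<in> ann M u" using a(8)[OF u(1), of 1 b] a(4)[OF u(1)] by simp
      then have "(1 - b) + b \<in> N" using N(2) b(1) N'(2) by blast
      then have "c \<in> N" for c using N'(3)[of 1 c] by simp
      then show ?thesis by blast
    qed
  qed
  have "left_ideal UNIV" by (simp add: left_ideal_def)
  moreover have "range (\<lambda>a. act M a u) \<noteq> {\<zero>\<^bsub>M\<^esub>}" using a(4)[OF u(1)] u(2) by (metis rangeI singletonD)
  ultimately show "w \<in> carrier M \<Longrightarrow> \<exists>a. w = act M a u" using cases by (metis imageE)
qed

text \<open>Both annihilators are maximal left ideals, so one inclusion forces equality, and
  \<open>a u \<mapsto> a v\<close> is a well-defined bijection. The two carriers may have different
  types.\<close>

lemma module_iso_if_ann_subset:
  assumes M: "simple_module alg_A M" "u \<in> carrier M" "u \<noteq> \<zero>\<^bsub>M\<^esub>"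
    and N: "simple_module alg_A N" "v \<in> carrier N" "v \<noteq> \<zero>\<^bsub>N\<^esub>"
    and sub: "ann M u \<subseteq> ann N v"
  shows "module_iso alg_A M N"
proof -
  have lM: "left_module alg_A M" and lN: "left_module alg_A N" using M N by (simp_all add: simple_module_def)
  note aM = act_simps[OF lM M(2)] and aN = act_simps[OF lN N(2)]
  have eq: "ann M u = ann N v"
    using ann_maximal(1)[OF M] ann_maximal(1)[OF N] sub unfolding maximal_left_ideal_def by blast
  define h where "h w = act N (SOME a. w = act M a u) v" for w
  have h: "h (act M a u) = act N a v" for a
  proof -
    have "act M a u = act M (SOME b. act M a u = act M b u) u" by (rule someI) simp
    then have "a - (SOME b. act M a u = act M b u) \<in> ann N v" using aM(8) eq by blast
    then show ?thesis unfolding h_def using aN(8) by metis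
  qed
  have rep: "\<exists>a. w = act M a u" if "w \<in> carrier M" for w using ann_maximal(2)[OF M] that by blast
  have "bij_betw h (carrier M) (carrier N)"
  proof (rule bij_betwI')
    show "h w = h w' \<longleftrightarrow> w = w'" if "w \<in> carrier M" "w' \<in> carrier M" for w w'
      using rep[OF that(1)] rep[OF that(2)] aM(8) aN(8) eq by (auto simp: h)
    show "h w \<in> carrier N" if "w \<in> carrier M" for w using rep[OF that] aN(1) by (auto simp: h)
    show "\<exists>w\<in>carrier M. w' = h w" if "w' \<in> carrier N" for w'
    proof -
      from ann_maximal(2)[OF N that] obtain a where "w' = act N a v" by blast
      then show ?thesis using aM(1)[of a] h[of a] by (intro bexI[of _ "act M a u"]) simp_all
    qed
  qed
  moreover have "h (w \<oplus>\<^bsub>M\<^esub> w') = h w \<oplus>\<^bsub>N\<^esub> h w'" if "w \<in> carrier M" "w' \<in> carrier M" for w w'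
    using rep[OF that(1)] rep[OF that(2)] by (auto simp: h aN(2) simp flip: aM(2))
  moreover have "h (c \<odot>\<^bsub>M\<^esub> w) = c \<odot>\<^bsub>N\<^esub> h w" if "c \<in> carrier alg_A" "w \<in> carrier M" for c w
  proof -
    from coset_surj[OF that(1)] obtain b where b: "c = coset b" by blast
    from rep[OF that(2)] obtain a where a: "w = act M a u" by blast
    have "h (act M b (act M a u)) = act N b (act N a v)" by (simp add: h flip: aM(3) aN(3))
    then show ?thesis by (simp add: a b h) (simp add: act_def)
  qed
  ultimately show ?thesis unfolding module_iso_def by blast
qed

lemma module_iso_act:
  assumes "left_module alg_A M" "left_module alg_A N" "module_iso alg_A M N"
  obtains h where "bij_betw h (carrier M) (carrier N)"
    "\<And>u v. u \<in> carrier M \<Longrightarrow> v \<in> carrier M \<Longrightarrow> h (u \<oplus>\<^bsub>M\<^esub> v) = h u \<oplus>\<^bsub>N\<^esub> h v"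
    "\<And>a u. u \<in> carrier M \<Longrightarrow> h (act M a u) = act N a (h u)" "h \<zero>\<^bsub>M\<^esub> = \<zero>\<^bsub>N\<^esub>"
proof -
  obtain h where h: "bij_betw h (carrier M) (carrier N)"
    "\<And>u v. u \<in> carrier M \<Longrightarrow> v \<in> carrier M \<Longrightarrow> h (u \<oplus>\<^bsub>M\<^esub> v) = h u \<oplus>\<^bsub>N\<^esub> h v"
    "\<And>a u. a \<in> carrier alg_A \<Longrightarrow> u \<in> carrier M \<Longrightarrow> h (a \<odot>\<^bsub>M\<^esub> u) = a \<odot>\<^bsub>N\<^esub> h u"
    using assms(3) unfolding module_iso_def by blast
  have a: "h (act M a u) = act N a (h u)" if "u \<in> carrier M" for a u
    using h(3)[OF coset that] by (simp add: act_def)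
  have z: "\<zero>\<^bsub>M\<^esub> \<in> carrier M" by (rule left_module_zero[OF assms(1)])
  then have "h \<zero>\<^bsub>M\<^esub> \<in> carrier N" using h(1) by (auto simp: bij_betw_def)
  then have "h \<zero>\<^bsub>M\<^esub> = \<zero>\<^bsub>N\<^esub>"
    using a[OF z, of 0] act_simps(5)[OF assms(1) z] act_simps(5)[OF assms(2)] by simp
  then show thesis using that h(1,2) a by blast
qed

lemma module_iso_sym:
  assumes "left_module R M" "module_iso R M N"
  shows "module_iso R N M"
proof -
  obtain h where h: "bij_betw h (carrier M) (carrier N)"
    "\<And>u v. u \<in> carrier M \<Longrightarrow> v \<in> carrier M \<Longrightarrow> h (u \<oplus>\<^bsub>M\<^esub> v) = h u \<oplus>\<^bsub>N\<^esub> h v"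
    "\<And>a u. a \<in> carrier R \<Longrightarrow> u \<in> carrier M \<Longrightarrow> h (a \<odot>\<^bsub>M\<^esub> u) = a \<odot>\<^bsub>N\<^esub> h u"
    using assms(2) unfolding module_iso_def by blast
  interpret MM: abelian_group M using assms(1) by (simp add: left_module_def)
  let ?k = "inv_into (carrier M) h"
  have k: "bij_betw ?k (carrier N) (carrier M)" by (rule bij_betw_inv_into[OF h(1)])
  have kc: "?k u \<in> carrier M" if "u \<in> carrier N" for u using k that by (auto simp: bij_betw_def)
  have hk: "h (?k u) = u" if "u \<in> carrier N" for u using bij_betw_inv_into_right[OF h(1) that] .
  have kh: "?k (h u) = u" if "u \<in> carrier M" for u using bij_betw_inv_into_left[OF h(1) that] .
  have "?k (u \<oplus>\<^bsub>N\<^esub> v) = ?k u \<oplus>\<^bsub>M\<^esub> ?k v" if "u \<in> carrier N" "v \<in> carrier N" for u v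
    using kh[of "?k u \<oplus>\<^bsub>M\<^esub> ?k v"] h(2)[OF kc kc] hk kc that by simp
  moreover have "?k (a \<odot>\<^bsub>N\<^esub> u) = a \<odot>\<^bsub>M\<^esub> ?k u" if "a \<in> carrier R" "u \<in> carrier N" for a u
    using kh[of "a \<odot>\<^bsub>M\<^esub> ?k u"] h(3)[OF that(1) kc] hk kc that left_module.smult_closed[OF assms(1)] by simp
  ultimately show ?thesis using k unfolding module_iso_def by blast
qed

lemma module_iso_trans:
  assumes "module_iso R M N" "module_iso R N K"
  shows "module_iso R M K"
proof -
  obtain h where h: "bij_betw h (carrier M) (carrier N)"
    "\<And>u v. u \<in> carrier M \<Longrightarrow> v \<in> carrier M \<Longrightarrow> h (u \<oplus>\<^bsub>M\<^esub> v) = h u \<oplus>\<^bsub>N\<^esub> h v"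
    "\<And>a u. a \<in> carrier R \<Longrightarrow> u \<in> carrier M \<Longrightarrow> h (a \<odot>\<^bsub>M\<^esub> u) = a \<odot>\<^bsub>N\<^esub> h u"
    using assms(1) unfolding module_iso_def by blast
  obtain k where k: "bij_betw k (carrier N) (carrier K)"
    "\<And>u v. u \<in> carrier N \<Longrightarrow> v \<in> carrier N \<Longrightarrow> k (u \<oplus>\<^bsub>N\<^esub> v) = k u \<oplus>\<^bsub>K\<^esub> k v"
    "\<And>a u. a \<in> carrier R \<Longrightarrow> u \<in> carrier N \<Longrightarrow> k (a \<odot>\<^bsub>N\<^esub> u) = a \<odot>\<^bsub>K\<^esub> k u"
    using assms(2) unfolding module_iso_def by blast
  have c: "h u \<in> carrier N" if "u \<in> carrier M" for u using h(1) that by (auto simp: bij_betw_def)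
  show ?thesis
    unfolding module_iso_def
    by (rule exI[of _ "k \<circ> h"]) (auto intro: bij_betw_trans[OF h(1) k(1)] simp: h(2,3) k(2,3) c)
qed

lemma iso_class_eq:
  assumes "left_module R M" "module_iso R M N"
  shows "iso_class R M = iso_class R N"
  using module_iso_trans[OF assms(2)] module_iso_trans[OF module_iso_sym[OF assms]]
  unfolding iso_class_def by blast

lemma simple_module_iso:
  assumes S: "simple_module alg_A M" and N: "left_module alg_A N" and iso: "module_iso alg_A M N"
  shows "simple_module alg_A N"
proof -
  have M: "left_module alg_A M" using S by (simp add: simple_module_def)
  obtain h where h: "bij_betw h (carrier M) (carrier N)"
    "\<And>u v. u \<in> carrier M \<Longrightarrow> v \<in> carrier M \<Longrightarrow> h (u \<oplus>\<^bsub>M\<^esub> v) = h u \<oplus>\<^bsub>N\<^esub> h v"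
    "\<And>a u. u \<in> carrier M \<Longrightarrow> h (act M a u) = act N a (h u)" "h \<zero>\<^bsub>M\<^esub> = \<zero>\<^bsub>N\<^esub>"
    using module_iso_act[OF M N iso] by blast
  have surj: "\<exists>u\<in>carrier M. w = h u" if "w \<in> carrier N" for w
    using h(1) that by (auto simp: bij_betw_def)
  have z: "\<zero>\<^bsub>M\<^esub> \<in> carrier M" by (rule left_module_zero[OF M])
  show ?thesis
    unfolding simple_module_def
  proof (intro conjI allI impI)
    show "carrier N \<noteq> {\<zero>\<^bsub>N\<^esub>}"
    proof
      assume N0: "carrier N = {\<zero>\<^bsub>N\<^esub>}"
      have "u = \<zero>\<^bsub>M\<^esub>" if "u \<in> carrier M" for u
      proof -
        have "h w \<in> carrier N" if "w \<in> carrier M" for w using h(1) that by (auto simp: bij_betw_def)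
        then have "h u = h \<zero>\<^bsub>M\<^esub>" using N0 that z by (metis singletonD)
        then show ?thesis using h(1) that z by (auto simp: bij_betw_def dest: inj_onD)
      qed
      then have "carrier M = {\<zero>\<^bsub>M\<^esub>}" using z by blast
      then show False using S unfolding simple_module_def by blast
    qed
    fix H assume H: "submodule H alg_A N"
    note H' = H[unfolded submodule_iff[OF N]]
    define H0 where "H0 = {u \<in> carrier M. h u \<in> H}"
    have "submodule H0 alg_A M"
      unfolding submodule_iff[OF M] H0_def using H' z h
      by (auto simp: act_simps[OF M] left_module_add[OF M])
    then consider "H0 = {\<zero>\<^bsub>M\<^esub>}" | "H0 = carrier M" using S unfolding simple_module_def by blast
    then show "H = {\<zero>\<^bsub>N\<^esub>} \<or> H = carrier N"
    proof cases
      case 1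
      have "w = \<zero>\<^bsub>N\<^esub>" if w: "w \<in> H" for w
      proof -
        obtain u where u: "u \<in> carrier M" "w = h u" using surj H' w by blast
        then have "u \<in> H0" using w by (simp add: H0_def)
        then show ?thesis using 1 u h(4) by simp
      qed
      then show ?thesis using H' by blast
    next
      case 2
      then have "carrier N \<subseteq> H" using surj by (force simp: H0_def)
      then show ?thesis using H' by blast
    qed
  qed (rule N)
qed

text \<open>Transport of structure along \<open>j\<close>. It provides an isomorphic module inside
  the universe, so that the isomorphism class there is inhabited.\<close>

lemma module_copy:
  fixes N :: "('k::field free_alg set, 'n) module" and j :: "'n \<Rightarrow> 'u"
  assumes N: "left_module alg_A N" and j: "inj_on j (carrier N)"
  obtains M :: "('k free_alg set, 'u) module" where "left_module alg_A M" "module_iso alg_A N M"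
proof -
  interpret NN: abelian_group N using N by (simp add: left_module_def)
  define i where "i = inv_into (carrier N) j"
  have ij: "i (j u) = u" if "u \<in> carrier N" for u using j that by (simp add: i_def)
  define M :: "('k free_alg set, 'u) module" where "M = \<lparr>carrier = j ` carrier N, monoid.mult = undefined,
    one = undefined, ring.zero = j \<zero>\<^bsub>N\<^esub>, ring.add = (\<lambda>a b. j (i a \<oplus>\<^bsub>N\<^esub> i b)),
    module.smult = (\<lambda>a u. j (a \<odot>\<^bsub>N\<^esub> i u))\<rparr>"
  have M: "carrier M = j ` carrier N" "\<zero>\<^bsub>M\<^esub> = j \<zero>\<^bsub>N\<^esub>" "a \<oplus>\<^bsub>M\<^esub> b = j (i a \<oplus>\<^bsub>N\<^esub> i b)"
    "c \<odot>\<^bsub>M\<^esub> a = j (c \<odot>\<^bsub>N\<^esub> i a)" for a b c by (simp_all add: M_def)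
  note ax = left_module.smult_closed[OF N] left_module.smult_l_distr[OF N] left_module.smult_r_distr[OF N]
    left_module.smult_assoc[OF N] left_module.smult_one[OF N]
  have "abelian_group M"
  proof (rule abelian_groupI)
    show "\<exists>y\<in>carrier M. y \<oplus>\<^bsub>M\<^esub> x = \<zero>\<^bsub>M\<^esub>" if "x \<in> carrier M" for x
    proof -
      from that obtain u where u: "u \<in> carrier N" "x = j u" by (auto simp: M)
      then show ?thesis by (intro bexI[of _ "j (\<ominus>\<^bsub>N\<^esub> u)"]) (simp_all add: M ij NN.l_neg)
    qed
  qed (auto simp: M ij NN.a_assoc NN.a_comm NN.a_lcomm)
  then have "left_module alg_A M"
    unfolding left_module_def left_module_axioms_def using ring_alg_A
    by (auto simp: M ij ax ring.ring_simprules)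
  moreover have "module_iso alg_A N M"
    unfolding module_iso_def using j by (intro exI[of _ j]) (auto simp: bij_betw_def M ij)
  ultimately show thesis by (rule that)
qed

section \<open>Annihilators of basis vectors\<close>

text \<open>The linear map from vectors to the algebra with prescribed values on the basis;
  \<open>\<phi> i\<close> serves as a lift of the basis vector \<open>i\<close> modulo a left
  ideal.\<close>

definition bos_comb :: "('i \<Rightarrow> 'k bos) \<Rightarrow> ('i, 'k::field) vec \<Rightarrow> 'k bos" where
  "bos_comb \<phi> u = (\<Sum>i\<in>Poly_Mapping.keys u. bos_scalar (Poly_Mapping.lookup u i) * \<phi> i)"

lemma bos_scalar_simps:
  fixes c d :: "'k::field"
  shows "bos_scalar (0 :: 'k) = 0" "bos_scalar (1 :: 'k) = 1" "bos_scalar (c + d) = bos_scalar c + bos_scalar d"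
    "bos_scalar (c * d) = bos_scalar c * bos_scalar d" "bos_scalar (- c) = - bos_scalar c"
    "bos_scalar (of_nat n :: 'k) = of_nat n"
proof -
  show *: "bos_scalar (0 :: 'k) = 0" "bos_scalar (1 :: 'k) = 1" "bos_scalar (c + d) = bos_scalar c + bos_scalar d"
    "bos_scalar (c * d) = bos_scalar c * bos_scalar d" "bos_scalar (- c) = - bos_scalar c" for c d :: 'k
    by (simp_all add: bos_scalar_def bos_of_minus single_add single_uminus bos_of_hom mult_single flip: bos_of_hom(2))
  show "bos_scalar (of_nat n :: 'k) = of_nat n" by (induction n) (simp_all add: *)
qed

lemma bos_comb_superset:
  assumes "finite S" "Poly_Mapping.keys u \<subseteq> S"
  shows "bos_comb \<phi> u = (\<Sum>i\<in>S. bos_scalar (Poly_Mapping.lookup u i) * \<phi> i)"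
  unfolding bos_comb_def
  by (rule sum.mono_neutral_left) (use assms in \<open>auto simp: in_keys_iff bos_scalar_simps\<close>)

lemma bos_comb_simps:
  "bos_comb \<phi> 0 = 0" "bos_comb \<phi> (u + v) = bos_comb \<phi> u + bos_comb \<phi> v"
  "bos_comb \<phi> (c *\<^sub>v u) = bos_scalar c * bos_comb \<phi> u"
  "bos_comb \<phi> (Poly_Mapping.single i c) = bos_scalar c * \<phi> i"
proof -
  let ?S = "Poly_Mapping.keys u \<union> Poly_Mapping.keys v"
  have k: "Poly_Mapping.keys (u + v) \<subseteq> ?S" "Poly_Mapping.keys (c *\<^sub>v u) \<subseteq> ?S"
    using keys_add[of u v] by (auto simp: in_keys_iff)
  show "bos_comb \<phi> (u + v) = bos_comb \<phi> u + bos_comb \<phi> v"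
    using k by (simp add: bos_comb_superset[of ?S] lookup_add sum.distrib bos_scalar_simps distrib_right)
  show "bos_comb \<phi> (c *\<^sub>v u) = bos_scalar c * bos_comb \<phi> u"
    using k by (simp add: bos_comb_superset[of ?S] sum_distrib_left bos_scalar_simps mult.assoc)
qed (simp_all add: bos_comb_def bos_scalar_simps)

lemma span_on_induct [consumes 1, case_names zero add scale base]:
  fixes P :: "('i, 'k::field) vec \<Rightarrow> bool"
  assumes u: "u \<in> span_on I" and "P 0" "\<And>u v. P u \<Longrightarrow> P v \<Longrightarrow> P (u + v)" "\<And>c u. P u \<Longrightarrow> P (c *\<^sub>v u)"
    "\<And>i. i \<in> I \<Longrightarrow> P (Poly_Mapping.single i 1)"
  shows "P u"
proof -
  have sum: "P (sum f A)" if "\<And>i. i \<in> A \<Longrightarrow> P (f i)" for f :: "'i \<Rightarrow> ('i, 'k) vec" and A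
    using that by (induction A rule: infinite_finite_induct) (auto intro: assms)
  have "P (\<Sum>i\<in>Poly_Mapping.keys u. Poly_Mapping.lookup u i *\<^sub>v Poly_Mapping.single i 1)"
  proof (rule sum)
    fix i assume "i \<in> Poly_Mapping.keys u"
    then have "i \<in> I" using u by (auto simp: span_on_def)
    then show "P (Poly_Mapping.lookup u i *\<^sub>v Poly_Mapping.single i 1)" by (intro assms(4,5))
  qed
  then show ?thesis by (simp only: vec_expand[of u, symmetric])
qed

context basis_rep
begin

lemma act_letters:
  assumes "u \<in> span_on I"
  shows "act M (bos_of fx) u = op_x u" "act M (bos_of fy) u = op_y u" "act M (bos_of fg) u = op_g u"
    "act M (bos_of fginv) u = op_h u" "act M (bos_scalar c) u = c *\<^sub>v u"
    "act M (bos_of fs) u = op_x (op_y u) + op_y (op_x u)"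
  using assms
  by (simp_all add: act_def smult_to_A free_act_letters bos_scalar_def fs_def free_act_add free_act_mult
    ops_in_span del: free_act_single)

text \<open>\<open>bos_comb \<phi>\<close> induces a map from the module to the quotient by
  \<open>J\<close>. It respects \<open>x\<close>, \<open>y\<close> and \<open>g\<close>, hence the
  whole algebra, and sends the basis vector \<open>i0\<close> to the class of 1; whatever kills
  \<open>i0\<close> therefore kills that class. The annihilator itself is never computed.\<close>

lemma ann_basis_subset:
  assumes J: "left_ideal J" and i0: "i0 \<in> I" and \<phi>0: "\<phi> i0 - 1 \<in> J"
    and com: "\<And>c a. a * bos_scalar c = bos_scalar c * (a :: 'k bos)"
    and x: "\<And>i. i \<in> I \<Longrightarrow> bos_of fx * \<phi> i - bos_comb \<phi> (\<xi> i) \<in> J"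
    and y: "\<And>i. i \<in> I \<Longrightarrow> bos_of fy * \<phi> i - bos_comb \<phi> (\<eta> i) \<in> J"
    and g: "\<And>i. i \<in> I \<Longrightarrow> bos_of fg * \<phi> i - bos_comb \<phi> (\<theta> i) \<in> J"
    and hg: "bos_of fginv * bos_of fg = (1 :: 'k bos)"
  shows "ann M (Poly_Mapping.single i0 1) \<subseteq> J"
proof
  note J' = left_idealD[OF J]
  let ?\<Phi> = "bos_comb \<phi>"
  have ext: "l * ?\<Phi> u - ?\<Phi> (linear_ext \<psi> u) \<in> J"
    if "\<And>i. i \<in> I \<Longrightarrow> l * \<phi> i - ?\<Phi> (\<psi> i) \<in> J" and "u \<in> span_on I" for l \<psi> u
    using that(2)
  proof (induction u rule: span_on_induct)
    case (add u v)
    have "l * ?\<Phi> (u + v) - ?\<Phi> (linear_ext \<psi> (u + v)) =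
        (l * ?\<Phi> u - ?\<Phi> (linear_ext \<psi> u)) + (l * ?\<Phi> v - ?\<Phi> (linear_ext \<psi> v))"
      by (simp add: bos_comb_simps distrib_left)
    then show ?case using J'(2) add by simp
  next
    case (scale c u)
    have "l * ?\<Phi> (c *\<^sub>v u) - ?\<Phi> (linear_ext \<psi> (c *\<^sub>v u)) = bos_scalar c * (l * ?\<Phi> u - ?\<Phi> (linear_ext \<psi> u))"
      using com[of l c] by (simp add: bos_comb_simps right_diff_distrib flip: mult.assoc)
    then show ?case using J'(3) scale by simp
  qed (use that in \<open>simp_all add: bos_comb_simps bos_scalar_simps J'\<close>)
  define N where "N = {a. \<forall>u\<in>span_on I. a * ?\<Phi> u - ?\<Phi> (act M a u) \<in> J}"
  note a = act_simps[OF left_module, simplified]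
  have step: "l * b \<in> N" if b: "b \<in> N" and l: "\<And>w. w \<in> span_on I \<Longrightarrow> l * ?\<Phi> w - ?\<Phi> (act M l w) \<in> J" for l b
    unfolding N_def
  proof (intro CollectI ballI)
    fix u :: "('i, 'k) vec" assume u: "u \<in> span_on I"
    have "l * b * ?\<Phi> u - ?\<Phi> (act M (l * b) u) =
        l * (b * ?\<Phi> u - ?\<Phi> (act M b u)) + (l * ?\<Phi> (act M b u) - ?\<Phi> (act M l (act M b u)))"
      using a(3)[OF u] by (simp add: right_diff_distrib mult.assoc)
    then show "l * b * ?\<Phi> u - ?\<Phi> (act M (l * b) u) \<in> J"
      using J'(2,3) b u l[OF a(1)[OF u]] by (simp add: N_def)
  qed
  have "N = UNIV"
  proof (rule bos_generated)
    show "1 \<in> N" by (simp add: N_def a J')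
    show "b + c \<in> N" if "b \<in> N" "c \<in> N" for b c
      unfolding N_def
    proof (intro CollectI ballI)
      fix u :: "('i, 'k) vec" assume u: "u \<in> span_on I"
      have "(b + c) * ?\<Phi> u - ?\<Phi> (act M (b + c) u) = (b * ?\<Phi> u - ?\<Phi> (act M b u)) + (c * ?\<Phi> u - ?\<Phi> (act M c u))"
        using a(2)[OF u] by (simp add: distrib_right bos_comb_simps)
      then show "(b + c) * ?\<Phi> u - ?\<Phi> (act M (b + c) u) \<in> J" using J'(2) that u by (simp add: N_def)
    qed
    fix b assume b: "b \<in> N"
    show "bos_scalar c * b \<in> N" for c
      by (rule step[OF b]) (simp add: act_letters bos_comb_simps J')
    show "bos_of fx * b \<in> N" by (rule step[OF b]) (simp add: act_letters ext x)
    show "bos_of fy * b \<in> N" by (rule step[OF b]) (simp add: act_letters ext y)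
    show "bos_of fg * b \<in> N" by (rule step[OF b]) (simp add: act_letters ext g)
    \<comment> \<open>Compatibility with the inverse follows from that with \<open>g\<close> at the
      vector \<open>op_h w\<close>, multiplied by \<open>fginv\<close> on the left.\<close>
    show "bos_of fginv * b \<in> N"
    proof (rule step[OF b])
      fix w :: "('i, 'k) vec" assume w: "w \<in> span_on I"
      have "bos_of fg * ?\<Phi> (op_h w) - ?\<Phi> w \<in> J"
        using ext[OF g ops_in_span(4)[OF w]] op_relations(1)[OF w] by simp
      then have "- (bos_of fginv * (bos_of fg * ?\<Phi> (op_h w) - ?\<Phi> w)) \<in> J" using J'(3,4) by blast
      also have "bos_of fginv * (bos_of fg * ?\<Phi> (op_h w) - ?\<Phi> w) = ?\<Phi> (op_h w) - bos_of fginv * ?\<Phi> w"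
        by (simp add: right_diff_distrib hg flip: mult.assoc)
      finally show "bos_of fginv * ?\<Phi> w - ?\<Phi> (act M (bos_of fginv) w) \<in> J" using w by (simp add: act_letters)
    qed
  qed
  fix b assume "b \<in> ann M (Poly_Mapping.single i0 1)"
  moreover have "b * ?\<Phi> (Poly_Mapping.single i0 1) - ?\<Phi> (act M b (Poly_Mapping.single i0 1)) \<in> J"
  proof -
    have "b \<in> N" using \<open>N = UNIV\<close> by simp
    then show ?thesis using span_on_closed(5)[OF i0] unfolding N_def by blast
  qed
  ultimately have "b * \<phi> i0 \<in> J" by (simp add: ann_def bos_comb_simps bos_scalar_simps)
  then have "b * \<phi> i0 - b * (\<phi> i0 - 1) \<in> J" using J'(3,5) \<phi>0 by blast
  then show "b \<in> J" by (simp add: right_diff_distrib)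
qed

end

context basis_rep
begin

lemma submodule_closed:
  assumes "submodule H alg_A M"
  shows "H \<subseteq> span_on I" "0 \<in> H" "u \<in> H \<Longrightarrow> v \<in> H \<Longrightarrow> u + v \<in> H" "u \<in> H \<Longrightarrow> op_x u \<in> H" "u \<in> H \<Longrightarrow> op_y u \<in> H"
    "u \<in> H \<Longrightarrow> op_g u \<in> H" "u \<in> H \<Longrightarrow> c *\<^sub>v u \<in> H"
proof -
  have H: "H \<subseteq> span_on I \<and> 0 \<in> H \<and> (\<forall>u\<in>H. \<forall>v\<in>H. u + v \<in> H) \<and> (\<forall>a. \<forall>u\<in>H. act M a u \<in> H)"
    using assms unfolding submodule_iff[OF left_module] module_simps .
  then show "H \<subseteq> span_on I" "0 \<in> H" "u \<in> H \<Longrightarrow> v \<in> H \<Longrightarrow> u + v \<in> H" by blast+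
  have a: "u \<in> H \<Longrightarrow> act M a u \<in> H" "u \<in> H \<Longrightarrow> u \<in> span_on I" for a u using H by blast+
  show "u \<in> H \<Longrightarrow> op_x u \<in> H" "u \<in> H \<Longrightarrow> op_y u \<in> H" "u \<in> H \<Longrightarrow> op_g u \<in> H" "u \<in> H \<Longrightarrow> c *\<^sub>v u \<in> H"
    using a act_letters by metis+
qed

lemma simpleI:
  assumes "i0 \<in> I"
    and "\<And>H u i. submodule H alg_A M \<Longrightarrow> u \<in> H \<Longrightarrow> u \<noteq> 0 \<Longrightarrow> i \<in> I \<Longrightarrow> Poly_Mapping.single i 1 \<in> H"
  shows "simple_module alg_A M"
  unfolding simple_module_def module_simps
proof (intro conjI allI impI left_module)
  have "Poly_Mapping.single i0 (1::'k) \<noteq> 0" by (metis lookup_single_eq lookup_zero one_neq_zero)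
  then show "span_on I \<noteq> {0 :: ('i, 'k) vec}" using span_on_closed(5)[OF assms(1)] by blast
  fix H assume H: "submodule H alg_A M"
  note H' = submodule_closed[OF H]
  show "H = {0} \<or> H = span_on I"
  proof (rule disjCI)
    assume "H \<noteq> span_on I"
    have "u = 0" if u: "u \<in> H" for u
    proof (rule ccontr)
      assume "u \<noteq> 0"
      have "v \<in> H" if "v \<in> span_on I" for v
        using that by (induction v rule: span_on_induct) (auto intro: H' assms(2)[OF H u \<open>u \<noteq> 0\<close>])
      then show False using H'(1) \<open>H \<noteq> span_on I\<close> by blast
    qed
    then show "H = {0}" using H'(2) by blast
  qed
qed

end

section \<open>The modules \<open>T\<close>\<close>

lemma linear_ext_zero_fun [simp]: "linear_ext (\<lambda>i. 0) u = 0"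
  by (simp add: linear_ext_def)

lemma T_rep:
  assumes "\<beta> \<noteq> (0 :: 'k::field)"
  shows "basis_rep UNIV (\<lambda>i. 0) (T_y \<alpha>) (T_g \<beta>)
    (\<lambda>i. case i of E0 \<Rightarrow> inverse \<beta> *\<^sub>v basis_e E1 | E1 \<Rightarrow> basis_e E0)"
proof unfold_locales
  fix i :: e_index
  show "linear_ext (T_g \<beta>) (case i of E0 \<Rightarrow> inverse \<beta> *\<^sub>v basis_e E1 | E1 \<Rightarrow> basis_e E0) = Poly_Mapping.single i 1"
    "linear_ext (\<lambda>i. case i of E0 \<Rightarrow> inverse \<beta> *\<^sub>v basis_e E1 | E1 \<Rightarrow> basis_e E0) (T_g \<beta> i) = Poly_Mapping.single i 1"
    "linear_ext (T_g \<beta>) (T_y \<alpha> i) = - linear_ext (T_y \<alpha>) (T_g \<beta> i) + linear_ext (\<lambda>i. 0) (T_g \<beta> i)"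
    "linear_ext (T_y \<alpha>) (linear_ext (\<lambda>i. 0) (T_y \<alpha> i) + linear_ext (T_y \<alpha>) 0) =
      linear_ext (\<lambda>i. 0) (linear_ext (T_y \<alpha>) (T_y \<alpha> i)) + linear_ext (T_y \<alpha>) (linear_ext (\<lambda>i. 0) (T_y \<alpha> i)) +
      linear_ext (\<lambda>i. 0) (linear_ext (\<lambda>i. 0) (T_y \<alpha> i) + linear_ext (T_y \<alpha>) 0)"
    using assms by (cases i; simp add: mult_ac flip: single_uminus)+
qed (simp_all add: span_on_def)

lemma T_simple:
  assumes "CHAR('k::field) = p" "p > 2" "\<alpha> \<noteq> (0 :: 'k)" "\<beta> \<noteq> 0"
  shows "simple_module alg_A (mod_T \<alpha> \<beta>)"
proof -
  interpret T: basis_rep UNIV "\<lambda>i. 0" "T_y \<alpha>" "T_g \<beta>"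
    "\<lambda>i. case i of E0 \<Rightarrow> inverse \<beta> *\<^sub>v basis_e E1 | E1 \<Rightarrow> basis_e E0"
    by (rule T_rep) fact
  have two: "(2 :: 'k) \<noteq> 0"
    using of_nat_eq_0_iff_char_dvd[of 2, where 'a = 'k] assms(1,2) by (auto dest: dvd_imp_le)
  show ?thesis
    unfolding mod_T_def
  proof (rule T.simpleI[OF UNIV_I])
    fix H u i assume H: "submodule H alg_A T.M" and u: "u \<in> H" "u \<noteq> 0"
    note H' = T.submodule_closed[OF H]
    define a b where "a = Poly_Mapping.lookup u E0" and "b = Poly_Mapping.lookup u E1"
    have uab: "u = Poly_Mapping.single E0 a + Poly_Mapping.single E1 b"
    proof (rule poly_mapping_eqI)
      fix k show "Poly_Mapping.lookup u k = Poly_Mapping.lookup (Poly_Mapping.single E0 a + Poly_Mapping.single E1 b) k"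
        by (cases k) (simp_all add: a_def b_def lookup_add lookup_single)
    qed
    have e: "Poly_Mapping.single k 1 \<in> H" if "Poly_Mapping.single k c \<in> H" "c \<noteq> 0" for k c
      using H'(7)[OF that(1), of "inverse c"] that(2) by simp
    have swap: "basis_e E0 \<in> H \<longleftrightarrow> basis_e E1 \<in> H"
      using H'(6)[of "basis_e E0"] H'(6)[of "basis_e E1"] e[of E0 \<beta>] assms(4) by auto
    \<comment> \<open>\<open>y + \<alpha>\<close> and \<open>y - \<alpha>\<close> project onto the
      two eigenlines up to the factors \<open>2 * \<alpha>\<close> and
      \<open>- 2 * \<alpha>\<close>, which are nonzero in odd characteristic. \<open>g\<close> then
      carries each line to the other.\<close>
    have "T.op_y u + \<alpha> *\<^sub>v u = Poly_Mapping.single E0 (2 * \<alpha> * a)"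
      by (rule poly_mapping_eqI) (auto simp: uab lookup_add lookup_single when_def)
    then have 0: "Poly_Mapping.single E0 (2 * \<alpha> * a) \<in> H" using H'(3,5,7) u(1) by metis
    have "T.op_y u + (- \<alpha>) *\<^sub>v u = Poly_Mapping.single E1 (- 2 * \<alpha> * b)"
      by (rule poly_mapping_eqI) (auto simp: uab lookup_add lookup_minus lookup_single when_def)
    then have 1: "Poly_Mapping.single E1 (- 2 * \<alpha> * b) \<in> H" using H'(3,5,7) u(1) by metis
    have "a \<noteq> 0 \<or> b \<noteq> 0" using u(2) uab by auto
    then have "basis_e E0 \<in> H \<or> basis_e E1 \<in> H" using e[OF 0] e[OF 1] two assms(3) by auto
    then show "Poly_Mapping.single i 1 \<in> H" using swap by (cases i) auto
  qed
qed

section \<open>The modules \<open>V\<close>\<close>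

locale V_params =
  fixes p :: nat and \<alpha> \<beta> \<gamma> :: "'k::field"
  assumes CHAR_p: "CHAR('k) = p" and p: "p > 2" and \<alpha>: "\<alpha> \<noteq> 0" and \<beta>: "\<beta> \<noteq> 0"
begin

text \<open>The indexing of the basis is extended to all \<open>n\<close> by \<open>v\<^sub>n\<^sub>+\<^sub>p = \<beta> v\<^sub>n\<close>, so that the
  action is given by the same formulas for all indices.\<close>

definition vv :: "nat \<Rightarrow> (vw, 'k) vec" where
  "vv n = Poly_Mapping.single (V_index (n mod p)) (\<beta> ^ (n div p))"

definition ww :: "nat \<Rightarrow> (vw, 'k) vec" where
  "ww n = Poly_Mapping.single (W_index (n mod p)) (\<beta> ^ (n div p))"

abbreviation "I \<equiv> V_index ` {0..<p} \<union> W_index ` {0..<p}"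
abbreviation "op_x \<equiv> linear_ext (V_x :: vw \<Rightarrow> (vw, 'k) vec)"
abbreviation "op_y \<equiv> linear_ext (V_y p \<beta> \<gamma>)"
abbreviation "op_g \<equiv> linear_ext (V_g p \<alpha> \<beta>)"

lemma shift: "vv (n + p) = \<beta> *\<^sub>v vv n" "ww (n + p) = \<beta> *\<^sub>v ww n"
  using p by (simp_all add: vv_def ww_def)

lemma shift_mult: "vv (n + q * p) = \<beta> ^ q *\<^sub>v vv n" "ww (n + q * p) = \<beta> ^ q *\<^sub>v ww n"
  using p by (simp_all add: vv_def ww_def power_add mult.commute)

lemma base: "i < p \<Longrightarrow> basis_v i = vv i" "i < p \<Longrightarrow> basis_w i = ww i"
  by (simp_all add: vv_def ww_def)

lemma of_nat_p: "of_nat p = (0 :: 'k)"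
  using of_nat_eq_0_iff_char_dvd[of p, where 'a = 'k] CHAR_p by simp

lemma of_nat_mod: "of_nat (n mod p) = (of_nat n :: 'k)"
proof -
  have "of_nat n = (of_nat (p * (n div p) + n mod p) :: 'k)" by simp
  then show ?thesis by (simp only: of_nat_add of_nat_mult of_nat_p) simp
qed

text \<open>The exceptional formulas at the last index are instances of the general ones: stepping
  from \<open>p - 1\<close> to \<open>p\<close> brings in \<open>\<beta>\<close> by the extended
  indexing, and the coefficient \<open>Suc i\<close> is \<open>p\<close>, which is zero in the
  field.\<close>

lemma V_vw:
  assumes "i < p"
  shows "V_y p \<beta> \<gamma> (V_index i) = ww (Suc i)"
    "V_y p \<beta> \<gamma> (W_index i) = of_nat (Suc i) *\<^sub>v vv i + \<gamma> *\<^sub>v vv (Suc i)"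
    "V_g p \<alpha> \<beta> (V_index i) = (- inverse \<alpha>) *\<^sub>v vv (Suc i)"
    "V_g p \<alpha> \<beta> (W_index i) = inverse \<alpha> *\<^sub>v ww (Suc i)"
    "V_x (V_index i) = (0 :: (vw, 'k) vec)" "V_x (W_index i) = vv i"
proof -
  have "of_nat (Suc (p - 1)) = (0 :: 'k)" using of_nat_p p by simp
  moreover have "i < p - 1 \<or> i = p - 1" using assms by linarith
  ultimately show "V_y p \<beta> \<gamma> (V_index i) = ww (Suc i)"
    "V_y p \<beta> \<gamma> (W_index i) = of_nat (Suc i) *\<^sub>v vv i + \<gamma> *\<^sub>v vv (Suc i)"
    "V_g p \<alpha> \<beta> (V_index i) = (- inverse \<alpha>) *\<^sub>v vv (Suc i)"
    "V_g p \<alpha> \<beta> (W_index i) = inverse \<alpha> *\<^sub>v ww (Suc i)"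
    using p by (auto simp: vv_def ww_def mult.commute simp del: of_nat_Suc)
  show "V_x (V_index i) = (0 :: (vw, 'k) vec)" "V_x (W_index i) = vv i"
    using assms by (simp_all add: vv_def)
qed

lemma expand: "vv n = \<beta> ^ (n div p) *\<^sub>v basis_v (n mod p)" "ww n = \<beta> ^ (n div p) *\<^sub>v basis_w (n mod p)"
  by (simp_all add: vv_def ww_def)

lemma mod_shift:
  "\<beta> ^ (n div p) *\<^sub>v vv (n mod p + k) = vv (n + k)" "\<beta> ^ (n div p) *\<^sub>v ww (n mod p + k) = ww (n + k)"
  unfolding shift_mult[symmetric] by (simp_all add: add.commute add.left_commute)

lemma ops:
  "op_x (vv n) = 0" "op_x (ww n) = vv n" "op_y (vv n) = ww (Suc n)"
  "op_y (ww n) = of_nat (Suc n) *\<^sub>v vv n + \<gamma> *\<^sub>v vv (Suc n)"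
  "op_g (vv n) = (- inverse \<alpha>) *\<^sub>v vv (Suc n)" "op_g (ww n) = inverse \<alpha> *\<^sub>v ww (Suc n)"
proof -
  have m: "n mod p < p" using p by simp
  have mc: "\<beta> ^ (n div p) *\<^sub>v (c *\<^sub>v u) = c *\<^sub>v (\<beta> ^ (n div p) *\<^sub>v u)" for c and u :: "(vw, 'k) vec"
    by (simp add: mult.commute)
  have s: "\<beta> ^ (n div p) *\<^sub>v vv (n mod p) = vv n" "\<beta> ^ (n div p) *\<^sub>v vv (Suc (n mod p)) = vv (Suc n)"
    "\<beta> ^ (n div p) *\<^sub>v ww (Suc (n mod p)) = ww (Suc n)"
    using mod_shift(1)[of n 0] mod_shift(1)[of n 1] mod_shift(2)[of n 1] by simp_all
  have o: "of_nat (Suc (n mod p)) = (of_nat (Suc n) :: 'k)" by (simp add: of_nat_mod)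
  show "op_x (vv n) = 0" "op_x (ww n) = vv n" "op_y (vv n) = ww (Suc n)"
    "op_y (ww n) = of_nat (Suc n) *\<^sub>v vv n + \<gamma> *\<^sub>v vv (Suc n)"
    "op_g (vv n) = (- inverse \<alpha>) *\<^sub>v vv (Suc n)" "op_g (ww n) = inverse \<alpha> *\<^sub>v ww (Suc n)"
    unfolding expand[of n] linear_ext_simps(2) linear_ext_single scale_simps(4) V_vw[OF m] scale_simps(1) mc s o scale_simps(6)
    by (simp_all only: s expand[of n, symmetric])
qed

text \<open>The inverse of \<open>g\<close> lowers the index by one. Raising it by
  \<open>p - 1\<close> and dividing by \<open>\<beta>\<close> has the same effect without an index
  \<open>- 1\<close>.\<close>

definition inv_g :: "vw \<Rightarrow> (vw, 'k) vec" where
  "inv_g i = (case i of V_index k \<Rightarrow> (- \<alpha> * inverse \<beta>) *\<^sub>v vv (k + (p - 1))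
    | W_index k \<Rightarrow> (\<alpha> * inverse \<beta>) *\<^sub>v ww (k + (p - 1)))"

lemma inv_g_ops:
  "linear_ext inv_g (vv n) = (- \<alpha> * inverse \<beta>) *\<^sub>v vv (n + (p - 1))"
  "linear_ext inv_g (ww n) = (\<alpha> * inverse \<beta>) *\<^sub>v ww (n + (p - 1))"
proof -
  have mc: "\<beta> ^ (n div p) *\<^sub>v (c *\<^sub>v u) = c *\<^sub>v (\<beta> ^ (n div p) *\<^sub>v u)" for c and u :: "(vw, 'k) vec"
    by (simp add: mult.commute)
  show "linear_ext inv_g (vv n) = (- \<alpha> * inverse \<beta>) *\<^sub>v vv (n + (p - 1))"
    "linear_ext inv_g (ww n) = (\<alpha> * inverse \<beta>) *\<^sub>v ww (n + (p - 1))"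
    unfolding expand[of n] linear_ext_simps(2) linear_ext_single scale_simps(4) inv_g_def vw.case mc mod_shift
    by (rule refl)+
qed

lemma in_span: "vv n \<in> span_on I" "ww n \<in> span_on I"
  using p by (auto simp: vv_def ww_def intro!: span_on_closed)

sublocale rep: basis_rep I V_x "V_y p \<beta> \<gamma>" "V_g p \<alpha> \<beta>" inv_g
proof unfold_locales
  fix i assume "i \<in> I"
  then obtain k where k: "k < p" and i: "i = V_index k \<or> i = W_index k" by auto
  note V = V_vw[OF k]
  have Suc_shift: "Suc (k + (p - 1)) = k + p" using p by simp
  have sh: "vv (Suc (k + (p - 1))) = \<beta> *\<^sub>v vv k" "ww (Suc (k + (p - 1))) = \<beta> *\<^sub>v ww k"
    "vv (Suc k + (p - 1)) = \<beta> *\<^sub>v vv k" "ww (Suc k + (p - 1)) = \<beta> *\<^sub>v ww k"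
    unfolding add_Suc Suc_shift shift by (rule refl)+
  show "(V_x i :: (vw, 'k) vec) \<in> span_on I" "V_y p \<beta> \<gamma> i \<in> span_on I" "V_g p \<alpha> \<beta> i \<in> span_on I" "inv_g i \<in> span_on I"
    using i by (auto simp del: V_x.simps V_y.simps V_g.simps simp add: V inv_g_def intro!: span_on_closed in_span)
  have one: "\<alpha> * inverse \<beta> * (inverse \<alpha> * \<beta>) = 1" "inverse \<alpha> * (\<alpha> * inverse \<beta> * \<beta>) = 1"
    using \<alpha> \<beta> by (simp_all add: field_simps)
  show "op_g (inv_g i) = Poly_Mapping.single i 1" "linear_ext inv_g (V_g p \<alpha> \<beta> i) = Poly_Mapping.single i 1"
    using i base[OF k]
    by (auto simp del: V_x.simps V_y.simps V_g.simps add_Suc One_nat_def simp add: V inv_g_def ops inv_g_ops sh one)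
  have dbl: "u + u = 2 *\<^sub>v u" "c *\<^sub>v u + c *\<^sub>v u = (c * 2) *\<^sub>v u" for c and u :: "(vw, 'k) vec"
    using scale_simps(2)[of 1 1 u] scale_simps(2)[of c c u] by (simp_all add: mult_2_right)
  show "op_x (V_x i) = 0"
    using i by (auto simp del: V_x.simps V_y.simps V_g.simps simp add: V ops)
  show "op_y (op_x (V_y p \<beta> \<gamma> i) + op_y (V_x i)) =
      op_x (op_y (V_y p \<beta> \<gamma> i)) + op_y (op_x (V_y p \<beta> \<gamma> i)) + op_x (op_x (V_y p \<beta> \<gamma> i) + op_y (V_x i))"
    "op_g (V_x i) = - op_x (V_g p \<alpha> \<beta> i)" "op_g (V_y p \<beta> \<gamma> i) = - op_y (V_g p \<alpha> \<beta> i) + op_x (V_g p \<alpha> \<beta> i)"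
    using i by (auto simp del: V_x.simps V_y.simps V_g.simps simp add: V ops dbl algebra_simps)
qed

lemma mod_V_eq: "mod_V p \<alpha> \<beta> \<gamma> = rep.M"
  by (simp add: mod_V_def)

end

text \<open>Subtracting \<open>c i\<close> from the operator removes the key \<open>i\<close> and,
  the eigenvalues being distinct, no other key; so the support shrinks until one key is
  left.\<close>

lemma diagonal_stable:
  fixes c :: "'i \<Rightarrow> 'k::field"
  assumes add: "\<And>u v. u \<in> H \<Longrightarrow> v \<in> H \<Longrightarrow> u + v \<in> H" and scale: "\<And>c u. u \<in> H \<Longrightarrow> c *\<^sub>v u \<in> H"
    and D: "\<And>u. u \<in> H \<Longrightarrow> Poly_Mapping.keys u \<subseteq> S \<Longrightarrow> linear_ext (\<lambda>j. Poly_Mapping.single j (c j)) u \<in> H"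
    and c: "inj_on c S" and u: "u \<in> H" "u \<noteq> 0" "Poly_Mapping.keys u \<subseteq> S"
  shows "\<exists>i\<in>S. Poly_Mapping.single i 1 \<in> H"
  using u
proof (induction "card (Poly_Mapping.keys u)" arbitrary: u rule: less_induct)
  case less
  have lookup_D: "Poly_Mapping.lookup (linear_ext (\<lambda>j. Poly_Mapping.single j (c j)) u) i = c i * Poly_Mapping.lookup u i" for i
    by (simp add: linear_ext_def lookup_sum lookup_single when_def in_keys_iff)
  obtain i where i: "i \<in> Poly_Mapping.keys u" using less.prems(2) by fastforce
  define a where "a = Poly_Mapping.lookup u i"
  have a: "a \<noteq> 0" using i by (simp add: a_def in_keys_iff)
  define u' where "u' = linear_ext (\<lambda>j. Poly_Mapping.single j (c j)) u + (- c i) *\<^sub>v u"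
  have lu': "Poly_Mapping.lookup u' j = (c j - c i) * Poly_Mapping.lookup u j" for j
    by (simp add: u'_def lookup_add lookup_D lookup_minus left_diff_distrib)
  have "u' \<in> H" unfolding u'_def using less.prems by (intro add scale D) auto
  show ?case
  proof (cases "u' = 0")
    case True
    have "j = i" if "j \<in> Poly_Mapping.keys u" for j
    proof -
      have "c j = c i" using lu'[of j] True that by (simp add: in_keys_iff)
      then show ?thesis using c that i less.prems(3) by (auto dest: inj_onD)
    qed
    then have "u = Poly_Mapping.single i a"
      by (intro poly_mapping_eqI) (auto simp: lookup_single when_def a_def in_keys_iff)
    then have "Poly_Mapping.single i 1 \<in> H" using scale[OF less.prems(1), of "inverse a"] a by simp
    then show ?thesis using i less.prems(3) by blast
  next
    case False
    have "Poly_Mapping.keys u' \<subseteq> Poly_Mapping.keys u - {i}" by (auto simp: in_keys_iff lu')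
    then have "Poly_Mapping.keys u' \<subset> Poly_Mapping.keys u" using i by blast
    then show ?thesis using less.hyps[of u'] False \<open>u' \<in> H\<close> less.prems(3) by (meson finite_keys psubset_card_mono psubset_imp_subset subset_trans)
  qed
qed

context V_params
begin

text \<open>On the span of the \<open>v_k\<close>, \<open>s\<close> raises the index and
  \<open>Y - \<gamma> s^2\<close> sends \<open>v_k\<close> to \<open>(k + 2) v_{k+1}\<close>.
  Returning to \<open>k\<close> by \<open>s ^ (p - 1)\<close> gives a diagonal operator with
  eigenvalues \<open>\<beta> (k + 2)\<close>, which are distinct for \<open>k < p\<close>. A nonzero
  submodule thus contains some \<open>v_k\<close>, from which all basis vectors are reached.\<close>

lemma V_simple: "simple_module alg_A (mod_V p \<alpha> \<beta> \<gamma>)"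
  unfolding mod_V_eq
proof (rule rep.simpleI)
  show "V_index 0 \<in> I" using p by simp
  fix H u i assume H: "submodule H alg_A rep.M" and u: "u \<in> H" "u \<noteq> 0" and i: "i \<in> I"
  note H' = rep.submodule_closed[OF H]
  let ?S = "V_index ` {0..<p}"
  \<comment> \<open>\<open>x\<close> kills every \<open>v_k\<close> and sends \<open>w_k\<close> to
    \<open>v_k\<close>. So \<open>op_x u\<close> is a nonzero combination of the \<open>v_k\<close>,
    or \<open>u\<close> has no component at any \<open>w_k\<close>.\<close>
  have "\<exists>u'\<in>H. u' \<noteq> 0 \<and> Poly_Mapping.keys u' \<subseteq> ?S"
  proof (cases "op_x u = 0")
    case False
    have "V_x j \<in> span_on ?S" if "j \<in> I" for j
      using that by (auto simp: span_on_def)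
    then have "op_x u \<in> span_on ?S" using linear_ext_in_span[of I V_x ?S u] H'(1) u by blast
    then show ?thesis using False H'(4)[OF u(1)] by (auto simp: span_on_def)
  next
    case True
    have "Poly_Mapping.lookup (op_x u) (V_index k) = Poly_Mapping.lookup u (W_index k)" for k
    proof -
      have "Poly_Mapping.lookup (op_x u) (V_index k) =
          (\<Sum>j\<in>Poly_Mapping.keys u. if j = W_index k then Poly_Mapping.lookup u j else 0)"
        unfolding linear_ext_def lookup_sum
      proof (rule sum.cong[OF refl])
        fix j show "Poly_Mapping.lookup (Poly_Mapping.lookup u j *\<^sub>v V_x j) (V_index k) =
            (if j = W_index k then Poly_Mapping.lookup u j else 0)"
          by (cases j) (auto simp: lookup_single when_def)
      qed
      then show ?thesis by (simp add: in_keys_iff)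
    qed
    then have "W_index k \<notin> Poly_Mapping.keys u" for k using True by (simp add: in_keys_iff)
    moreover have "Poly_Mapping.keys u \<subseteq> I" using H'(1) u by (auto simp: span_on_def)
    ultimately show ?thesis using u by blast
  qed
  then obtain u' where u': "u' \<in> H" "u' \<noteq> 0" "Poly_Mapping.keys u' \<subseteq> ?S" by blast
  define sop :: "(vw, 'k) vec \<Rightarrow> (vw, 'k) vec" where "sop u = op_x (op_y u) + op_y (op_x u)" for u
  have lin_sop: "lin sop"
    unfolding sop_def by (intro lin_intros lin_linear_ext_comp)
  have lin_pow: "lin (\<lambda>u. (sop ^^ k) (f u))" if "lin f" for k and f :: "(vw, 'k) vec \<Rightarrow> (vw, 'k) vec"
    using that lin_sop by (induction k) (auto simp: lin_def)
  have sop_vv: "(sop ^^ k) (vv n) = vv (n + k)" for k n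
    by (induction k) (simp_all add: sop_def ops)
  have sop_H: "(sop ^^ k) v \<in> H" if "v \<in> H" for k v
    by (induction k) (simp_all add: sop_def that H')
  \<comment> \<open>The eigenvalues of the operator \<open>d\<close> below; at
    \<open>W_index\<close> the value is a filler, as only keys in \<open>?S\<close> are
    considered.\<close>
  define c where "c j = (case j of V_index k \<Rightarrow> \<beta> * of_nat (k + 2) | W_index k \<Rightarrow> 0)" for j
  define d where "d v = (sop ^^ (p - 1)) (op_y (op_y v) + (- \<gamma>) *\<^sub>v (sop ^^ 2) v)" for v
  have lin_scale: "lin (\<lambda>u. c *\<^sub>v f u)" if "lin f" for c and f :: "(vw, 'k) vec \<Rightarrow> (vw, 'k) vec"
    using that by (auto simp: lin_def mult.commute)
  have "d v = linear_ext (\<lambda>j. Poly_Mapping.single j (c j)) v" if "v \<in> span_on ?S" for v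
  proof (rule lin_eq_on_span[OF _ _ _ that])
    show "lin d" unfolding d_def
      by (intro lin_pow lin_intros(3) lin_linear_ext_comp lin_scale lin_intros(2))
    show "lin (linear_ext (\<lambda>j. Poly_Mapping.single j (c j)))" by (rule lin_linear_ext)
    fix j assume "j \<in> ?S"
    then obtain k where k: "k < p" "j = V_index k" by auto
    have "op_y (op_y (vv k)) + (- \<gamma>) *\<^sub>v (sop ^^ 2) (vv k) = of_nat (k + 2) *\<^sub>v vv (Suc k)"
      unfolding sop_vv by (simp add: ops)
    then have "d (vv k) = of_nat (k + 2) *\<^sub>v (sop ^^ (p - 1)) (vv (Suc k))"
      using linD(2)[OF lin_pow[OF lin_intros(2)]] by (simp only: d_def)
    also have "(sop ^^ (p - 1)) (vv (Suc k)) = vv (k + p)" using p by (simp add: sop_vv)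
    finally have "d (vv k) = of_nat (k + 2) *\<^sub>v vv (k + p)" .
    then show "d (Poly_Mapping.single j 1) = linear_ext (\<lambda>j. Poly_Mapping.single j (c j)) (Poly_Mapping.single j 1)"
      using k by (simp add: base[OF k(1), symmetric] shift c_def mult.commute)
  qed
  then have D: "linear_ext (\<lambda>j. Poly_Mapping.single j (c j)) v \<in> H" if "v \<in> H" "Poly_Mapping.keys v \<subseteq> ?S" for v
    using that sop_H H'(3,5,7) unfolding d_def span_on_def by (metis (no_types, lifting) mem_Collect_eq)
  have inj: "inj_on c ?S"
  proof (rule inj_onI)
    have *: "k = l" if "k \<le> l" "l < p" "of_nat k = (of_nat l :: 'k)" for k l
    proof -
      have "of_nat (l - k) = (0 :: 'k)" using that by (simp add: of_nat_diff)
      then have "p dvd l - k" using of_nat_eq_0_iff_char_dvd[of "l - k", where 'a = 'k] CHAR_p by simp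
      then show ?thesis using that by (auto dest: dvd_imp_le)
    qed
    fix j j' assume "j \<in> ?S" "j' \<in> ?S" "c j = c j'"
    then obtain k l where "k < p" "l < p" "j = V_index k" "j' = V_index l" "of_nat k = (of_nat l :: 'k)"
      using \<beta> by (auto simp: c_def)
    then show "j = j'" using *[of k l] *[of l k] by (cases "k \<le> l") auto
  qed
  obtain j where "j \<in> ?S" "Poly_Mapping.single j 1 \<in> H"
    using diagonal_stable[OF H'(3) H'(7) D inj u'] by blast
  then obtain k where k: "k < p" "vv k \<in> H" using base by auto
  have v: "vv l \<in> H" for l
  proof -
    \<comment> \<open>One more turn around the cycle covers \<open>l < k\<close>, at the cost of the
      invertible factor \<open>\<beta>\<close>.\<close>
    have "(sop ^^ (l + p - k)) (vv k) = vv (l + p)" using k(1) by (simp add: sop_vv)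
    then have "\<beta> *\<^sub>v vv l \<in> H" using sop_H[OF k(2)] shift by metis
    then show ?thesis using H'(7)[of "\<beta> *\<^sub>v vv l" "inverse \<beta>"] \<beta> by simp
  qed
  have w: "ww l \<in> H" for l
  proof -
    have "op_y (vv (l + (p - 1))) = ww (l + p)" using p by (simp add: ops)
    then have "\<beta> *\<^sub>v ww l \<in> H" using H'(5)[OF v] shift by metis
    then show ?thesis using H'(7)[of "\<beta> *\<^sub>v ww l" "inverse \<beta>"] \<beta> by simp
  qed
  show "Poly_Mapping.single i 1 \<in> H" using i v w base by auto
qed

end

section \<open>Consequences of the equations of a generating vector\<close>

context super_jordan_bosonization
begin

text \<open>If \<open>L\<close> is the annihilator of \<open>u\<close>, then
  \<open>{a. a * m \<in> L}\<close> is the annihilator of \<open>m u\<close>. Replacing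
  \<open>L\<close> by it, the generating vector becomes 1.\<close>

lemma vector_shift:
  "S_vector \<gamma> {a. a * m \<in> L} 1 \<longleftrightarrow> S_vector \<gamma> L m"
  "T_vector \<alpha> \<beta> {a. a * m \<in> L} 1 \<longleftrightarrow> T_vector \<alpha> \<beta> L m"
  "V_vector \<alpha> \<beta> \<gamma> {a. a * m \<in> L} 1 \<longleftrightarrow> V_vector \<alpha> \<beta> \<gamma> L m"
  by (simp_all add: S_vector_def T_vector_def V_vector_def distrib_right left_diff_distrib mult.assoc)

text \<open>Modulo \<open>J\<close>, \<open>s ^ n\<close> behaves like \<open>v_n\<close> and
  \<open>y * s ^ n\<close> like \<open>w_{n+1}\<close>. The equations at 1 are multiplied by powers
  of \<open>s\<close> from the left; these commute with \<open>x\<close> and \<open>g\<close> and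
  pass \<open>Y\<close> by the Jordan plane rule.\<close>

lemma V_congruences:
  assumes J: "left_ideal J" and V: "V_vector \<alpha> \<beta> \<gamma> J 1"
  shows "x * s ^ n \<in> J" "x * (y * s ^ n) - s ^ Suc n \<in> J"
    "Y * s ^ n - (of_nat (n + 2) * s ^ Suc n + \<sigma> \<gamma> * s ^ Suc (Suc n)) \<in> J"
    "g * s ^ n + \<sigma> (inverse \<alpha>) * s ^ Suc n \<in> J"
    "g * (y * s ^ n) - \<sigma> (inverse \<alpha>) * (y * s ^ Suc n) \<in> J"
    "s ^ (n + q * p) - \<sigma> (\<beta> ^ q) * s ^ n \<in> J"
proof -
  note J' = left_idealD[OF J]
  have v: "x \<in> J" "g + \<sigma> (inverse \<alpha>) * s \<in> J" "s ^ p - \<sigma> \<beta> \<in> J" "Y - 2 * s - \<sigma> \<gamma> * (s * s) \<in> J"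
    using V by (simp_all add: V_vector_def)
  have sx: "x * s ^ n = s ^ n * x" for n by (rule power_commutes_if[OF xs[symmetric], symmetric])
  have sg: "g * s ^ n = s ^ n * g" for n by (rule power_commutes_if[OF gs[symmetric], symmetric])
  show 1: "x * s ^ n \<in> J" for n unfolding sx by (rule J'(3)[OF v(1)])
  have "x * (y * s ^ n) = s ^ Suc n - y * (x * s ^ n)"
    by (simp add: s_def distrib_right mult.assoc)
  then show "x * (y * s ^ n) - s ^ Suc n \<in> J" using J'(3)[OF 1] J'(4) by simp
  have "Y * s ^ n - (of_nat (n + 2) * s ^ Suc n + \<sigma> \<gamma> * s ^ Suc (Suc n)) =
      s ^ n * (Y - 2 * s - \<sigma> \<gamma> * (s * s))"
  proof -
    have m: "s ^ n * (of_nat k * s) = of_nat k * s ^ Suc n" for k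
      by (metis mult.assoc mult_of_nat_commute power_Suc2)
    have "s ^ n * (2 * s) = 2 * s ^ Suc n" using m[of 2] by simp
    moreover have "s ^ n * (\<sigma> \<gamma> * (s * s)) = \<sigma> \<gamma> * s ^ Suc (Suc n)"
      by (simp only: \<sigma>_commute power_Suc2 mult.assoc)
    ultimately show ?thesis
      unfolding jordan_plane_power(3)[OF Ys] right_diff_distrib distrib_left m
      by (simp add: distrib_right mult_2)
  qed
  then show "Y * s ^ n - (of_nat (n + 2) * s ^ Suc n + \<sigma> \<gamma> * s ^ Suc (Suc n)) \<in> J"
    using J'(3)[OF v(4)] by simp
  show 4: "g * s ^ n + \<sigma> (inverse \<alpha>) * s ^ Suc n \<in> J" for n
  proof -
    have "g * s ^ n + \<sigma> (inverse \<alpha>) * s ^ Suc n = s ^ n * (g + \<sigma> (inverse \<alpha>) * s)"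
      by (simp only: sg distrib_left \<sigma>_commute power_Suc2)
    then show ?thesis using J'(3)[OF v(2)] by simp
  qed
  have "g * (y * s ^ n) = (x - y) * (g * s ^ n)" by (simp only: gy mult.assoc[symmetric])
  then have "g * (y * s ^ n) - \<sigma> (inverse \<alpha>) * (y * s ^ Suc n) =
      (x - y) * (g * s ^ n + \<sigma> (inverse \<alpha>) * s ^ Suc n) - \<sigma> (inverse \<alpha>) * (x * s ^ Suc n)"
    by (simp only: distrib_left left_diff_distrib \<sigma>_commute right_diff_distrib) simp
  then show "g * (y * s ^ n) - \<sigma> (inverse \<alpha>) * (y * s ^ Suc n) \<in> J"
    using J'(3)[OF 4] J'(3)[OF 1] J'(5) by metis
  show "s ^ (n + q * p) - \<sigma> (\<beta> ^ q) * s ^ n \<in> J"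
  proof (induction q)
    case 0
    then show ?case using J'(1) by (simp add: \<sigma>'(2))
  next
    case (Suc q)
    have "s ^ (n + Suc q * p) - \<sigma> (\<beta> ^ Suc q) * s ^ n =
        s ^ (n + q * p) * (s ^ p - \<sigma> \<beta>) + \<sigma> \<beta> * (s ^ (n + q * p) - \<sigma> (\<beta> ^ q) * s ^ n)"
    proof -
      have "s ^ (n + Suc q * p) = s ^ (n + q * p) * s ^ p" by (simp add: add_ac flip: power_add)
      then show ?thesis
        by (simp add: right_diff_distrib \<sigma>'(4) \<sigma>'(5)[of \<beta> "s ^ (n + q * p)"] mult.assoc)
    qed
    then show ?case using J'(2,3) v(3) Suc by simp
  qed
qed

text \<open>The equations at 1 put \<open>x\<close>, \<open>y\<close>, \<open>s\<close> and
  \<open>g - \<sigma> \<gamma>\<close> into a left ideal, whereas \<open>S\<close> is the quotient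
  by a two-sided ideal. Induction over words extends the equations to all right multiples.\<close>

lemma S_kernel:
  assumes L: "left_ideal L" and S: "S_vector \<gamma> L 1"
  shows "x * b \<in> L" "y * b \<in> L" "s * b \<in> L" "(g - \<sigma> \<gamma>) * b \<in> L"
proof -
  note L' = left_idealD[OF L]
  define N where "N = {b. x * b \<in> L \<and> y * b \<in> L \<and> s * b \<in> L \<and> (g - \<sigma> \<gamma>) * b \<in> L}"
  have N: "x * b \<in> L" "y * b \<in> L" "s * b \<in> L" "(g - \<sigma> \<gamma>) * b \<in> L" if "b \<in> N" for b
    using that by (simp_all add: N_def)
  have NL: "b \<in> N" if "b \<in> L" for b using that L'(3) by (simp add: N_def)
  have "N = UNIV"
  proof (rule gen)
    show "1 \<in> N" using S by (simp add: N_def S_vector_def)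
    show "a + b \<in> N" if "a \<in> N" "b \<in> N" for a b
      using that L'(2) by (simp add: N_def distrib_left)
    fix b assume b: "b \<in> N"
    show "\<sigma> c * b \<in> N" for c using b L'(3) by (simp add: N_def \<sigma>_commute)
    show "x * b \<in> N" "y * b \<in> N" using NL N[OF b] by blast+
    have hg': "h * (g * b) = b" "g * (h * b) = b" using gh hg by (simp_all flip: mult.assoc)
    have g: "x * (g * b) = - (g * (x * b))" "y * (g * b) = x * (g * b) - g * (y * b)"
      "s * (g * b) = g * (s * b)" "(g - \<sigma> \<gamma>) * (g * b) = g * ((g - \<sigma> \<gamma>) * b)"
      by (simp_all add: gx gs left_diff_distrib right_diff_distrib \<sigma>_commute flip: mult.assoc)
        (simp_all add: yg left_diff_distrib mult.assoc \<sigma>_commute)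
    then have "x * (g * b) \<in> L" using N(1)[OF b] L'(3,4) by simp
    then show "g * b \<in> N" using N[OF b] L'(3,5) g by (simp add: N_def)
    have h: "x * (h * b) = - (h * (x * b))" "y * (h * b) = - (h * (y * b)) - x * (h * b)"
      "s * (h * b) = h * (s * b)"
      by (simp_all add: hx hs flip: mult.assoc) (simp add: yh left_diff_distrib mult.assoc)
    have h4: "(g - \<sigma> \<gamma>) * (h * b) = h * ((g - \<sigma> \<gamma>) * b)"
      by (simp add: left_diff_distrib right_diff_distrib \<sigma>_commute mult.assoc hg')
    have "x * (h * b) \<in> L" using N(1)[OF b] L'(3,4) h by simp
    then show "h * b \<in> N" using N[OF b] L'(3,4,5) h h4 by (simp add: N_def)
  qed
  then have "b \<in> N" by simp
  then show "x * b \<in> L" "y * b \<in> L" "s * b \<in> L" "(g - \<sigma> \<gamma>) * b \<in> L" by (rule N)+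
qed

end

lemma T_ann_subset:
  fixes J :: "'k::alg_closed_field bos set"
  assumes p: "CHAR('k) = p" "p > 2" and "\<beta> \<noteq> 0" and J: "left_ideal J"
    and T: "super_jordan_bosonization.T_vector bos_scalar (bos_of fx) (bos_of fy) (bos_of fg) \<alpha> \<beta> J 1"
  shows "ann (mod_T \<alpha> \<beta>) (basis_e E0) \<subseteq> J"
proof -
  interpret sj: super_jordan_bosonization bos_scalar "bos_of fx :: 'k bos" "bos_of fy" "bos_of fg" "bos_of fginv" "bos_of fs" p
    by (rule super_jordan_bos[OF p])
  interpret T: basis_rep UNIV "\<lambda>i. 0" "T_y \<alpha>" "T_g \<beta>"
    "\<lambda>i. case i of E0 \<Rightarrow> inverse \<beta> *\<^sub>v basis_e E1 | E1 \<Rightarrow> basis_e E0"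
    by (rule T_rep) fact
  note J' = left_idealD[OF J]
  let ?x = "bos_of fx :: 'k bos" and ?y = "bos_of fy :: 'k bos" and ?g = "bos_of fg :: 'k bos"
  have t: "?x \<in> J" "?x * ?g \<in> J" "?y - bos_scalar \<alpha> \<in> J" "?g * ?g - bos_scalar \<beta> \<in> J"
    using T by (simp_all add: sj.T_vector_def sj.G_def)
  have yg: "?y * ?g + bos_scalar \<alpha> * ?g \<in> J"
  proof -
    have "?y * ?g + bos_scalar \<alpha> * ?g = ?x * ?g - ?g * (?y - bos_scalar \<alpha>)"
      by (simp add: sj.yg right_diff_distrib sj.\<sigma>'(5)[of \<alpha> ?g])
    then show ?thesis using t J'(3,5) by simp
  qed
  show ?thesis
    unfolding mod_T_def
  \<comment> \<open>As \<open>e_0\<close> is lifted to 1, the equation \<open>e_1 = g e_0\<close>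
    makes \<open>g\<close> the lift of \<open>e_1\<close>.\<close>
  proof (rule T.ann_basis_subset[OF J UNIV_I, of "\<lambda>i. case i of E0 \<Rightarrow> 1 | E1 \<Rightarrow> ?g"])
    show "a * bos_scalar c = bos_scalar c * a" for c and a :: "'k bos" by (rule sj.\<sigma>'(5)[symmetric])
    fix i :: e_index
    show "?x * (case i of E0 \<Rightarrow> 1 | E1 \<Rightarrow> ?g) - bos_comb (\<lambda>i. case i of E0 \<Rightarrow> 1 | E1 \<Rightarrow> ?g) 0 \<in> J"
      "?y * (case i of E0 \<Rightarrow> 1 | E1 \<Rightarrow> ?g) - bos_comb (\<lambda>i. case i of E0 \<Rightarrow> 1 | E1 \<Rightarrow> ?g) (T_y \<alpha> i) \<in> J"
      "?g * (case i of E0 \<Rightarrow> 1 | E1 \<Rightarrow> ?g) - bos_comb (\<lambda>i. case i of E0 \<Rightarrow> 1 | E1 \<Rightarrow> ?g) (T_g \<beta> i) \<in> J"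
      using t yg J'(1) by (cases i; simp add: bos_comb_simps bos_scalar_simps)+
  qed (use J'(1) sj.hg in simp_all)
qed

lemma V_ann_subset:
  fixes J :: "'k::alg_closed_field bos set"
  assumes V: "V_params p \<alpha> \<beta>" and J: "left_ideal J"
    and v: "super_jordan_bosonization.V_vector bos_scalar (bos_of fx) (bos_of fy) (bos_of fg) (bos_of fs) p \<alpha> \<beta> \<gamma> J 1"
  shows "ann (mod_V p \<alpha> \<beta> \<gamma>) (basis_v 0) \<subseteq> J"
proof -
  interpret V: V_params p \<alpha> \<beta> \<gamma> by (rule V)
  interpret sj: super_jordan_bosonization bos_scalar "bos_of fx :: 'k bos" "bos_of fy" "bos_of fg" "bos_of fginv" "bos_of fs" p
    by (rule super_jordan_bos[OF V.CHAR_p V.p])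
  note J' = left_idealD[OF J] and c = sj.V_congruences[OF J v]
  let ?x = "bos_of fx :: 'k bos" and ?y = "bos_of fy :: 'k bos" and ?g = "bos_of fg :: 'k bos"
    and ?s = "bos_of fs :: 'k bos" and ?b = "bos_scalar (inverse \<beta>)"
  define R where "R a b \<longleftrightarrow> a - b \<in> J" for a b
  have Rtrans [trans]: "R a b \<Longrightarrow> R b d \<Longrightarrow> R a d" for a b d
    using J'(2)[of "a - b" "b - d"] by (simp add: R_def)
  have Rsym: "R a b \<Longrightarrow> R b a" for a b using J'(4)[of "a - b"] by (simp add: R_def)
  have Radd: "R a b \<Longrightarrow> R a' b' \<Longrightarrow> R (a + a') (b + b')" for a b a' b'
    using J'(2)[of "a - b" "a' - b'"] by (simp add: R_def algebra_simps)
  have Rmult: "R a b \<Longrightarrow> R (d * a) (d * b)" for a b d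
    using J'(3)[of "a - b" d] by (simp add: R_def right_diff_distrib)
  have b: "?b * (bos_scalar \<beta> * a) = a" for a
    using V.\<beta> by (simp add: bos_scalar_simps flip: mult.assoc bos_scalar_simps(4))
  \<comment> \<open>The lifts come from \<open>v_k = s^k v_0\<close> and
    \<open>w_k = y v_{k-1} = \<beta>^{-1} y v_{k+p-1}\<close>, where the last form avoids a negative
    index at \<open>k = 0\<close>.\<close>
  define \<phi> where "\<phi> j = (case j of V_index k \<Rightarrow> ?s ^ k | W_index k \<Rightarrow> ?b * (?y * ?s ^ (k + (p - 1))))" for j
  let ?\<Phi> = "bos_comb \<phi>"
  have sp: "R (?s ^ (n + p)) (bos_scalar \<beta> * ?s ^ n)" for n
    using c(6)[of n 1] by (simp add: R_def)
  have com: "a * (bos_scalar d * m) = bos_scalar d * (a * m)" for a m :: "'k bos" and d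
    by (rule sj.\<sigma>_commute)
  have \<Phi>v: "R (?\<Phi> (V.vv n)) (?s ^ n)" for n
    using Rsym[of "?s ^ n"] c(6)[of "n mod p" "n div p"]
    by (simp add: V.vv_def bos_comb_simps \<phi>_def R_def)
  have \<Phi>w: "R (?\<Phi> (V.ww n)) (?b * (?y * ?s ^ (n + (p - 1))))" for n
  proof -
    have e: "n mod p + (p - 1) + n div p * p = n + (p - 1)"
      by (metis add.assoc add.commute mod_mult_div_eq mult.commute)
    have r: "R (?s ^ (n + (p - 1))) (bos_scalar (\<beta> ^ (n div p)) * ?s ^ (n mod p + (p - 1)))"
      using c(6)[of "n mod p + (p - 1)" "n div p"] unfolding e by (simp add: R_def)
    have "?\<Phi> (V.ww n) = ?b * (?y * (bos_scalar (\<beta> ^ (n div p)) * ?s ^ (n mod p + (p - 1))))"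
      by (simp only: V.ww_def bos_comb_simps \<phi>_def vw.case com[of ?y] com[of ?b])
    then show ?thesis using Rsym[OF Rmult[OF Rmult[OF r, of ?y], of ?b]] by simp
  qed
  have S: "Suc (k + (p - 1)) = k + p" for k using V.p by simp
  have bp: "R (?b * ?s ^ (n + p)) (?s ^ n)" for n
    using Rmult[OF sp, of ?b n] by (simp add: b)
  show ?thesis
    unfolding V.mod_V_eq
  proof (rule V.rep.ann_basis_subset[OF J, of "V_index 0" \<phi>])
    show "a * bos_scalar d = bos_scalar d * a" for d and a :: "'k bos" by (rule sj.\<sigma>'(5)[symmetric])
    fix i assume "i \<in> V.I"
    then obtain k where k: "k < p" and i: "i = V_index k \<or> i = W_index k" by auto
    note Vk = V.V_vw[OF k]
    let ?n = "k + (p - 1)"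
    have "R (?x * \<phi> (V_index k)) (?\<Phi> (V_x (V_index k)))"
      using c(1)[of k] by (simp add: R_def \<phi>_def bos_comb_simps)
    moreover have "R (?x * \<phi> (W_index k)) (?\<Phi> (V_x (W_index k)))"
    proof -
      have "R (?x * \<phi> (W_index k)) (?b * ?s ^ (k + p))"
        using Rmult[of _ _ ?b] c(2)[of ?n] unfolding S by (simp add: R_def \<phi>_def com[of ?x])
      also note bp
      also have "R (?s ^ k) (?\<Phi> (V_x (W_index k)))" unfolding Vk by (rule Rsym[OF \<Phi>v])
      finally show ?thesis .
    qed
    ultimately show "?x * \<phi> i - ?\<Phi> (V_x i) \<in> J" using i by (auto simp: R_def)
    have "R (?y * \<phi> (V_index k)) (?\<Phi> (V_y p \<beta> \<gamma> (V_index k)))"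
    proof -
      have "R (?b * (?y * ?s ^ (k + p))) (?y * ?s ^ k)"
        using Rmult[OF bp, of ?y k] by (simp add: com[of ?y])
      then have "R (?\<Phi> (V.ww (Suc k))) (?y * ?s ^ k)" by (rule Rtrans[OF \<Phi>w[of "Suc k", unfolded add_Suc S]])
      then show ?thesis unfolding Vk by (simp add: \<phi>_def Rsym)
    qed
    moreover have "R (?y * \<phi> (W_index k)) (?\<Phi> (V_y p \<beta> \<gamma> (W_index k)))"
    proof -
      \<comment> \<open>Up to the period \<open>p\<close>, \<open>?n\<close> is
        \<open>k - 1\<close>, so the coefficient \<open>n + 2\<close> of the congruence becomes the
        coefficient \<open>k + 1\<close> in \<open>y w_k\<close>.\<close>
      have o: "of_nat (?n + 2) = (of_nat (Suc k) :: 'k bos)"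
      proof -
        have "?n + 2 = Suc k + p" using V.p by simp
        then show ?thesis by (simp only: of_nat_add sj.of_nat_p add_0_right)
      qed
      have "R (sj.Y * ?s ^ ?n) (of_nat (Suc k) * ?s ^ (k + p) + bos_scalar \<gamma> * ?s ^ (Suc k + p))"
        using c(3)[of ?n] unfolding o S R_def add_Suc .
      then have "R (?y * \<phi> (W_index k)) (?b * (of_nat (Suc k) * ?s ^ (k + p) + bos_scalar \<gamma> * ?s ^ (Suc k + p)))"
        using Rmult[of _ _ ?b] by (simp add: \<phi>_def com[of ?y] sj.Y_def mult.assoc)
      also have "?b * (of_nat (Suc k) * ?s ^ (k + p) + bos_scalar \<gamma> * ?s ^ (Suc k + p)) =
          bos_scalar (of_nat (Suc k)) * (?b * ?s ^ (k + p)) + bos_scalar \<gamma> * (?b * ?s ^ (Suc k + p))"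
        by (simp only: distrib_left com[of ?b] bos_scalar_simps(6)[symmetric])
      also have "R \<dots> (bos_scalar (of_nat (Suc k)) * ?s ^ k + bos_scalar \<gamma> * ?s ^ Suc k)"
        by (intro Radd Rmult bp)
      also have "R \<dots> (bos_scalar (of_nat (Suc k)) * ?\<Phi> (V.vv k) + bos_scalar \<gamma> * ?\<Phi> (V.vv (Suc k)))"
        by (intro Radd Rmult Rsym[OF \<Phi>v])
      finally show ?thesis unfolding Vk by (simp only: bos_comb_simps)
    qed
    ultimately show "?y * \<phi> i - ?\<Phi> (V_y p \<beta> \<gamma> i) \<in> J" using i by (auto simp: R_def)
    have "R (?g * \<phi> (V_index k)) (?\<Phi> (V_g p \<alpha> \<beta> (V_index k)))"
    proof -
      have "R (?g * \<phi> (V_index k)) (bos_scalar (- inverse \<alpha>) * ?s ^ Suc k)"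
        using c(4)[of k] by (simp add: R_def \<phi>_def bos_scalar_simps)
      also have "R \<dots> (bos_scalar (- inverse \<alpha>) * ?\<Phi> (V.vv (Suc k)))" by (intro Rmult Rsym[OF \<Phi>v])
      finally show ?thesis unfolding Vk by (simp only: bos_comb_simps)
    qed
    moreover have "R (?g * \<phi> (W_index k)) (?\<Phi> (V_g p \<alpha> \<beta> (W_index k)))"
    proof -
      have "R (?b * (?g * (?y * ?s ^ ?n))) (?b * (bos_scalar (inverse \<alpha>) * (?y * ?s ^ Suc ?n)))"
        by (rule Rmult) (use c(5)[of ?n] in \<open>simp add: R_def\<close>)
      then have "R (?g * \<phi> (W_index k)) (bos_scalar (inverse \<alpha>) * (?b * (?y * ?s ^ (Suc k + (p - 1)))))"
        by (simp only: \<phi>_def vw.case com[of ?g] com[of ?b] S add_Suc)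
      also have "R \<dots> (bos_scalar (inverse \<alpha>) * ?\<Phi> (V.ww (Suc k)))" by (intro Rmult Rsym[OF \<Phi>w])
      finally show ?thesis unfolding Vk by (simp only: bos_comb_simps)
    qed
    ultimately show "?g * \<phi> i - ?\<Phi> (V_g p \<alpha> \<beta> i) \<in> J" using i by (auto simp: R_def)
  qed (use J'(1) sj.hg V.p in \<open>simp_all add: \<phi>_def\<close>)
qed

section \<open>The modules \<open>S\<close>\<close>

lemma quotient_left_module:
  assumes R: "Ring.ring R" and I: "ideal I R"
  shows "left_module R (quotient_module R I)"
proof -
  interpret I: ideal I R by (rule I)
  interpret Q: Ring.ring "R Quot I" by (rule I.quotient_is_ring)
  note hom = I.rcos_ring_hom
  have s: "carrier (quotient_module R I) = carrier (R Quot I)" "\<zero>\<^bsub>quotient_module R I\<^esub> = \<zero>\<^bsub>R Quot I\<^esub>"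
    "u \<oplus>\<^bsub>quotient_module R I\<^esub> v = u \<oplus>\<^bsub>R Quot I\<^esub> v"
    "a \<odot>\<^bsub>quotient_module R I\<^esub> u = (I +>\<^bsub>R\<^esub> a) \<otimes>\<^bsub>R Quot I\<^esub> u" for a u v
    by (simp_all add: quotient_module_def)
  have "abelian_group (quotient_module R I)"
  proof (rule abelian_groupI)
    show "\<exists>y\<in>carrier (quotient_module R I). y \<oplus>\<^bsub>quotient_module R I\<^esub> x = \<zero>\<^bsub>quotient_module R I\<^esub>"
      if "x \<in> carrier (quotient_module R I)" for x
      using that by (intro bexI[of _ "\<ominus>\<^bsub>R Quot I\<^esub> x"]) (simp_all add: s Q.l_neg)
  qed (simp_all add: s Q.a_assoc Q.a_comm Q.a_lcomm)
  then show ?thesis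
    unfolding left_module_def left_module_axioms_def using R
    by (simp add: s ring_hom_closed[OF hom] ring_hom_add[OF hom] ring_hom_mult[OF hom] ring_hom_one[OF hom]
      Q.l_distr Q.r_distr Q.m_assoc)
qed

definition S_ideal :: "'k::field \<Rightarrow> 'k free_alg set set" where
  "S_ideal \<gamma> = Idl\<^bsub>alg_A\<^esub> {to_A fs, to_A fx, to_A fy, to_A (fg - fscalar \<gamma>)}"

lemma ideal_S_ideal: "ideal (S_ideal \<gamma>) alg_A"
  unfolding S_ideal_def by (rule ring.genideal_ideal[OF ring_alg_A]) (auto simp: carrier_alg_A)

lemma S_left_module: "left_module alg_A (mod_S \<gamma>)"
  unfolding mod_S_def S_ideal_def[symmetric] by (rule quotient_left_module[OF ring_alg_A ideal_S_ideal])

definition S_gen :: "'k::field \<Rightarrow> 'k free_alg set set" where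
  "S_gen \<gamma> = \<one>\<^bsub>alg_A Quot S_ideal \<gamma>\<^esub>"

lemma act_S_gen: "act (mod_S \<gamma>) a (S_gen \<gamma>) = S_ideal \<gamma> +>\<^bsub>alg_A\<^esub> coset a"
proof -
  interpret I: ideal "S_ideal \<gamma>" alg_A by (rule ideal_S_ideal)
  interpret Q: Ring.ring "alg_A Quot S_ideal \<gamma>" by (rule I.quotient_is_ring)
  show ?thesis
    using Q.r_one[OF ring_hom_closed[OF I.rcos_ring_hom coset], of a]
    by (simp add: act_def mod_S_def quotient_module_def S_gen_def S_ideal_def[symmetric])
qed

lemma S_module_simps:
  "carrier (mod_S \<gamma>) = range (\<lambda>a. act (mod_S \<gamma>) a (S_gen \<gamma>))" "S_gen \<gamma> \<in> carrier (mod_S \<gamma>)"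
  "ann (mod_S \<gamma>) (S_gen \<gamma>) = {a. coset a \<in> S_ideal \<gamma>}"
proof -
  interpret I: ideal "S_ideal \<gamma>" alg_A by (rule ideal_S_ideal)
  interpret Q: Ring.ring "alg_A Quot S_ideal \<gamma>" by (rule I.quotient_is_ring)
  have car: "carrier (mod_S \<gamma>) = carrier (alg_A Quot S_ideal \<gamma>)" "\<zero>\<^bsub>mod_S \<gamma>\<^esub> = S_ideal \<gamma>"
    by (simp_all add: mod_S_def quotient_module_def S_ideal_def[symmetric] FactRing_def)
  show "S_gen \<gamma> \<in> carrier (mod_S \<gamma>)" using Q.one_closed by (simp add: car S_gen_def)
  have "carrier (alg_A Quot S_ideal \<gamma>) = (\<lambda>a. S_ideal \<gamma> +>\<^bsub>alg_A\<^esub> a) ` carrier alg_A"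
    by (auto simp: FactRing_def A_RCOSETS_defs a_r_coset_def)
  also have "carrier alg_A = range (coset :: 'a bos \<Rightarrow> _)"
    using coset coset_surj by blast
  finally show "carrier (mod_S \<gamma>) = range (\<lambda>a. act (mod_S \<gamma>) a (S_gen \<gamma>))"
    by (auto simp: car act_S_gen)
  show "ann (mod_S \<gamma>) (S_gen \<gamma>) = {a. coset a \<in> S_ideal \<gamma>}"
    unfolding ann_def act_S_gen car using I.a_rcos_const I.a_rcos_self[OF coset] by blast
qed

text \<open>\<open>D\<close> is the largest two-sided ideal inside \<open>L\<close>; by
  \<open>S_kernel\<close> it contains the generators of \<open>S_ideal \<gamma>\<close>.\<close>

lemma S_ideal_subset:
  fixes L :: "'k::alg_closed_field bos set"
  assumes p: "CHAR('k) = p" "p > 2" and L: "left_ideal L"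
    and S: "super_jordan_bosonization.S_vector bos_scalar (bos_of fx) (bos_of fy) (bos_of fg) (bos_of fs) \<gamma> L 1"
  shows "ann (mod_S \<gamma>) (S_gen \<gamma>) \<subseteq> L"
proof -
  interpret sj: super_jordan_bosonization bos_scalar "bos_of fx :: 'k bos" "bos_of fy" "bos_of fg" "bos_of fginv" "bos_of fs" p
    by (rule super_jordan_bos[OF p])
  interpret A: Ring.ring "alg_A :: 'k free_alg set ring" by (rule ring_alg_A)
  note L' = left_idealD[OF L]
  define D where "D = {a. \<forall>b. a * b \<in> L}"
  have inv: "\<ominus>\<^bsub>alg_A\<^esub> (coset a) = coset (- a)" for a :: "'k bos"
    by (rule A.minus_equality) (simp_all add: coset flip: coset_simps)
  have "ideal (coset ` D) alg_A"
  proof (rule idealI[OF ring_alg_A])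
    show "subgroup (coset ` D) (add_monoid alg_A)"
    proof (rule subgroup.intro)
      show "coset ` D \<subseteq> carrier (add_monoid alg_A)" using coset by auto
      show "\<one>\<^bsub>add_monoid alg_A\<^esub> \<in> coset ` D"
        using L'(1) by (auto simp: D_def simp flip: coset_simps)
      fix u assume "u \<in> coset ` D"
      then obtain a where a: "u = coset a" "a \<in> D" by blast
      have "- a \<in> D" using a(2) L'(4) by (simp add: D_def)
      then show "inv\<^bsub>add_monoid alg_A\<^esub> u \<in> coset ` D"
        unfolding a_inv_def[symmetric] a(1) inv by blast
      fix v assume "v \<in> coset ` D"
      then obtain b where b: "v = coset b" "b \<in> D" by blast
      have "a + b \<in> D" using a(2) b(2) L'(2) by (simp add: D_def distrib_right)
      then show "u \<otimes>\<^bsub>add_monoid alg_A\<^esub> v \<in> coset ` D" by (simp add: a b flip: coset_simps)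
    qed
    fix u c :: "'k free_alg set" assume "u \<in> coset ` D" "c \<in> carrier alg_A"
    then obtain a b where a: "u = coset a" "a \<in> D" "c = coset b" using coset_surj by blast
    have "b * a \<in> D" "a * b \<in> D" using a(2) L'(3) by (simp_all add: D_def mult.assoc)
    then show "c \<otimes>\<^bsub>alg_A\<^esub> u \<in> coset ` D" "u \<otimes>\<^bsub>alg_A\<^esub> c \<in> coset ` D"
      by (simp_all add: a flip: coset_simps)
  qed
  moreover have "{to_A fs, to_A fx, to_A fy, to_A (fg - fscalar \<gamma>)} \<subseteq> coset ` D"
  proof -
    have "bos_of fs \<in> D" "bos_of fx \<in> D" "bos_of fy \<in> D" "bos_of (fg - fscalar \<gamma>) \<in> D"
      using sj.S_kernel[OF L S] by (simp_all add: D_def bos_of_minus bos_scalar_def)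
    then show ?thesis by (simp flip: coset_bos_of)
  qed
  ultimately have "S_ideal \<gamma> \<subseteq> coset ` D" unfolding S_ideal_def by (rule A.genideal_minimal)
  then show ?thesis
    unfolding S_module_simps
  proof (intro subsetI)
    fix a :: "'k bos" assume "S_ideal \<gamma> \<subseteq> coset ` D" "a \<in> {a. coset a \<in> S_ideal \<gamma>}"
    then have "coset a \<in> coset ` D" by blast
    then have "a \<in> D" by (auto simp: coset_inject)
    then have "a * 1 \<in> L" unfolding D_def by blast
    then show "a \<in> L" by simp
  qed
qed

text \<open>The ideal is proper because it annihilates the one-dimensional representation with
  \<open>x\<close> and \<open>y\<close> zero and \<open>g\<close> equal to \<open>\<gamma>\<close>.
  Modulo the ideal every generator is a scalar; for the inverse of \<open>g\<close> this scalar is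
  \<open>inverse \<gamma>\<close>.\<close>

lemma S_one_dimensional:
  assumes p: "CHAR('k::alg_closed_field) = p" "p > 2" and \<gamma>: "\<gamma> \<noteq> (0 :: 'k)"
  shows "1 \<notin> ann (mod_S \<gamma>) (S_gen \<gamma>)" "\<exists>c. a - bos_scalar c \<in> ann (mod_S \<gamma>) (S_gen \<gamma>)"
proof -
  interpret sj: super_jordan_bosonization bos_scalar "bos_of fx :: 'k bos" "bos_of fy" "bos_of fg" "bos_of fginv" "bos_of fs" p
    by (rule super_jordan_bos[OF p])
  interpret U: basis_rep "{E0}" "\<lambda>i. 0" "\<lambda>i. 0" "\<lambda>i. Poly_Mapping.single i \<gamma>"
    "\<lambda>i. Poly_Mapping.single i (inverse \<gamma>)"
    using \<gamma> by unfold_locales (auto intro: span_on_closed)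
  let ?e = "Poly_Mapping.single E0 (1 :: 'k)"
  have e: "?e \<in> span_on {E0}" by (simp add: span_on_closed)
  have e0: "?e \<noteq> 0" by (metis lookup_single_eq lookup_zero one_neq_zero)
  have "sj.S_vector \<gamma> (ann U.M ?e) 1"
    using e act_simps(8)[OF U.left_module, of ?e "bos_of fg" "bos_scalar \<gamma>"]
    by (simp add: sj.S_vector_def ann_def U.act_letters)
  from S_ideal_subset[OF p ann_left_ideal[OF U.left_module] this] e
  have sub: "ann (mod_S \<gamma>) (S_gen \<gamma>) \<subseteq> ann U.M ?e" by simp
  have "1 \<notin> ann U.M ?e" using act_simps(4)[OF U.left_module, of ?e] e e0 by (simp add: ann_def)
  then show "1 \<notin> ann (mod_S \<gamma>) (S_gen \<gamma>)" using sub by blast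
  let ?L = "ann (mod_S \<gamma>) (S_gen \<gamma>)"
  have LI: "left_ideal ?L" by (rule ann_left_ideal[OF S_left_module S_module_simps(2)])
  note L' = left_idealD[OF LI]
  interpret I: ideal "S_ideal \<gamma>" alg_A by (rule ideal_S_ideal)
  have Lr: "a * b \<in> ?L" if "a \<in> ?L" for a b
    using that I.I_r_closed[OF _ coset] by (simp add: S_module_simps coset_simps)
  have "{to_A fs, to_A fx, to_A fy, to_A (fg - fscalar \<gamma>)} \<subseteq> S_ideal \<gamma>"
    unfolding S_ideal_def by (rule ring.genideal_self[OF ring_alg_A]) (auto simp: carrier_alg_A)
  then have "bos_of fx \<in> ?L" "bos_of fy \<in> ?L" "bos_of (fg - fscalar \<gamma>) \<in> ?L"
    by (simp_all add: S_module_simps)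
  then have gens: "bos_of fx \<in> ?L" "bos_of fy \<in> ?L" "bos_of fg - bos_scalar \<gamma> \<in> ?L"
    by (simp_all add: bos_of_minus bos_scalar_def)
  have hL: "bos_of fginv - bos_scalar (inverse \<gamma>) \<in> ?L"
  proof -
    have 1: "bos_of fginv * (bos_of fg - bos_scalar \<gamma>) = 1 - bos_scalar \<gamma> * bos_of fginv"
      by (simp add: right_diff_distrib sj.hg sj.\<sigma>'(5)[of \<gamma> "bos_of fginv"])
    have 2: "bos_scalar (inverse \<gamma>) * (bos_scalar \<gamma> * bos_of fginv) = bos_of fginv"
      using \<gamma> by (simp add: bos_scalar_simps(2) flip: mult.assoc bos_scalar_simps(4))
    have "bos_of fginv - bos_scalar (inverse \<gamma>) =
        - (bos_scalar (inverse \<gamma>) * (bos_of fginv * (bos_of fg - bos_scalar \<gamma>)))"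
      unfolding 1 by (simp add: right_diff_distrib 2)
    then show ?thesis using gens(3) L'(3,4) by simp
  qed
  have "{a. \<exists>c. a - bos_scalar c \<in> ?L} = UNIV"
  proof (rule bos_generated; (unfold mem_Collect_eq)?)
    show "\<exists>c. 1 - bos_scalar c \<in> ?L" using L'(1) by (intro exI[of _ 1]) (simp add: bos_scalar_simps)
    show "\<exists>c. a + b - bos_scalar c \<in> ?L" if ab: "\<exists>c. a - bos_scalar c \<in> ?L" "\<exists>c. b - bos_scalar c \<in> ?L" for a b
    proof -
      from ab obtain c d where "a - bos_scalar c \<in> ?L" "b - bos_scalar d \<in> ?L" by blast
      then have "(a - bos_scalar c) + (b - bos_scalar d) \<in> ?L" by (rule L'(2))
      then show ?thesis by (intro exI[of _ "c + d"]) (simp add: bos_scalar_simps algebra_simps)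
    qed
    \<comment> \<open>Closure of \<open>?L\<close> under right multiplication, a property of the
      two-sided ideal, puts \<open>(l - bos_scalar d) * a\<close> into \<open>?L\<close>.\<close>
    have mult: "\<exists>c. l * a - bos_scalar c \<in> ?L" if l: "l - bos_scalar d \<in> ?L" and a: "\<exists>c. a - bos_scalar c \<in> ?L" for l d a
    proof -
      from a obtain c where c: "a - bos_scalar c \<in> ?L" by blast
      have "(l - bos_scalar d) * a + bos_scalar d * (a - bos_scalar c) \<in> ?L"
        using L'(2) Lr[OF l] L'(3)[OF c] by blast
      then show ?thesis
        by (intro exI[of _ "d * c"]) (simp add: bos_scalar_simps left_diff_distrib right_diff_distrib)
    qed
    fix a assume a: "\<exists>c. a - bos_scalar c \<in> ?L"
    show "\<exists>d. bos_scalar c * a - bos_scalar d \<in> ?L" for c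
      by (rule mult[OF _ a, of _ c]) (simp add: L')
    show "\<exists>c. bos_of fx * a - bos_scalar c \<in> ?L" "\<exists>c. bos_of fy * a - bos_scalar c \<in> ?L"
      by (rule mult[OF _ a, of _ 0]; simp add: bos_scalar_simps gens)+
    show "\<exists>c. bos_of fg * a - bos_scalar c \<in> ?L" by (rule mult[OF gens(3) a])
    show "\<exists>c. bos_of fginv * a - bos_scalar c \<in> ?L" by (rule mult[OF hL a])
  qed
  then show "\<exists>c. a - bos_scalar c \<in> ?L" by blast
qed

lemma S_carrier:
  assumes p: "CHAR('k::alg_closed_field) = p" "p > 2" and \<gamma>: "\<gamma> \<noteq> (0 :: 'k)"
    and w: "w \<in> carrier (mod_S \<gamma>)"
  shows "\<exists>c. w = act (mod_S \<gamma>) (bos_scalar c) (S_gen \<gamma>)"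
proof -
  obtain a where a: "w = act (mod_S \<gamma>) a (S_gen \<gamma>)" using w S_module_simps(1) by blast
  then show ?thesis
    using S_one_dimensional(2)[OF p \<gamma>, of a] act_simps(8)[OF S_left_module S_module_simps(2)] by blast
qed

lemma S_gen_nonzero:
  assumes p: "CHAR('k::alg_closed_field) = p" "p > 2" and \<gamma>: "\<gamma> \<noteq> (0 :: 'k)"
  shows "S_gen \<gamma> \<noteq> \<zero>\<^bsub>mod_S \<gamma>\<^esub>"
  using S_one_dimensional(1)[OF p \<gamma>] act_simps(4)[OF S_left_module[of \<gamma>] S_module_simps(2)[of \<gamma>]]
  by (auto simp: ann_def)

lemma S_simple:
  assumes p: "CHAR('k::alg_closed_field) = p" "p > 2" and \<gamma>: "\<gamma> \<noteq> (0 :: 'k)"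
  shows "simple_module alg_A (mod_S \<gamma>)"
  unfolding simple_module_def
proof (intro conjI allI impI S_left_module)
  note a = act_simps[OF S_left_module[of \<gamma>] S_module_simps(2)[of \<gamma>]]
  show "carrier (mod_S \<gamma>) \<noteq> {\<zero>\<^bsub>mod_S \<gamma>\<^esub>}"
    using S_module_simps(2) S_gen_nonzero[OF p \<gamma>] by blast
  fix H assume H: "submodule H alg_A (mod_S \<gamma>)"
  note H' = H[unfolded submodule_iff[OF S_left_module]]
  show "H = {\<zero>\<^bsub>mod_S \<gamma>\<^esub>} \<or> H = carrier (mod_S \<gamma>)"
  proof (cases "H = {\<zero>\<^bsub>mod_S \<gamma>\<^esub>}")
    case False
    then obtain w where w: "w \<in> H" "w \<noteq> \<zero>\<^bsub>mod_S \<gamma>\<^esub>" using H' by blast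
    then obtain c where c: "w = act (mod_S \<gamma>) (bos_scalar c) (S_gen \<gamma>)"
      using S_carrier[OF p \<gamma>] H' by blast
    have c0: "c \<noteq> 0"
    proof
      assume "c = 0"
      then have "w = \<zero>\<^bsub>mod_S \<gamma>\<^esub>" by (simp only: c bos_scalar_simps(1) a(5))
      then show False using w(2) by blast
    qed
    have "act (mod_S \<gamma>) (bos_scalar (inverse c)) w \<in> H" using H' w(1) by blast
    also have "act (mod_S \<gamma>) (bos_scalar (inverse c)) w = S_gen \<gamma>"
    proof -
      have "bos_scalar (inverse c) * bos_scalar c = 1"
        using c0 by (simp add: bos_scalar_simps(2) flip: bos_scalar_simps(4))
      then show ?thesis by (simp only: c a(4) flip: a(3))
    qed
    finally have "S_gen \<gamma> \<in> H" .
    then have "carrier (mod_S \<gamma>) \<subseteq> H" using H' unfolding S_module_simps(1) by blast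
    then show ?thesis using H' by blast
  qed simp
qed

section \<open>The classification\<close>

text \<open>An infinite field is equipotent with its square, so the coordinates can be packed one by
  one into a single field element. With an injection of \<open>'k\<close> into the universe this
  makes room there for \<open>T\<close> and \<open>V\<close>.\<close>

lemma finite_dim_injection:
  assumes "infinite (UNIV :: 'k::field set)" "finite I"
  shows "\<exists>f :: ('i, 'k) vec \<Rightarrow> 'k. inj_on f (span_on I)"
  using assms(2)
proof (induction I rule: finite_induct)
  case empty
  have "span_on {} = {0 :: ('i, 'k) vec}" by (auto simp: span_on_def)
  then show ?case by simp
next
  case (insert i I)
  obtain f :: "('i, 'k) vec \<Rightarrow> 'k" where f: "inj_on f (span_on I)" using insert.IH by blast
  obtain e :: "'k \<times> 'k \<Rightarrow> 'k" where e: "inj e"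
    using card_of_Times_same_infinite[OF assms(1), unfolded card_of_ordIso[symmetric]]
    by (auto simp: bij_betw_def)
  let ?r = "\<lambda>u :: ('i, 'k) vec. u - Poly_Mapping.single i (Poly_Mapping.lookup u i)"
  have r: "?r u \<in> span_on I" if "u \<in> span_on (insert i I)" for u
    using that by (auto simp: span_on_def in_keys_iff lookup_minus lookup_single when_def split: if_splits)
  have "inj_on (\<lambda>u. e (Poly_Mapping.lookup u i, f (?r u))) (span_on (insert i I))"
  proof (rule inj_onI)
    fix u v assume uv: "u \<in> span_on (insert i I)" "v \<in> span_on (insert i I)"
      "e (Poly_Mapping.lookup u i, f (?r u)) = e (Poly_Mapping.lookup v i, f (?r v))"
    then have l: "Poly_Mapping.lookup u i = Poly_Mapping.lookup v i" "f (?r u) = f (?r v)"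
      using injD[OF e uv(3)] by auto
    then have "?r u = ?r v" using inj_onD[OF f l(2) r[OF uv(1)] r[OF uv(2)]] by simp
    then show "u = v" using l(1) by simp
  qed
  then show ?case by blast
qed

lemma iso_class_in_simple_classes:
  fixes N :: "('k::field free_alg set, 'n) module" and j :: "'n \<Rightarrow> 'u"
  assumes N: "simple_module alg_A N" and j: "inj_on j (carrier N)"
  shows "(iso_class alg_A N :: ('k free_alg set, 'u) module set) \<in> simple_classes alg_A"
proof -
  have lN: "left_module alg_A N" using N by (simp add: simple_module_def)
  obtain M :: "('k free_alg set, 'u) module" where M: "left_module alg_A M" "module_iso alg_A N M"
    using module_copy[OF lN j] by blast
  then have "simple_module alg_A M" using simple_module_iso[OF N] by blast
  moreover have "iso_class alg_A N = (iso_class alg_A M :: ('k free_alg set, 'u) module set)"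
    by (rule iso_class_eq[OF lN M(2)])
  ultimately show ?thesis unfolding simple_classes_def by blast
qed

theorem theorem4p5:
  fixes p :: nat
  assumes "CHAR('k::alg_closed_field) = p" and "p > 2"
    and universe: "\<exists>\<iota> :: 'k \<Rightarrow> 'u. inj \<iota>"
  shows "(simple_classes alg_A :: ('k free_alg set, 'u) module set set) =
    {iso_class alg_A (mod_S \<gamma>) | \<gamma>. \<gamma> \<noteq> 0} \<union>
    {iso_class alg_A (mod_T \<alpha> \<beta>) | \<alpha> \<beta>. \<alpha> \<noteq> 0 \<and> \<beta> \<noteq> 0} \<union>
    {iso_class alg_A (mod_V p \<alpha> \<beta> \<gamma>) | \<alpha> \<beta> \<gamma>. \<alpha> \<noteq> 0 \<and> \<beta> \<noteq> 0}"
    (is "_ = ?S \<union> ?T \<union> ?V")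
proof (intro equalityI subsetI)
  note p = assms(1,2)
  interpret sj: super_jordan_bosonization bos_scalar "bos_of fx :: 'k bos" "bos_of fy" "bos_of fg" "bos_of fginv" "bos_of fs" p
    by (rule super_jordan_bos[OF p])
  fix C :: "('k free_alg set, 'u) module set"
  assume "C \<in> simple_classes alg_A"
  then obtain M :: "('k free_alg set, 'u) module" where C: "C = iso_class alg_A M" and M: "simple_module alg_A M"
    unfolding simple_classes_def by blast
  have lM: "left_module alg_A M" using M by (simp add: simple_module_def)
  obtain u where u: "u \<in> carrier M" "u \<noteq> \<zero>\<^bsub>M\<^esub>"
    using M left_module_zero[OF lM] unfolding simple_module_def by blast
  let ?L = "ann M u"
  \<comment> \<open>One criterion for three families whose carriers have different types:
    \<open>act M m u\<close> is the image of the distinguished vector \<open>e\<close>, and its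
    annihilator is the shifted left ideal.\<close>
  have iso: "C = iso_class alg_A N"
    if N: "simple_module alg_A N" "e \<in> carrier N" "e \<noteq> \<zero>\<^bsub>N\<^esub>" and m: "m \<notin> ?L"
      and sub: "left_ideal {a. a * m \<in> ?L} \<Longrightarrow> ann N e \<subseteq> {a. a * m \<in> ?L}"
    for N :: "('k free_alg set, 'n) module" and e m
  proof -
    let ?v = "act M m u"
    have v: "?v \<in> carrier M" "?v \<noteq> \<zero>\<^bsub>M\<^esub>" using act_simps(1)[OF lM u(1)] m by (auto simp: ann_def)
    have "ann M ?v = {a. a * m \<in> ?L}" by (simp add: ann_def act_simps(3)[OF lM u(1)])
    then have "ann N e \<subseteq> ann M ?v" using sub ann_left_ideal[OF lM v(1)] by simp
    then have "module_iso alg_A N M" by (rule module_iso_if_ann_subset[OF N M v])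
    then show ?thesis unfolding C using N(1) iso_class_eq by (metis simple_module_def)
  qed
  have single: "Poly_Mapping.single i (1 :: 'k) \<noteq> 0" for i :: 'i
    by (metis lookup_single_eq lookup_zero one_neq_zero)
  from sj.simple_classification[OF ann_maximal(1)[OF M u]]
  show "C \<in> ?S \<union> ?T \<union> ?V"
  proof (elim disjE exE conjE)
    fix \<gamma> m assume \<gamma>: "\<gamma> \<noteq> 0" and m: "m \<notin> ?L" "sj.S_vector \<gamma> ?L m"
    have "C = iso_class alg_A (mod_S \<gamma>)"
      by (rule iso[OF S_simple[OF p \<gamma>] S_module_simps(2) S_gen_nonzero[OF p \<gamma>] m(1)])
        (rule S_ideal_subset[OF p], use m sj.vector_shift in auto)
    then show ?thesis using \<gamma> by blast
  next
    fix \<alpha> \<beta> m assume ab: "\<alpha> \<noteq> 0" "\<beta> \<noteq> 0" and m: "m \<notin> ?L" "sj.T_vector \<alpha> \<beta> ?L m"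
    have "C = iso_class alg_A (mod_T \<alpha> \<beta>)"
    proof (rule iso[OF T_simple[OF p ab] _ _ m(1)])
      show "basis_e E0 \<in> carrier (mod_T \<alpha> \<beta>)" "basis_e E0 \<noteq> \<zero>\<^bsub>mod_T \<alpha> \<beta>\<^esub>"
        by (simp_all add: mod_T_def basis_module_def span_on_closed single)
      show "ann (mod_T \<alpha> \<beta>) (basis_e E0) \<subseteq> {a. a * m \<in> ?L}" if "left_ideal {a. a * m \<in> ?L}"
        by (rule T_ann_subset[OF p ab(2) that]) (use m(2) sj.vector_shift in blast)
    qed
    then show ?thesis using ab by blast
  next
    fix \<alpha> \<beta> \<gamma> m assume ab: "\<alpha> \<noteq> 0" "\<beta> \<noteq> 0" and m: "m \<notin> ?L" "sj.V_vector \<alpha> \<beta> \<gamma> ?L m"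
    have V: "V_params p \<alpha> \<beta>" by (rule V_params.intro) (use p ab in auto)
    have "C = iso_class alg_A (mod_V p \<alpha> \<beta> \<gamma>)"
    proof (rule iso[OF V_params.V_simple[OF V] _ _ m(1)])
      show "basis_v 0 \<in> carrier (mod_V p \<alpha> \<beta> \<gamma>)" "basis_v 0 \<noteq> \<zero>\<^bsub>mod_V p \<alpha> \<beta> \<gamma>\<^esub>"
        using p by (simp_all add: mod_V_def basis_module_def span_on_closed single)
      show "ann (mod_V p \<alpha> \<beta> \<gamma>) (basis_v 0) \<subseteq> {a. a * m \<in> ?L}" if "left_ideal {a. a * m \<in> ?L}"
        by (rule V_ann_subset[OF V that]) (use m(2) sj.vector_shift in blast)
    qed
    then show ?thesis using ab by blast
  qed
next
  note p = assms(1,2)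
  \<comment> \<open>Each listed module must have a copy over \<open>'u\<close>, for otherwise its
    class would be empty and not the class of a simple module in the universe.\<close>
  obtain \<iota> :: "'k \<Rightarrow> 'u" where \<iota>: "inj \<iota>" using universe by blast
  have fin: "\<exists>j :: ('i, 'k) vec \<Rightarrow> 'u. inj_on j (span_on I)" if "finite I" for I :: "'i set"
    using finite_dim_injection[OF alg_closed_infinite that] \<iota> by (metis comp_inj_on inj_on_subset subset_UNIV)
  fix C :: "('k free_alg set, 'u) module set"
  assume "C \<in> ?S \<union> ?T \<union> ?V"
  then consider \<gamma> where "\<gamma> \<noteq> 0" "C = iso_class alg_A (mod_S \<gamma>)"
    | \<alpha> \<beta> where "\<alpha> \<noteq> 0" "\<beta> \<noteq> 0" "C = iso_class alg_A (mod_T \<alpha> \<beta>)"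
    | \<alpha> \<beta> \<gamma> where "\<alpha> \<noteq> 0" "\<beta> \<noteq> 0" "C = iso_class alg_A (mod_V p \<alpha> \<beta> \<gamma>)" by blast
  then show "C \<in> simple_classes alg_A"
  proof cases
    case 1
    \<comment> \<open>The carrier of \<open>mod_S \<gamma>\<close> consists of cosets rather than
      vectors; the coordinate with respect to \<open>S_gen \<gamma>\<close> embeds it into the
      field.\<close>
    define c where "c w = (SOME c. w = act (mod_S \<gamma>) (bos_scalar c) (S_gen \<gamma>))" for w
    have c: "w = act (mod_S \<gamma>) (bos_scalar (c w)) (S_gen \<gamma>)" if "w \<in> carrier (mod_S \<gamma>)" for w
      unfolding c_def using S_carrier[OF p 1(1) that] by (rule someI_ex)
    have "inj_on c (carrier (mod_S \<gamma>))" by (rule inj_onI) (metis c)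
    then have "inj_on (\<iota> \<circ> c) (carrier (mod_S \<gamma>))" using \<iota> by (metis comp_inj_on inj_on_subset subset_UNIV)
    then show ?thesis unfolding 1(2) by (rule iso_class_in_simple_classes[OF S_simple[OF p 1(1)]])
  next
    case 2
    have "finite (UNIV :: e_index set)"
      by (rule finite_subset[of _ "{E0, E1}"]) (auto intro: e_index.exhaust)
    then obtain j :: "(e_index, 'k) vec \<Rightarrow> 'u" where "inj_on j (span_on UNIV)" using fin by blast
    then have "inj_on j (carrier (mod_T \<alpha> \<beta>))" by (simp add: mod_T_def basis_module_def)
    then show ?thesis unfolding 2(3) by (rule iso_class_in_simple_classes[OF T_simple[OF p 2(1,2)]])
  next
    case 3
    have V: "V_params p \<alpha> \<beta>" by (rule V_params.intro) (use p 3 in auto)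
    obtain j :: "(vw, 'k) vec \<Rightarrow> 'u" where "inj_on j (span_on (V_index ` {0..<p} \<union> W_index ` {0..<p}))"
      using fin[of "V_index ` {0..<p} \<union> W_index ` {0..<p}"] by auto
    then have "inj_on j (carrier (mod_V p \<alpha> \<beta> \<gamma>))" by (simp add: mod_V_def basis_module_def)
    then show ?thesis unfolding 3(3) by (rule iso_class_in_simple_classes[OF V_params.V_simple[OF V]])
  qed
qed

end
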